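(* For any central hyperplane arrangement $\mathcal{A}$, $$\Sigma^1(\mathcal{A})=S(\mathcal{A})\setminus\big(S(\overline{\mathcal{A}})\setminus\Sigma^1(\overline{\mathcal{A}})\big).$$ In particular, $S(\mathcal{A})\setminus S(\overline{\mathcal{A}})\subseteq\Sigma^1(\mathcal{A})$.
   Context: A (central) hyperplane arrangement $\mathcal{A}$ is a finite collection of codimension $1$ linear subspaces of $\mathbb{C}^\ell$; put $n=|\mathcal{A}|$. Its complement is $X(\mathcal{A})=\mathbb{C}^\ell\setminus\bigcup_{H\in\mathcal{A}}H$. The projectivization is $\overline{\mathcal{A}}=\{\mathbb{P}(H)\}_{H\in\mathcal{A}}$, with complement $X(\overline{\mathcal{A}})$ in $\mathbb{CP}^{\ell-1}$. Restriction of the $\mathbb{C}^\times$-action gives a trivial bundle $\mathbb{C}^\times\to X(\mathcal{A})\to X(\overline{\mathcal{A}})$, so $X(\mathcal{A})\cong X(\overline{\mathcal{A}})\times\mathbb{C}^\times$. For a connected CW-complex $X$ with finite $1$-skeleton and $G=\pi_1(X)$: $S(X)=(H^1(X,\mathbb{R})\setminus\{0\})/\mathbb{R}^+$, identified with the unit sphere in $H^1(X,\mathbb{R})=\mathrm{Hom}(G,\mathbb{R})$. For $\chi\in S(X)$ let $G_\chi=\{g\in G:\chi(g)\ge 0\}$. A non-negatively graded chain complex $C$ over a ring $R$ is of finite $1$-type if there is a chain complex $C'$ of finitely generated projective $R$-modules and a chain map $C'\to C$ inducing an isomorphism on $H_0$ and an epimorphism on $H_1$. Then $\Sigma^1(X,\mathbb{Z})=\{\chi\in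 S(X) : C_*(\widetilde X,\mathbb{Z}) \text{ is of finite } 1\text{-type over } \mathbb{Z}G_\chi\}$, with $C_*(\widetilde X,\mathbb{Z})$ the cellular chain complex of the universal cover (a homotopy invariant of $X$). Write $S(\mathcal{A})=S(X(\mathcal{A}))$, $\Sigma^1(\mathcal{A})=\Sigma^1(X(\mathcal{A}),\mathbb{Z})$, $S(\overline{\mathcal{A}})=S(X(\overline{\mathcal{A}}))$, $\Sigma^1(\overline{\mathcal{A}})=\Sigma^1(X(\overline{\mathcal{A}}),\mathbb{Z})$. Using the basis of $H^1(X(\mathcal{A}),\mathbb{R})=\mathbb{R}^n$ dual to the meridians around the hyperplanes, $S(\mathcal{A})=S^{n-1}$, and $S(\overline{\mathcal{A}})$ is identified, via pullback along $X(\mathcal{A})\to X(\overline{\mathcal{A}})$, with the great sphere $\{\chi\in S^{n-1} : \sum_{j=1}^n\chi_j=0\}$; $\Sigma^1(\overline{\mathcal{A}})$ is thereby viewed as a subset of $S(\mathcal{A})$. *)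

theory Defs
  imports "HOL-Analysis.Analysis" "HOL-Algebra.AbelCoset" "HOL-Algebra.Module" "HOL-Homology.Homology"
begin

section \<open>Fundamental group and universal cover\<close>

definition path_homotopic :: "'a topology \<Rightarrow> (real \<Rightarrow> 'a) \<Rightarrow> (real \<Rightarrow> 'a) \<Rightarrow> bool" where
  "path_homotopic X p q \<longleftrightarrow>
     homotopic_with (\<lambda>h. h 0 = p 0 \<and> h 1 = p 1) (top_of_set {0..1}) X p q"

text \<open>The library's \<open>(+++)\<close> is restricted to types of class \<open>topological_space\<close>; the points of
  projective space below are sets, so concatenation is needed for arbitrary types.\<close>

definition path_concat :: "(real \<Rightarrow> 'a) \<Rightarrow> (real \<Rightarrow> 'a) \<Rightarrow> real \<Rightarrow> 'a" where
  "path_concat p q = (\<lambda>t. if t \<le> 1/2 then p (2 * t) else q (2 * t - 1))"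

definition path_class :: "'a topology \<Rightarrow> (real \<Rightarrow> 'a) \<Rightarrow> (real \<Rightarrow> 'a) set" where
  "path_class X p = {q. path_homotopic X p q}"

definition class_concat ::
    "'a topology \<Rightarrow> (real \<Rightarrow> 'a) set \<Rightarrow> (real \<Rightarrow> 'a) set \<Rightarrow> (real \<Rightarrow> 'a) set" where
  "class_concat X a b = (\<Union>p\<in>a. \<Union>q\<in>b. path_class X (path_concat p q))"

definition pi1 :: "'a topology \<Rightarrow> 'a \<Rightarrow> (real \<Rightarrow> 'a) set monoid" where
  "pi1 X x0 =
     \<lparr>carrier = {path_class X p | p. pathin X p \<and> p 0 = x0 \<and> p 1 = x0},
      monoid.mult = class_concat X,
      one = path_class X (\<lambda>_. x0)\<rparr>"

definition pi1_map :: "'b topology \<Rightarrow> ('a \<Rightarrow> 'b) \<Rightarrow> (real \<Rightarrow> 'a) set \<Rightarrow> (real \<Rightarrow> 'b) set" where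
  "pi1_map Y f a = (\<Union>p\<in>a. path_class Y (f \<circ> p))"

text \<open>The standard model of the universal cover (of a path connected, locally path connected and
  semilocally simply connected space): homotopy classes of paths issuing from the base point.
  A basic neighbourhood of the class of \<open>p\<close> consists of the classes of all continuations of \<open>p\<close>
  by paths inside an open set \<open>U\<close>. The fundamental group acts on the left by \<open>class_concat X\<close>.\<close>

definition universal_cover :: "'a topology \<Rightarrow> 'a \<Rightarrow> (real \<Rightarrow> 'a) set topology" where
  "universal_cover X x0 = topology_generated_by
     {{path_class X (path_concat p q) | q. pathin (subtopology X U) q \<and> q 0 = p 1} | p U.
        pathin X p \<and> p 0 = x0 \<and> openin X U \<and> p 1 \<in> U}"


section \<open>The character sphere\<close>

definition real_add_group :: "real monoid" where
  "real_add_group = \<lparr>carrier = UNIV, monoid.mult = (+), one = 0\<rparr>"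

text \<open>\<open>H\<^sup>1(X, \<real>)\<close> as \<open>Hom(\<pi>\<^sub>1 X, \<real>)\<close>; extensionality makes characters equal as functions
  when they agree on the group.\<close>

definition H1_real :: "'a topology \<Rightarrow> 'a \<Rightarrow> ((real \<Rightarrow> 'a) set \<Rightarrow> real) set" where
  "H1_real X x0 = hom (pi1 X x0) real_add_group \<inter> extensional (carrier (pi1 X x0))"

definition zero_char :: "'a topology \<Rightarrow> 'a \<Rightarrow> (real \<Rightarrow> 'a) set \<Rightarrow> real" where
  "zero_char X x0 = (\<lambda>g\<in>carrier (pi1 X x0). 0)"

definition char_ray ::
    "'a topology \<Rightarrow> 'a \<Rightarrow> ((real \<Rightarrow> 'a) set \<Rightarrow> real) \<Rightarrow> ((real \<Rightarrow> 'a) set \<Rightarrow> real) set" where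
  "char_ray X x0 \<phi> = {(\<lambda>g\<in>carrier (pi1 X x0). c * \<phi> g) | c. 0 < c}"

text \<open>\<open>S(X)\<close> as the set of orbits of the positive reals on the nonzero characters.\<close>

definition char_sphere :: "'a topology \<Rightarrow> 'a \<Rightarrow> ((real \<Rightarrow> 'a) set \<Rightarrow> real) set set" where
  "char_sphere X x0 = char_ray X x0 ` (H1_real X x0 - {zero_char X x0})"

definition pullback_char ::
    "'a topology \<Rightarrow> 'a \<Rightarrow> 'b topology \<Rightarrow> ('a \<Rightarrow> 'b) \<Rightarrow>
     ((real \<Rightarrow> 'b) set \<Rightarrow> real) \<Rightarrow> (real \<Rightarrow> 'a) set \<Rightarrow> real" where
  "pullback_char X x0 Y f \<phi> = (\<lambda>g\<in>carrier (pi1 X x0). \<phi> (pi1_map Y f g))"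

definition pullback_ray ::
    "'a topology \<Rightarrow> 'a \<Rightarrow> 'b topology \<Rightarrow> ('a \<Rightarrow> 'b) \<Rightarrow>
     ((real \<Rightarrow> 'b) set \<Rightarrow> real) set \<Rightarrow> ((real \<Rightarrow> 'a) set \<Rightarrow> real) set" where
  "pullback_ray X x0 Y f r = pullback_char X x0 Y f ` r"


section \<open>Modules over a noncommutative ring\<close>

text \<open>The library's locale \<open>module\<close> requires a commutative ring of scalars, so left modules are
  introduced here, on the library's record type \<open>module\<close>. The fields \<open>mult\<close> and \<open>one\<close> of that
  record are never used.\<close>

definition left_module :: "'r ring \<Rightarrow> ('r, 'm) module \<Rightarrow> bool" where
  "left_module R M \<longleftrightarrow> ring R \<and> abelian_group M \<and>
     (\<forall>r\<in>carrier R. \<forall>x\<in>carrier M. r \<odot>\<^bsub>M\<^esub> x \<in> carrier M) \<and>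
     (\<forall>r\<in>carrier R. \<forall>s\<in>carrier R. \<forall>x\<in>carrier M.
        (r \<oplus>\<^bsub>R\<^esub> s) \<odot>\<^bsub>M\<^esub> x = r \<odot>\<^bsub>M\<^esub> x \<oplus>\<^bsub>M\<^esub> s \<odot>\<^bsub>M\<^esub> x) \<and>
     (\<forall>r\<in>carrier R. \<forall>x\<in>carrier M. \<forall>y\<in>carrier M.
        r \<odot>\<^bsub>M\<^esub> (x \<oplus>\<^bsub>M\<^esub> y) = r \<odot>\<^bsub>M\<^esub> x \<oplus>\<^bsub>M\<^esub> r \<odot>\<^bsub>M\<^esub> y) \<and>
     (\<forall>r\<in>carrier R. \<forall>s\<in>carrier R. \<forall>x\<in>carrier M.
        (r \<otimes>\<^bsub>R\<^esub> s) \<odot>\<^bsub>M\<^esub> x = r \<odot>\<^bsub>M\<^esub> (s \<odot>\<^bsub>M\<^esub> x)) \<and>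
     (\<forall>x\<in>carrier M. \<one>\<^bsub>R\<^esub> \<odot>\<^bsub>M\<^esub> x = x)"

definition linear_hom :: "'r ring \<Rightarrow> ('r, 'm) module \<Rightarrow> ('r, 'n) module \<Rightarrow> ('m \<Rightarrow> 'n) set" where
  "linear_hom R M N = {f \<in> carrier M \<rightarrow> carrier N.
     (\<forall>x\<in>carrier M. \<forall>y\<in>carrier M. f (x \<oplus>\<^bsub>M\<^esub> y) = f x \<oplus>\<^bsub>N\<^esub> f y) \<and>
     (\<forall>r\<in>carrier R. \<forall>x\<in>carrier M. f (r \<odot>\<^bsub>M\<^esub> x) = r \<odot>\<^bsub>N\<^esub> f x)}"

definition free_left_module :: "'r ring \<Rightarrow> 'i set \<Rightarrow> ('r, 'i \<Rightarrow> 'r) module" where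
  "free_left_module R I =
     \<lparr>carrier = {f. (\<forall>i. f i \<in> carrier R) \<and> (\<forall>i. i \<notin> I \<longrightarrow> f i = \<zero>\<^bsub>R\<^esub>) \<and>
                    finite {i. f i \<noteq> \<zero>\<^bsub>R\<^esub>}},
      monoid.mult = undefined, one = undefined,
      zero = (\<lambda>i. \<zero>\<^bsub>R\<^esub>), add = (\<lambda>f g i. f i \<oplus>\<^bsub>R\<^esub> g i),
      smult = (\<lambda>r f i. r \<otimes>\<^bsub>R\<^esub> f i)\<rparr>"

definition fin_gen_module :: "'r ring \<Rightarrow> ('r, 'm) module \<Rightarrow> bool" where
  "fin_gen_module R M \<longleftrightarrow> left_module R M \<and>
     (\<exists>B. finite B \<and> B \<subseteq> carrier M \<and>
        (\<forall>x\<in>carrier M. \<exists>c\<in>B \<rightarrow> carrier R. x = (\<Oplus>\<^bsub>M\<^esub>b\<in>B. c b \<odot>\<^bsub>M\<^esub> b)))"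

text \<open>Projective: a direct summand of a free module. Index sets of the type of the elements of
  \<open>M\<close> suffice, since \<open>M\<close> is a quotient of the free module on its own carrier.\<close>

definition projective_module :: "'r ring \<Rightarrow> ('r, 'm) module \<Rightarrow> bool" where
  "projective_module R M \<longleftrightarrow> left_module R M \<and>
     (\<exists>(I :: 'm set) i q.
        i \<in> linear_hom R M (free_left_module R I) \<and>
        q \<in> linear_hom R (free_left_module R I) M \<and>
        (\<forall>x\<in>carrier M. q (i x) = x))"


section \<open>Chain complexes of finite 1-type\<close>

text \<open>Non-negatively graded complexes; \<open>diff C p\<close> goes from degree \<open>p + 1\<close> to degree \<open>p\<close>.\<close>

record ('r, 'm) chain_cx =
  obj :: "nat \<Rightarrow> ('r, 'm) module"
  diff :: "nat \<Rightarrow> 'm \<Rightarrow> 'm"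

definition is_chain_cx :: "'r ring \<Rightarrow> ('r, 'm) chain_cx \<Rightarrow> bool" where
  "is_chain_cx R C \<longleftrightarrow>
     (\<forall>p. left_module R (obj C p)) \<and>
     (\<forall>p. diff C p \<in> linear_hom R (obj C (Suc p)) (obj C p)) \<and>
     (\<forall>p. \<forall>x\<in>carrier (obj C (Suc (Suc p))). diff C p (diff C (Suc p) x) = \<zero>\<^bsub>obj C p\<^esub>)"

definition is_chain_map ::
    "'r ring \<Rightarrow> ('r, 'm) chain_cx \<Rightarrow> ('r, 'n) chain_cx \<Rightarrow> (nat \<Rightarrow> 'm \<Rightarrow> 'n) \<Rightarrow> bool" where
  "is_chain_map R C D f \<longleftrightarrow>
     (\<forall>p. f p \<in> linear_hom R (obj C p) (obj D p)) \<and>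
     (\<forall>p. \<forall>x\<in>carrier (obj C (Suc p)). f p (diff C p x) = diff D p (f (Suc p) x))"

fun cycles :: "('r, 'm) chain_cx \<Rightarrow> nat \<Rightarrow> 'm set" where
  "cycles C 0 = carrier (obj C 0)"
| "cycles C (Suc p) = {x \<in> carrier (obj C (Suc p)). diff C p x = \<zero>\<^bsub>obj C p\<^esub>}"

definition boundaries :: "('r, 'm) chain_cx \<Rightarrow> nat \<Rightarrow> 'm set" where
  "boundaries C p = diff C p ` carrier (obj C (Suc p))"

definition hclass :: "('r, 'm) chain_cx \<Rightarrow> nat \<Rightarrow> 'm \<Rightarrow> 'm set" where
  "hclass C p x = boundaries C p +>\<^bsub>obj C p\<^esub> x"

definition homology :: "('r, 'm) chain_cx \<Rightarrow> nat \<Rightarrow> 'm set set" where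
  "homology C p = hclass C p ` cycles C p"

definition homology_map :: "('r, 'n) chain_cx \<Rightarrow> (nat \<Rightarrow> 'm \<Rightarrow> 'n) \<Rightarrow> nat \<Rightarrow> 'm set \<Rightarrow> 'n set" where
  "homology_map D f p a = (\<Union>x\<in>a. hclass D p (f p x))"

text \<open>Elements of \<open>C'\<close> may be taken of type \<open>nat \<Rightarrow> 'r\<close>: every finitely generated projective
  module is isomorphic to a submodule of some finite power of \<open>R\<close>. The map induced on homology is
  a homomorphism, so it is an isomorphism (epimorphism) iff it is bijective (surjective).\<close>

definition finite_1_type :: "'r ring \<Rightarrow> ('r, 'm) chain_cx \<Rightarrow> bool" where
  "finite_1_type R C \<longleftrightarrow>
     (\<exists>(C' :: ('r, nat \<Rightarrow> 'r) chain_cx) f.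
        is_chain_cx R C' \<and>
        (\<forall>p. fin_gen_module R (obj C' p) \<and> projective_module R (obj C' p)) \<and>
        is_chain_map R C' C f \<and>
        bij_betw (homology_map C f 0) (homology C' 0) (homology C 0) \<and>
        homology_map C f 1 ` homology C' 1 = homology C 1)"


section \<open>The invariant \<open>\<Sigma>\<^sup>1(X, \<int>)\<close>\<close>

text \<open>The ring \<open>\<int>G\<close> of a monoid \<open>G\<close>, on the free abelian group of the underlying set. (The product
  of the library's type of finitely supported functions is unavailable here: it needs a monoid
  structure on the type of the support.)\<close>

definition monoid_ring :: "('g, 'b) monoid_scheme \<Rightarrow> ('g \<Rightarrow>\<^sub>0 int) ring" where
  "monoid_ring G =
     \<lparr>carrier = {a. Poly_Mapping.keys a \<subseteq> carrier G},
      monoid.mult = (\<lambda>a b. frag_extend (\<lambda>g. frag_extend (\<lambda>h. frag_of (g \<otimes>\<^bsub>G\<^esub> h)) b) a),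
      one = frag_of \<one>\<^bsub>G\<^esub>, zero = 0, add = (+)\<rparr>"

definition nonneg_submonoid ::
    "'a topology \<Rightarrow> 'a \<Rightarrow> ((real \<Rightarrow> 'a) set \<Rightarrow> real) \<Rightarrow> (real \<Rightarrow> 'a) set monoid" where
  "nonneg_submonoid X x0 \<phi> = (pi1 X x0) \<lparr>carrier := {g \<in> carrier (pi1 X x0). 0 \<le> \<phi> g}\<rparr>"

text \<open>The complex \<open>C\<^sub>*(X~, \<int>)\<close> with its left action of \<open>\<int>\<pi>\<^sub>1(X)\<close>, and hence of every subring.
  Singular chains are used, because the spaces of interest come without a cell structure; for a CW
  complex the singular and the cellular chain complexes of the universal cover are chain homotopy
  equivalent over \<open>\<int>\<pi>\<^sub>1(X)\<close>, and being of finite 1-type is invariant under such equivalences.\<close>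

definition ucover_chains ::
    "'a topology \<Rightarrow> 'a \<Rightarrow> ((real \<Rightarrow> 'a) set \<Rightarrow>\<^sub>0 int, (real \<Rightarrow> 'a) set chain) chain_cx" where
  "ucover_chains X x0 =
     \<lparr>obj = (\<lambda>p.
        \<lparr>carrier = singular_chain_set p (universal_cover X x0),
         monoid.mult = undefined, one = undefined, zero = 0, add = (+),
         smult = (\<lambda>r c. frag_extend (\<lambda>g. chain_map p (class_concat X g) c) r)\<rparr>),
      diff = (\<lambda>p. chain_boundary (Suc p))\<rparr>"

text \<open>The submonoid \<open>G\<^sub>\<phi>\<close> depends only on the ray of \<open>\<phi>\<close>.\<close>

definition Sigma1 :: "'a topology \<Rightarrow> 'a \<Rightarrow> ((real \<Rightarrow> 'a) set \<Rightarrow> real) set set" where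
  "Sigma1 X x0 = {char_ray X x0 \<phi> | \<phi>. \<phi> \<in> H1_real X x0 - {zero_char X x0} \<and>
     finite_1_type (monoid_ring (nonneg_submonoid X x0 \<phi>)) (ucover_chains X x0)}"


section \<open>Central hyperplane arrangements\<close>

text \<open>The prefix \<open>vec\<close> selects the structure of a vector space over the complex numbers;
  the unqualified \<open>subspace\<close>, \<open>dim\<close>, \<open>span\<close> refer to the underlying real vector space.\<close>

definition central_arrangement :: "(complex ^ 'n) set set \<Rightarrow> bool" where
  "central_arrangement A \<longleftrightarrow>
     finite A \<and> (\<forall>H\<in>A. vec.subspace H \<and> Suc (vec.dim H) = CARD('n))"

definition arr_compl :: "(complex ^ 'n) set set \<Rightarrow> (complex ^ 'n) topology" where
  "arr_compl A = top_of_set (UNIV - \<Union>A)"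

definition proj_pt :: "complex ^ 'n \<Rightarrow> (complex ^ 'n) set" where
  "proj_pt v = vec.span {v}"

text \<open>Points of projective space are the complex lines through the origin; the topology is the
  quotient topology.\<close>

definition proj_space :: "(complex ^ 'n) set topology" where
  "proj_space = topology (\<lambda>U. U \<subseteq> proj_pt ` (UNIV - {0}) \<and> open {v. v \<noteq> 0 \<and> proj_pt v \<in> U})"

lemma openin_proj_space:
  "openin proj_space U \<longleftrightarrow>
     U \<subseteq> proj_pt ` (UNIV - {0}) \<and> open {v. v \<noteq> 0 \<and> proj_pt v \<in> U}"
proof -
  have 1: "{v. v \<noteq> 0 \<and> proj_pt v \<in> S \<inter> T} =
      {v. v \<noteq> 0 \<and> proj_pt v \<in> S} \<inter> {v. v \<noteq> 0 \<and> proj_pt v \<in> T}"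
    for S T :: "(complex ^ 'n) set set" by blast
  have 2: "{v. v \<noteq> 0 \<and> proj_pt v \<in> \<Union>K} = (\<Union>S\<in>K. {v. v \<noteq> 0 \<and> proj_pt v \<in> S})"
    for K :: "(complex ^ 'n) set set set" by blast
  have "istopology (\<lambda>U :: (complex ^ 'n) set set.
          U \<subseteq> proj_pt ` (UNIV - {0}) \<and> open {v. v \<noteq> 0 \<and> proj_pt v \<in> U})"
    unfolding istopology_def 1 2
    by (intro conjI allI impI; (elim conjE)?; (intro open_Int open_UN ballI)?; blast)
  then show ?thesis
    unfolding proj_space_def by (rule topology_inverse'[THEN fun_cong])
qed

definition proj_of_subspace :: "(complex ^ 'n) set \<Rightarrow> (complex ^ 'n) set set" where
  "proj_of_subspace H = proj_pt ` (H - {0})"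

definition proj_arr_compl :: "(complex ^ 'n) set set \<Rightarrow> (complex ^ 'n) set topology" where
  "proj_arr_compl A =
     subtopology proj_space (topspace proj_space - (\<Union>H\<in>A. proj_of_subspace H))"

definition S_arr ::
    "(complex ^ 'n) set set \<Rightarrow> complex ^ 'n \<Rightarrow> ((real \<Rightarrow> complex ^ 'n) set \<Rightarrow> real) set set" where
  "S_arr A x0 = char_sphere (arr_compl A) x0"

definition Sigma1_arr ::
    "(complex ^ 'n) set set \<Rightarrow> complex ^ 'n \<Rightarrow> ((real \<Rightarrow> complex ^ 'n) set \<Rightarrow> real) set set" where
  "Sigma1_arr A x0 = Sigma1 (arr_compl A) x0"

text \<open>The sphere and the invariant of the projectivized arrangement, viewed as subsets of
  \<open>S_arr A x0\<close> by pullback along the projection from the complement to its projectivization. The base point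
  \<open>x0\<close> has to be nonzero for \<open>proj_pt x0\<close> to be a point of projective space; this is automatic
  unless \<open>A\<close> is empty, when both spheres are empty.\<close>

definition S_proj_arr ::
    "(complex ^ 'n) set set \<Rightarrow> complex ^ 'n \<Rightarrow> ((real \<Rightarrow> complex ^ 'n) set \<Rightarrow> real) set set" where
  "S_proj_arr A x0 =
     pullback_ray (arr_compl A) x0 (proj_arr_compl A) proj_pt `
       char_sphere (proj_arr_compl A) (proj_pt x0)"

definition Sigma1_proj_arr ::
    "(complex ^ 'n) set set \<Rightarrow> complex ^ 'n \<Rightarrow> ((real \<Rightarrow> complex ^ 'n) set \<Rightarrow> real) set set" where
  "Sigma1_proj_arr A x0 =
     pullback_ray (arr_compl A) x0 (proj_arr_compl A) proj_pt `
       Sigma1 (proj_arr_compl A) (proj_pt x0)"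

end

theory Submission
  imports Defs
begin

text \<open>The singular chain complex of the universal cover has \<open>H\<^sub>0 = \<int>\<close> and \<open>H\<^sub>1 = 0\<close>, so it is of
  finite 1-type over \<open>\<int>G\<^sub>\<phi>\<close> iff the trivial module \<open>\<int>\<close> is finitely presented, i.e. iff finitely many
  elements of \<open>G\<^sub>\<phi>\<close> suffice to connect the half-space \<open>\<phi> \<ge> 0\<close> of the Cayley graph. This turns the
  invariant into a property of the pair \<open>(G, \<phi>)\<close>. The complement is a product of its projectivization
  and \<open>\<complex>\<^sup>*\<close>, the loop \<open>c\<close> of which is central. If \<open>\<phi> c \<noteq> 0\<close>, one can escape from the boundary of the
  half-space along \<open>c\<close>, and the half-space is connected because \<open>G\<close> is finitely generated: the
  complement is a finite union of convex open sets, cut out by conditions \<open>Re (w * \<ell> v) > 0\<close> with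
  \<open>w\<close> a fourth root of unity and \<open>\<ell>\<close> a defining functional. If \<open>\<phi> c = 0\<close>, then \<open>\<phi>\<close> is pulled back from
  the projectivization, and paths in half-spaces are pushed down and lifted along the central
  extension by \<open>c\<close>.\<close>

section \<open>The path groupoid\<close>

text \<open>A point of the universal cover is a path class, so it carries its own path from the base
  point. Coning along these paths computes \<open>H\<^sub>0\<close> directly. For
  \<open>H\<^sub>1\<close> one needs that a path in the cover is the lift of its own projection, and
  this is where semilocal simple connectedness enters.

  The passage from graphs to modules rests on the identity hs - h = h(s - 1): a path in the
  half-space writes g - 1 as a combination of the elements s - 1. The converse is harder, because a
  complex witnessing finite 1-type is abstract and its chain map sends generators to chains over
  arbitrary points of the space. An equivariant retraction moves those points into the group, a
  translation moves the finitely many resulting group elements into the half-space, and functionals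
  replace explicit linear algebra.

  The value of a character on \<open>cloop\<close> is the sum of its meridian coordinates, because
  this loop winds once around each hyperplane. So the two cases of the argument are the complement
  of the great sphere and the great sphere itself.\<close>

lemma path_homotopicD:
  assumes "path_homotopic X p q"
  shows "pathin X p" "pathin X q" "q 0 = p 0" "q 1 = p 1"
  using homotopic_with_imp_continuous_maps[OF assms[unfolded path_homotopic_def]]
    homotopic_with_imp_property[OF assms[unfolded path_homotopic_def]]
  by (auto simp: pathin_def)

lemma path_homotopic_refl: "pathin X p \<Longrightarrow> path_homotopic X p p"
  by (simp add: path_homotopic_def pathin_def)

lemma path_homotopic_sym: "path_homotopic X p q \<Longrightarrow> path_homotopic X q p"
proof -
  assume a: "path_homotopic X p q"
  have "homotopic_with (\<lambda>h. h 0 = p 0 \<and> h 1 = p 1) (top_of_set {0..1}) X q p"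
    using a unfolding path_homotopic_def by (rule homotopic_with_symD)
  then show ?thesis
    unfolding path_homotopic_def using path_homotopicD[OF a] by simp
qed

lemma path_homotopic_trans:
  "path_homotopic X p q \<Longrightarrow> path_homotopic X q r \<Longrightarrow> path_homotopic X p r"
proof -
  assume a: "path_homotopic X p q" and b: "path_homotopic X q r"
  have "homotopic_with (\<lambda>h. h 0 = p 0 \<and> h 1 = p 1) (top_of_set {0..1}) X q r"
    using b path_homotopicD[OF a] unfolding path_homotopic_def by simp
  then show ?thesis
    using a unfolding path_homotopic_def by (blast intro: homotopic_with_trans)
qed

lemma path_class_eq_iff:
  assumes "pathin X p"
  shows "path_class X p = path_class X q \<longleftrightarrow> path_homotopic X p q"
proof
  assume "path_class X p = path_class X q"
  then have "p \<in> path_class X q"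
    using assms by (auto simp: path_class_def path_homotopic_refl)
  then show "path_homotopic X p q"
    by (simp add: path_class_def path_homotopic_sym)
next
  assume "path_homotopic X p q"
  then show "path_class X p = path_class X q"
    unfolding path_class_def by (blast intro: path_homotopic_sym path_homotopic_trans)
qed

lemma mem_path_class: "pathin X p \<Longrightarrow> p \<in> path_class X p"
  by (simp add: path_class_def path_homotopic_refl)

lemma path_class_ends:
  assumes "pathin X p" "path_class X p = path_class X q"
  shows "pathin X q" "q 0 = p 0" "q 1 = p 1"
  using path_homotopicD assms path_class_eq_iff by metis+

text \<open>Paths are total functions on the reals, but a homotopy class sees only their values on
  the unit interval.\<close>

lemma path_class_cong:
  assumes "pathin X p" "\<And>t. t \<in> {0..1} \<Longrightarrow> p t = q t"
  shows "path_class X p = path_class X q"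
  unfolding path_class_eq_iff[OF assms(1)] path_homotopic_def
  by (rule homotopic_with_equal) (use assms in \<open>auto simp: pathin_def\<close>)

text \<open>The image under \<open>F\<close> of a straight-line homotopy. Nearly all explicit
  homotopies below are instances with a suitable convex parameter space \<open>K\<close>: the unit
  interval, a triangle, a square, the complex plane or a member of a convex cover.\<close>

lemma path_class_convex:
  fixes p q :: "real \<Rightarrow> 'b::real_normed_vector"
  assumes F: "continuous_map (top_of_set K) X F" and K: "convex K"
    and p: "continuous_on {0..1} p" "p ` {0..1} \<subseteq> K"
    and q: "continuous_on {0..1} q" "q ` {0..1} \<subseteq> K"
    and "p 0 = q 0" "p 1 = q 1"
  shows "path_class X (F \<circ> p) = path_class X (F \<circ> q)"
proof -
  let ?h = "\<lambda>z. F ((1 - fst z) *\<^sub>R p (snd z) + fst z *\<^sub>R q (snd z))"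
  have c: "continuous_map (top_of_set ({0..1} \<times> {0..1})) (top_of_set K)
      (\<lambda>z. (1 - fst z) *\<^sub>R p (snd z) + fst z *\<^sub>R q (snd z))"
  proof -
    have "continuous_on ({0..1} \<times> {0..1}) (\<lambda>z. (1 - fst z) *\<^sub>R p (snd z) + fst z *\<^sub>R q (snd z))"
    proof -
      have 1: "continuous_on ({0..1::real} \<times> {0..1}) (\<lambda>z. p (snd z))"
        and 2: "continuous_on ({0..1::real} \<times> {0..1}) (\<lambda>z. q (snd z))"
        by (rule continuous_on_compose2[OF p(1) continuous_on_snd[OF continuous_on_id]]
            continuous_on_compose2[OF q(1) continuous_on_snd[OF continuous_on_id]]; force)+
      show ?thesis
        by (intro continuous_on_add continuous_on_scaleR continuous_on_diff continuous_on_const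
            continuous_on_fst continuous_on_id 1 2)
    qed
    moreover have "(1 - s) *\<^sub>R p t + s *\<^sub>R q t \<in> K" if "s \<in> {0..1}" "t \<in> {0..1}" for s t
    proof -
      have "p t \<in> K" "q t \<in> K" using p q that by blast+
      then show ?thesis using convexD_alt[OF K, of "p t" "q t" s] that by simp
    qed
    ultimately show ?thesis
      by auto
  qed
  have "path_homotopic X (F \<circ> p) (F \<circ> q)"
    unfolding path_homotopic_def homotopic_with_def
  proof (intro exI[of _ ?h] conjI allI ballI)
    show "continuous_map (prod_topology (top_of_set {0..1}) (top_of_set {0..1})) X ?h"
      using continuous_map_compose[OF c F] by (simp add: o_def)
  qed (use assms in \<open>auto simp: algebra_simps simp flip: scaleR_add_left\<close>)
  moreover have "pathin X (F \<circ> p)"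
    unfolding pathin_def by (rule continuous_map_compose[OF _ F]) (use p in auto)
  ultimately show ?thesis
    by (simp add: path_class_eq_iff)
qed

lemma pathin_compose_convex:
  assumes "continuous_map (top_of_set K) X F" "continuous_on {0..1} p" "p ` {0..1} \<subseteq> K"
  shows "pathin X (F \<circ> p)"
  unfolding pathin_def by (rule continuous_map_compose[OF _ assms(1)]) (use assms in auto)

lemma path_concat_ends [simp]: "path_concat p q 0 = p 0" "path_concat p q 1 = q 1"
  by (auto simp: path_concat_def)

lemma path_concat_compose: "path_concat (f \<circ> p) (f \<circ> q) = f \<circ> path_concat p q"
  by (auto simp: path_concat_def)

lemma pathin_concat:
  assumes "pathin X p" "pathin X q" "p 1 = q 0"
  shows "pathin X (path_concat p q)"
  unfolding pathin_def path_concat_def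
proof (rule continuous_map_cases_le)
  show "continuous_map (subtopology (top_of_set {0..1}) {x \<in> topspace (top_of_set {0..1}). x \<le> 1/2}) X (\<lambda>t. p (2*t))"
    by (rule continuous_map_compose[of _ "top_of_set {0..1}" "\<lambda>t. 2*t", unfolded o_def])
      (use assms in \<open>auto simp: pathin_def subtopology_subtopology intro!: continuous_intros\<close>)
  show "continuous_map (subtopology (top_of_set {0..1}) {x \<in> topspace (top_of_set {0..1}). 1/2 \<le> x}) X (\<lambda>t. q (2*t-1))"
    by (rule continuous_map_compose[of _ "top_of_set {0..1}" "\<lambda>t. 2*t-1", unfolded o_def])
      (use assms in \<open>auto simp: pathin_def subtopology_subtopology intro!: continuous_intros\<close>)
next
  show "p (2 * x) = q (2 * x - 1)" if "x = 1/2" for x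
  proof -
    have "2 * x = 1" "2 * x - 1 = 0" using that by auto
    then show ?thesis using assms(3) by (simp only:)
  qed
qed (auto intro!: continuous_intros)

lemma continuous_on_path_concat:
  fixes p q :: "real \<Rightarrow> 'a::topological_space"
  assumes "continuous_on {0..1} p" "continuous_on {0..1} q" "p 1 = q 0"
  shows "continuous_on {0..1} (path_concat p q)"
  using pathin_concat[of euclidean p q] assms by (simp add: pathin_def)

lemma path_concat_image: "path_concat p q ` {0..1} \<subseteq> p ` {0..1} \<union> q ` {0..1}"
proof
  fix x assume "x \<in> path_concat p q ` {0..1}"
  then obtain t where t: "t \<in> {0..1}" "x = path_concat p q t" by auto
  show "x \<in> p ` {0..1} \<union> q ` {0..1}"
  proof (cases "t \<le> 1/2")
    case True then have "x = p (2*t)" "2*t \<in> {0..1}" using t by (auto simp: path_concat_def)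
    then show ?thesis by blast
  next
    case False then have "x = q (2*t-1)" "2*t-1 \<in> {0..1}" using t by (auto simp: path_concat_def)
    then show ?thesis by blast
  qed
qed

lemma path_homotopic_concat:
  assumes "path_homotopic X p p'" "path_homotopic X q q'" "p 1 = q 0"
  shows "path_homotopic X (path_concat p q) (path_concat p' q')"
proof -
  obtain h where h: "continuous_map (top_of_set ({0..1::real} \<times> {0..1})) X h" "\<And>x. h (0,x) = p x"
      "\<And>x. h (1,x) = p' x" "\<And>t. t \<in> {0..1} \<Longrightarrow> h (t,0) = p 0 \<and> h (t,1) = p 1"
    using assms(1) unfolding path_homotopic_def homotopic_with_def prod_topology_subtopology_eu by blast
  obtain k where k: "continuous_map (top_of_set ({0..1::real} \<times> {0..1})) X k" "\<And>x. k (0,x) = q x"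
      "\<And>x. k (1,x) = q' x" "\<And>t. t \<in> {0..1} \<Longrightarrow> k (t,0) = q 0 \<and> k (t,1) = q 1"
    using assms(2) unfolding path_homotopic_def homotopic_with_def prod_topology_subtopology_eu by blast
  let ?S = "{0..1::real} \<times> {0..1::real}"
  let ?m = "\<lambda>z. if snd z \<le> 1/2 then h (fst z, 2 * snd z) else k (fst z, 2 * snd z - 1)"
  have "continuous_map (top_of_set ?S) X ?m"
  proof (rule continuous_map_cases_le)
    show "continuous_map (subtopology (top_of_set ?S) {z \<in> topspace (top_of_set ?S). snd z \<le> 1/2}) X
        (\<lambda>z. h (fst z, 2 * snd z))"
      by (rule continuous_map_compose[OF _ h(1), of _ "\<lambda>z. (fst z, 2 * snd z)", unfolded o_def])
        (auto simp: subtopology_subtopology intro!: continuous_intros)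
    show "continuous_map (subtopology (top_of_set ?S) {z \<in> topspace (top_of_set ?S). 1/2 \<le> snd z}) X
        (\<lambda>z. k (fst z, 2 * snd z - 1))"
      by (rule continuous_map_compose[OF _ k(1), of _ "\<lambda>z. (fst z, 2 * snd z - 1)", unfolded o_def])
        (auto simp: subtopology_subtopology intro!: continuous_intros)
  next
    \<comment> \<open>The two homotopies agree on the middle line because each of them fixes the
      common point \<open>p 1 = q 0\<close> throughout.\<close>
    show "h (fst z, 2 * snd z) = k (fst z, 2 * snd z - 1)" if "z \<in> topspace (top_of_set ?S)" "snd z = 1/2" for z
    proof -
      have "2 * snd z = 1" "2 * snd z - 1 = 0" "fst z \<in> {0..1}"
        using that by (auto simp: mem_Times_iff)
      then show ?thesis using h(4)[of "fst z"] k(4)[of "fst z"] assms(3) by (simp only:)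
    qed
  qed (auto intro!: continuous_intros)
  then show ?thesis
    unfolding path_homotopic_def homotopic_with_def
    using h k by (intro exI[of _ ?m]) (auto simp: path_concat_def)
qed

text \<open>Written as a composition, so that reversal is a reparametrization by a map of the convex
  unit interval.\<close>

definition path_rev :: "(real \<Rightarrow> 'a) \<Rightarrow> real \<Rightarrow> 'a" where
  "path_rev p = p \<circ> (\<lambda>t. 1 - t)"

lemma pathin_rev: "pathin X p \<Longrightarrow> pathin X (path_rev p)"
  unfolding path_rev_def
  by (rule pathin_compose_convex[of "{0..1}"]) (auto simp: pathin_def continuous_on_diff)

text \<open>The hom-sets of the fundamental groupoid. Recording both ends plays the role of typing
  for the composition laws.\<close>

definition path_classes :: "'a topology \<Rightarrow> 'a \<Rightarrow> 'a \<Rightarrow> (real \<Rightarrow> 'a) set set" where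
  "path_classes X y z = {path_class X p | p. pathin X p \<and> p 0 = y \<and> p 1 = z}"

lemma path_classesI: "pathin X p \<Longrightarrow> p 0 = y \<Longrightarrow> p 1 = z \<Longrightarrow> path_class X p \<in> path_classes X y z"
  by (auto simp: path_classes_def)

lemma path_classesE:
  assumes "a \<in> path_classes X y z"
  obtains p where "pathin X p" "p 0 = y" "p 1 = z" "a = path_class X p"
  using assms by (auto simp: path_classes_def)

text \<open>A class contains its representatives and hence determines their ends. This turns an
  equality of classes into an equality of end points when paths in the cover are compared.\<close>

lemma path_classes_ends_unique:
  assumes "a \<in> path_classes X y z" "a \<in> path_classes X y' z'"
  shows "y' = y" "z' = z"
proof -
  obtain p where p: "pathin X p" "p 0 = y" "p 1 = z" "a = path_class X p"
    using assms(1) by (elim path_classesE)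
  obtain q where q: "pathin X q" "q 0 = y'" "q 1 = z'" "a = path_class X q"
    using assms(2) by (elim path_classesE)
  show "y' = y" "z' = z" using path_class_ends[OF p(1), of q] p q by auto
qed

lemma path_classes_topspace:
  assumes "a \<in> path_classes X y z"
  shows "y \<in> topspace X" "z \<in> topspace X"
  using assms unfolding path_classes_def pathin_def continuous_map_def by (auto simp: Pi_def)

lemma path_classes_member:
  assumes "a \<in> path_classes X y z" "p \<in> a"
  shows "pathin X p" "p 0 = y" "p 1 = z" "path_class X p = a"
proof -
  obtain q where q: "pathin X q" "q 0 = y" "q 1 = z" "a = path_class X q"
    using assms by (elim path_classesE)
  then have *: "path_homotopic X q p" using assms by (simp add: path_class_def)
  show "pathin X p" "p 0 = y" "p 1 = z" using path_homotopicD[OF *] q by auto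
  show "path_class X p = a" using * q path_class_eq_iff by blast
qed

lemma class_concat_path_class:
  assumes "pathin X p" "pathin X q" "p 1 = q 0"
  shows "class_concat X (path_class X p) (path_class X q) = path_class X (path_concat p q)"
proof -
  have "path_class X (path_concat p' q') = path_class X (path_concat p q)"
    if "p' \<in> path_class X p" "q' \<in> path_class X q" for p' q'
  proof -
    have "path_homotopic X (path_concat p q) (path_concat p' q')"
      using that assms by (intro path_homotopic_concat) (auto simp: path_class_def)
    then show ?thesis
      using path_class_eq_iff pathin_concat assms by metis
  qed
  then show ?thesis
    unfolding class_concat_def using mem_path_class[OF assms(1)] mem_path_class[OF assms(2)] by blast
qed

lemma path_classes_concat:
  assumes "a \<in> path_classes X x y" "b \<in> path_classes X y z"
  shows "class_concat X a b \<in> path_classes X x z"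
proof -
  obtain p where p: "pathin X p" "p 0 = x" "p 1 = y" "a = path_class X p"
    using assms(1) by (elim path_classesE)
  obtain q where q: "pathin X q" "q 0 = y" "q 1 = z" "b = path_class X q"
    using assms(2) by (elim path_classesE)
  have "path_class X (path_concat p q) \<in> path_classes X x z"
    using p q by (intro path_classesI pathin_concat) auto
  then show ?thesis using p q by (simp add: class_concat_path_class)
qed

text \<open>An arbitrary representative is reversed; the inverse laws below show that the choice is
  immaterial.\<close>

definition inv_class :: "'a topology \<Rightarrow> (real \<Rightarrow> 'a) set \<Rightarrow> (real \<Rightarrow> 'a) set" where
  "inv_class X a = path_class X (path_rev (SOME p. p \<in> a))"

lemma some_mem_path_class:
  assumes "a \<in> path_classes X y z"
  shows "(SOME p. p \<in> a) \<in> a"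
  using assms by (elim path_classesE) (metis mem_path_class someI)

lemma path_classes_inv:
  assumes "a \<in> path_classes X y z"
  shows "inv_class X a \<in> path_classes X z y"
  using path_classes_member[OF assms some_mem_path_class[OF assms]]
  unfolding inv_class_def by (intro path_classesI pathin_rev) (auto simp: path_rev_def)

lemma path_classes_const: "x \<in> topspace X \<Longrightarrow> path_class X (\<lambda>_. x) \<in> path_classes X x x"
  by (intro path_classesI) (auto simp: pathin_const)

text \<open>A path is a continuous map on the convex unit interval, so two reparametrizations with
  common ends are joined by straight lines. The inverse, unit and associativity laws only have to
  exhibit the two reparametrizations.\<close>

lemma path_class_reparam:
  assumes "pathin X p" "continuous_on {0..1} u" "u ` {0..1} \<subseteq> {0..1}"
    "continuous_on {0..1} v" "v ` {0..1} \<subseteq> {0..1}" "u 0 = v 0" "u 1 = v 1"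
  shows "path_class X (p \<circ> u) = path_class X (p \<circ> v)"
  by (rule path_class_convex[of "{0..1}"]) (use assms in \<open>auto simp: pathin_def\<close>)

section \<open>Laws of the fundamental groupoid\<close>

lemma class_concat_inv_right:
  assumes "a \<in> path_classes X y z"
  shows "class_concat X a (inv_class X a) = path_class X (\<lambda>_. y)"
proof -
  define p where "p = (SOME p. p \<in> a)"
  have p: "pathin X p" "p 0 = y" "p 1 = z" "path_class X p = a"
    using path_classes_member[OF assms some_mem_path_class[OF assms]] by (auto simp: p_def)
  let ?u = "path_concat id (\<lambda>t. 1 - t)"
  have u: "continuous_on {0..1} ?u"
    by (intro continuous_on_path_concat continuous_intros continuous_on_id') auto
  have "class_concat X a (inv_class X a) = path_class X (path_concat p (path_rev p))"
    unfolding inv_class_def p_def[symmetric] unfolding p(4)[symmetric]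
    by (rule class_concat_path_class) (use p pathin_rev[OF p(1)] in \<open>auto simp: path_rev_def\<close>)
  also have "path_concat p (path_rev p) = p \<circ> ?u"
    by (simp add: path_rev_def flip: path_concat_compose)
  also have "path_class X \<dots> = path_class X (p \<circ> (\<lambda>_. 0))"
    by (rule path_class_reparam[OF p(1)])
      (use u in \<open>auto simp: path_concat_def\<close>)
  finally show ?thesis using p by (simp add: o_def)
qed

lemma class_concat_inv_left:
  assumes "a \<in> path_classes X y z"
  shows "class_concat X (inv_class X a) a = path_class X (\<lambda>_. z)"
proof -
  define p where "p = (SOME p. p \<in> a)"
  have p: "pathin X p" "p 0 = y" "p 1 = z" "path_class X p = a"
    using path_classes_member[OF assms some_mem_path_class[OF assms]] by (auto simp: p_def)
  let ?u = "path_concat (\<lambda>t. 1 - t) id"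
  have u: "continuous_on {0..1} ?u"
    by (intro continuous_on_path_concat continuous_intros continuous_on_id') auto
  have "class_concat X (inv_class X a) a = path_class X (path_concat (path_rev p) p)"
    unfolding inv_class_def p_def[symmetric] unfolding p(4)[symmetric]
    by (rule class_concat_path_class) (use p pathin_rev[OF p(1)] in \<open>auto simp: path_rev_def\<close>)
  also have "path_concat (path_rev p) p = p \<circ> ?u"
    by (simp add: path_rev_def flip: path_concat_compose)
  also have "path_class X \<dots> = path_class X (p \<circ> (\<lambda>_. 1))"
    by (rule path_class_reparam[OF p(1)])
      (use u in \<open>auto simp: path_concat_def\<close>)
  finally show ?thesis using p by (simp add: o_def)
qed

lemma class_concat_const_left:
  assumes "a \<in> path_classes X y z"
  shows "class_concat X (path_class X (\<lambda>_. y)) a = a"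
proof -
  obtain p where p: "pathin X p" "p 0 = y" "p 1 = z" "a = path_class X p"
    using assms by (elim path_classesE)
  have y: "y \<in> topspace X" using path_classes_topspace[OF assms] by auto
  let ?u = "path_concat (\<lambda>_. 0) id"
  have u: "continuous_on {0..1} ?u"
    by (intro continuous_on_path_concat continuous_intros continuous_on_id') auto
  have "class_concat X (path_class X (\<lambda>_. y)) a = path_class X (path_concat (p \<circ> (\<lambda>_. 0)) (p \<circ> id))"
    unfolding p(4) using p y by (subst class_concat_path_class) (auto simp: pathin_const o_def)
  also have "\<dots> = path_class X (p \<circ> ?u)" by (simp only: path_concat_compose)
  also have "\<dots> = path_class X (p \<circ> id)"
    by (rule path_class_reparam[OF p(1)])
      (use u in \<open>auto simp: path_concat_def\<close>)
  finally show ?thesis using p by simp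
qed

lemma class_concat_const_right:
  assumes "a \<in> path_classes X y z"
  shows "class_concat X a (path_class X (\<lambda>_. z)) = a"
proof -
  obtain p where p: "pathin X p" "p 0 = y" "p 1 = z" "a = path_class X p"
    using assms by (elim path_classesE)
  have z: "z \<in> topspace X" using path_classes_topspace[OF assms] by auto
  let ?u = "path_concat id (\<lambda>_. 1)"
  have u: "continuous_on {0..1} ?u"
    by (intro continuous_on_path_concat continuous_intros continuous_on_id') auto
  have "class_concat X a (path_class X (\<lambda>_. z)) = path_class X (path_concat (p \<circ> id) (p \<circ> (\<lambda>_. 1)))"
    unfolding p(4) using p z by (subst class_concat_path_class) (auto simp: pathin_const o_def)
  also have "\<dots> = path_class X (p \<circ> ?u)" by (simp only: path_concat_compose)
  also have "\<dots> = path_class X (p \<circ> id)"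
    by (rule path_class_reparam[OF p(1)])
      (use u in \<open>auto simp: path_concat_def\<close>)
  finally show ?thesis using p by simp
qed

lemma class_concat_assoc:
  assumes "a \<in> path_classes X w x" "b \<in> path_classes X x y" "c \<in> path_classes X y z"
  shows "class_concat X (class_concat X a b) c = class_concat X a (class_concat X b c)"
proof -
  obtain p where p: "pathin X p" "p 0 = w" "p 1 = x" "a = path_class X p"
    using assms by (elim path_classesE)
  obtain q where q: "pathin X q" "q 0 = x" "q 1 = y" "b = path_class X q"
    using assms by (elim path_classesE)
  obtain r where r: "pathin X r" "r 0 = y" "r 1 = z" "c = path_class X r"
    using assms by (elim path_classesE)
  let ?F = "path_concat p (path_concat q r)"
  \<comment> \<open>\<open>?u\<close> maps the breakpoints 1/4 and 1/2 of the left bracketing to the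
    breakpoints 1/2 and 3/4 of the right one, linearly in between.\<close>
  let ?u = "path_concat (path_concat (\<lambda>t. t/2) (\<lambda>t. 1/2 + t/4)) (\<lambda>t. 3/4 + t/4)"
  have u: "continuous_on {0..1} ?u"
    by (intro continuous_on_path_concat continuous_intros continuous_on_id') auto
  have F: "pathin X ?F"
    using p q r by (intro pathin_concat) auto
  have "class_concat X (class_concat X a b) c = path_class X (path_concat (path_concat p q) r)"
    unfolding p(4) q(4) r(4) using p q r by (simp add: class_concat_path_class pathin_concat)
  also have "path_concat (path_concat p q) r = ?F \<circ> ?u"
    using p q r by (auto simp: path_concat_def fun_eq_iff intro!: arg_cong[of _ _ p] arg_cong[of _ _ q] arg_cong[of _ _ r])
  also have "path_class X \<dots> = path_class X (?F \<circ> id)"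
    by (rule path_class_reparam[OF F])
      (use u in \<open>auto simp: path_concat_def field_simps\<close>)
  also have "\<dots> = class_concat X a (class_concat X b c)"
    unfolding p(4) q(4) r(4) using p q r by (simp add: class_concat_path_class pathin_concat)
  finally show ?thesis .
qed

text \<open>A triangle of paths commutes as soon as it comes from a convex parameter space.
  Composition rules for subpaths, segments, radii and rotations are all read off from this.\<close>

lemma class_concat_convex:
  fixes p q r :: "real \<Rightarrow> 'b::real_normed_vector"
  assumes F: "continuous_map (top_of_set K) X F" and K: "convex K"
    and p: "continuous_on {0..1} p" "p ` {0..1} \<subseteq> K"
    and q: "continuous_on {0..1} q" "q ` {0..1} \<subseteq> K"
    and r: "continuous_on {0..1} r" "r ` {0..1} \<subseteq> K"
    and e: "p 1 = q 0" "r 0 = p 0" "r 1 = q 1"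
  shows "class_concat X (path_class X (F \<circ> p)) (path_class X (F \<circ> q)) = path_class X (F \<circ> r)"
proof -
  have "class_concat X (path_class X (F \<circ> p)) (path_class X (F \<circ> q)) = path_class X (F \<circ> path_concat p q)"
    using assms by (simp add: class_concat_path_class path_concat_compose pathin_compose_convex)
  also have "\<dots> = path_class X (F \<circ> r)"
    using path_concat_image[of p q] p q r e
    by (intro path_class_convex[OF F K] continuous_on_path_concat) auto
  finally show ?thesis .
qed

section \<open>The fundamental group\<close>

lemma pi1_simps [simp]:
  "carrier (pi1 X x0) = path_classes X x0 x0"
  "monoid.mult (pi1 X x0) = class_concat X"
  "one (pi1 X x0) = path_class X (\<lambda>_. x0)"
  by (auto simp: pi1_def path_classes_def)

lemma group_pi1:
  assumes "x0 \<in> topspace X"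
  shows "group (pi1 X x0)"
proof (rule groupI)
  show "\<exists>y\<in>carrier (pi1 X x0). y \<otimes>\<^bsub>pi1 X x0\<^esub> x = \<one>\<^bsub>pi1 X x0\<^esub>" if "x \<in> carrier (pi1 X x0)" for x
    using that by (auto intro!: bexI[of _ "inv_class X x"] class_concat_inv_left path_classes_inv)
qed (use assms in \<open>auto simp: path_classes_const path_classes_concat class_concat_assoc class_concat_const_left\<close>)

lemma pi1_map_path_class:
  assumes f: "continuous_map X Y f" and p: "pathin X p"
  shows "pi1_map Y f (path_class X p) = path_class Y (f \<circ> p)"
proof -
  have "path_class Y (f \<circ> q) = path_class Y (f \<circ> p)" if "path_homotopic X p q" for q
  proof -
    have "path_homotopic Y (f \<circ> p) (f \<circ> q)"
      unfolding path_homotopic_def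
      by (rule homotopic_with_compose_continuous_map_left[OF that[unfolded path_homotopic_def] f]) auto
    then show ?thesis
      using path_class_eq_iff path_homotopicD by metis
  qed
  then have "path_class Y (f \<circ> q) = path_class Y (f \<circ> p)" if "q \<in> path_class X p" for q
    using that by (simp add: path_class_def)
  then show ?thesis
    unfolding pi1_map_def using mem_path_class[OF p] by blast
qed

lemma pathin_compose: "continuous_map X Y f \<Longrightarrow> pathin X p \<Longrightarrow> pathin Y (f \<circ> p)"
  unfolding pathin_def by (erule continuous_map_compose[rotated])

lemma pi1_map_path_classes:
  assumes f: "continuous_map X Y f" and a: "a \<in> path_classes X y z"
  shows "pi1_map Y f a \<in> path_classes Y (f y) (f z)"
proof -
  obtain p where p: "pathin X p" "p 0 = y" "p 1 = z" "a = path_class X p"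
    using a by (elim path_classesE)
  show ?thesis
    unfolding p(4) pi1_map_path_class[OF f p(1)]
    by (rule path_classesI[OF pathin_compose[OF f p(1)]]) (use p in auto)
qed

lemma pi1_map_concat:
  assumes f: "continuous_map X Y f" and a: "a \<in> path_classes X x y" and b: "b \<in> path_classes X y z"
  shows "pi1_map Y f (class_concat X a b) = class_concat Y (pi1_map Y f a) (pi1_map Y f b)"
proof -
  obtain p where p: "pathin X p" "p 0 = x" "p 1 = y" "a = path_class X p"
    using a by (elim path_classesE)
  obtain q where q: "pathin X q" "q 0 = y" "q 1 = z" "b = path_class X q"
    using b by (elim path_classesE)
  have pq: "p 1 = q 0" using p q by simp
  show ?thesis
    unfolding p(4) q(4) class_concat_path_class[OF p(1) q(1) pq]
      pi1_map_path_class[OF f p(1)] pi1_map_path_class[OF f q(1)]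
      pi1_map_path_class[OF f pathin_concat[OF p(1) q(1) pq]]
    using class_concat_path_class[OF pathin_compose[OF f p(1)] pathin_compose[OF f q(1)]] pq
    by (simp add: path_concat_compose)
qed

lemma pi1_map_hom:
  assumes f: "continuous_map X Y f"
  shows "pi1_map Y f \<in> hom (pi1 X x0) (pi1 Y (f x0))"
proof (rule homI)
  show "pi1_map Y f a \<in> carrier (pi1 Y (f x0))" if "a \<in> carrier (pi1 X x0)" for a
    using pi1_map_path_classes[OF f] that by simp
  show "pi1_map Y f (a \<otimes>\<^bsub>pi1 X x0\<^esub> b) = pi1_map Y f a \<otimes>\<^bsub>pi1 Y (f x0)\<^esub> pi1_map Y f b"
    if "a \<in> carrier (pi1 X x0)" "b \<in> carrier (pi1 X x0)" for a b
    using pi1_map_concat[OF f] that by simp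
qed

section \<open>Lifting to the universal cover\<close>

text \<open>The generating open sets of the universal cover, expressed through the class
  \<open>a\<close> instead of a representative, so that the groupoid laws apply to them. The point
  \<open>y\<close> stands for the end of \<open>a\<close>.\<close>

definition ucover_nbhd :: "'a topology \<Rightarrow> (real \<Rightarrow> 'a) set \<Rightarrow> 'a set \<Rightarrow> 'a \<Rightarrow> (real \<Rightarrow> 'a) set set" where
  "ucover_nbhd X a U y = {class_concat X a (path_class X q) | q. pathin (subtopology X U) q \<and> q 0 = y}"

lemma pathin_subtopologyD:
  assumes "pathin (subtopology X U) q"
  shows "pathin X q" "\<And>t. t \<in> {0..1} \<Longrightarrow> q t \<in> U"
  using assms by (auto simp: pathin_def continuous_map_in_subtopology Pi_def image_subset_iff)

lemma pathin_subtopologyI: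
  assumes "pathin X q" "\<And>t. t \<in> {0..1} \<Longrightarrow> q t \<in> U"
  shows "pathin (subtopology X U) q"
  using assms by (auto simp: pathin_def continuous_map_in_subtopology)

lemma universal_cover_eq:
  "universal_cover X x0 = topology_generated_by
     {ucover_nbhd X a U y | a U y. a \<in> path_classes X x0 y \<and> openin X U \<and> y \<in> U}"
proof -
  have eq: "{path_class X (path_concat p q) | q. pathin (subtopology X U) q \<and> q 0 = p 1}
      = ucover_nbhd X (path_class X p) U (p 1)" if "pathin X p" for p U
    unfolding ucover_nbhd_def
    using class_concat_path_class[OF that pathin_subtopologyD(1)] by (intro Collect_cong ex_cong1) auto
  have "{{path_class X (path_concat p q) | q. pathin (subtopology X U) q \<and> q 0 = p 1} | p U.
        pathin X p \<and> p 0 = x0 \<and> openin X U \<and> p 1 \<in> U} =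
     {ucover_nbhd X a U y | a U y. a \<in> path_classes X x0 y \<and> openin X U \<and> y \<in> U}" (is "?A = ?B")
  proof (rule equalityI; rule subsetI)
    fix S assume "S \<in> ?A"
    then obtain p U where p: "pathin X p" "p 0 = x0" "openin X U" "p 1 \<in> U"
      "S = ucover_nbhd X (path_class X p) U (p 1)"
      using eq by auto
    then show "S \<in> ?B" using path_classesI[OF p(1), of x0 "p 1"] by auto
  next
    fix S assume "S \<in> ?B"
    then obtain a U y where S: "S = ucover_nbhd X a U y" "a \<in> path_classes X x0 y" "openin X U" "y \<in> U"
      by auto
    obtain p where p: "pathin X p" "p 0 = x0" "p 1 = y" "a = path_class X p"
      using S(2) by (elim path_classesE)
    have "S = {path_class X (path_concat p q) | q. pathin (subtopology X U) q \<and> q 0 = p 1}"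
      unfolding S(1) eq[OF p(1)] using p by simp
    then show "S \<in> ?A" using p S by blast
  qed
  then show ?thesis
    unfolding universal_cover_def by simp
qed

lemma openin_ucover_nbhd:
  assumes "a \<in> path_classes X x0 y" "openin X U" "y \<in> U"
  shows "openin (universal_cover X x0) (ucover_nbhd X a U y)"
  unfolding universal_cover_eq using assms by (intro topology_generated_by_Basis) auto

lemma ucover_nbhd_self:
  assumes "a \<in> path_classes X x0 y" "y \<in> U"
  shows "a \<in> ucover_nbhd X a U y"
proof -
  have "pathin (subtopology X U) (\<lambda>_. y)"
    using path_classes_topspace(2)[OF assms(1)] assms(2) by (simp add: pathin_const)
  then show ?thesis
    unfolding ucover_nbhd_def using class_concat_const_right[OF assms(1)] by force
qed

lemma ucover_nbhd_path_classes:
  assumes "a \<in> path_classes X x0 y" "b \<in> ucover_nbhd X a U y"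
  obtains z where "z \<in> U" "b \<in> path_classes X x0 z"
proof -
  obtain q where q: "b = class_concat X a (path_class X q)" "pathin (subtopology X U) q" "q 0 = y"
    using assms(2) by (auto simp: ucover_nbhd_def)
  show ?thesis
    by (rule that[of "q 1"])
      (use q assms pathin_subtopologyD[OF q(2)] in \<open>auto intro!: path_classes_concat path_classesI\<close>)
qed

lemma topspace_universal_cover: "topspace (universal_cover X x0) = (\<Union>y. path_classes X x0 y)"
proof (rule equalityI; rule subsetI)
  fix b assume "b \<in> topspace (universal_cover X x0)"
  then show "b \<in> (\<Union>y. path_classes X x0 y)"
    unfolding universal_cover_eq topology_generated_by_topspace
    by (auto elim: ucover_nbhd_path_classes)
next
  fix b assume "b \<in> (\<Union>y. path_classes X x0 y)"
  then obtain y where b: "b \<in> path_classes X x0 y" by auto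
  have "openin (universal_cover X x0) (ucover_nbhd X b (topspace X) y)"
    using b path_classes_topspace[OF b] by (intro openin_ucover_nbhd) auto
  moreover have "b \<in> ucover_nbhd X b (topspace X) y"
    using b path_classes_topspace[OF b] by (intro ucover_nbhd_self)
  ultimately show "b \<in> topspace (universal_cover X x0)"
    using openin_subset by blast
qed

lemma continuous_map_into_universal_cover:
  assumes "\<And>t. t \<in> topspace T \<Longrightarrow> f t \<in> topspace (universal_cover X x0)"
    and "\<And>a U y. \<lbrakk>a \<in> path_classes X x0 y; openin X U; y \<in> U\<rbrakk>
      \<Longrightarrow> openin T {t \<in> topspace T. f t \<in> ucover_nbhd X a U y}"
  shows "continuous_map T (universal_cover X x0) f"
  unfolding universal_cover_eq
proof (rule continuous_on_generated_topo)
  show "openin T (f -` N \<inter> topspace T)"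
    if "N \<in> {ucover_nbhd X a U y | a U y. a \<in> path_classes X x0 y \<and> openin X U \<and> y \<in> U}" for N
  proof -
    have "f -` N \<inter> topspace T = {t \<in> topspace T. f t \<in> N}" by auto
    then show ?thesis using that assms(2) by auto
  qed
  show "f ` topspace T \<subseteq> \<Union> {ucover_nbhd X a U y | a U y. a \<in> path_classes X x0 y \<and> openin X U \<and> y \<in> U}"
    using assms(1) unfolding universal_cover_eq topology_generated_by_topspace by blast
qed

text \<open>The covering projection; all representatives of a class have the same end.\<close>

definition class_end :: "(real \<Rightarrow> 'a) set \<Rightarrow> 'a" where
  "class_end a = (SOME p. p \<in> a) 1"

lemma class_end: "a \<in> path_classes X y z \<Longrightarrow> class_end a = z"
  unfolding class_end_def by (rule path_classes_member(3)[OF _ some_mem_path_class])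

lemma ucover_class_end: "a \<in> topspace (universal_cover X x0) \<Longrightarrow> a \<in> path_classes X x0 (class_end a)"
  unfolding topspace_universal_cover by (elim UN_E) (simp add: class_end)

lemma ucover_I: "a \<in> path_classes X x0 z \<Longrightarrow> a \<in> topspace (universal_cover X x0)"
  unfolding topspace_universal_cover by auto

lemma continuous_map_class_end: "continuous_map (universal_cover X x0) X class_end"
  unfolding continuous_map_def
proof (intro conjI allI impI)
  show "class_end \<in> topspace (universal_cover X x0) \<rightarrow> topspace X"
    using path_classes_topspace(2)[OF ucover_class_end] by auto
  fix U assume U: "openin X U"
  show "openin (universal_cover X x0) {a \<in> topspace (universal_cover X x0). class_end a \<in> U}" (is "openin _ ?S")
  proof (subst openin_subopen, rule ballI)
    fix a assume a: "a \<in> ?S"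
    let ?N = "ucover_nbhd X a U (class_end a)"
    have a': "a \<in> path_classes X x0 (class_end a)" using a ucover_class_end[of a] by simp
    have "?N \<subseteq> ?S"
    proof
      fix b assume "b \<in> ?N"
      then obtain z where "z \<in> U" "b \<in> path_classes X x0 z"
        using ucover_nbhd_path_classes[OF a'] by blast
      then show "b \<in> ?S" using ucover_I[of b] class_end[of b] by simp
    qed
    then show "\<exists>T. openin (universal_cover X x0) T \<and> a \<in> T \<and> T \<subseteq> ?S"
      using openin_ucover_nbhd[OF a' U] ucover_nbhd_self[OF a'] a by blast
  qed
qed

text \<open>Translation acts on the left while neighbourhoods are formed by continuing paths on the
  right. Hence translation by \<open>g\<close> pulls the basic neighbourhood of \<open>b\<close>
  back to the one of the inverse of \<open>g\<close> times \<open>b\<close>.\<close>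

lemma continuous_map_deck:
  assumes g: "g \<in> path_classes X x0 x0"
  shows "continuous_map (universal_cover X x0) (universal_cover X x0) (class_concat X g)"
proof (rule continuous_map_into_universal_cover)
  show "class_concat X g t \<in> topspace (universal_cover X x0)"
    if "t \<in> topspace (universal_cover X x0)" for t
    using path_classes_concat[OF g ucover_class_end[OF that]] by (rule ucover_I)
  fix b U y assume b: "b \<in> path_classes X x0 y" "openin X U" "y \<in> U"
  let ?g' = "inv_class X g"
  have g': "?g' \<in> path_classes X x0 x0" by (rule path_classes_inv[OF g])
  have "{a \<in> topspace (universal_cover X x0). class_concat X g a \<in> ucover_nbhd X b U y}
      = ucover_nbhd X (class_concat X ?g' b) U y" (is "?L = ?R")
  proof (rule equalityI; rule subsetI)
    fix a assume a: "a \<in> ?L"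
    then obtain q where q: "class_concat X g a = class_concat X b (path_class X q)"
        "pathin (subtopology X U) q" "q 0 = y"
      by (auto simp: ucover_nbhd_def)
    have q': "path_class X q \<in> path_classes X y (q 1)"
      using q pathin_subtopologyD by (intro path_classesI) auto
    have a': "a \<in> path_classes X x0 (class_end a)" using a ucover_class_end[of a] by simp
    have "a = class_concat X ?g' (class_concat X g a)"
      using class_concat_assoc[OF g' g a'] class_concat_inv_left[OF g] class_concat_const_left[OF a'] by simp
    also have "\<dots> = class_concat X (class_concat X ?g' b) (path_class X q)"
      unfolding q(1) by (rule class_concat_assoc[OF g' b(1) q', symmetric])
    finally show "a \<in> ?R" unfolding ucover_nbhd_def using q by blast
  next
    fix a assume "a \<in> ?R"
    then obtain q where q: "a = class_concat X (class_concat X ?g' b) (path_class X q)"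
        "pathin (subtopology X U) q" "q 0 = y"
      by (auto simp: ucover_nbhd_def)
    have q': "path_class X q \<in> path_classes X y (q 1)"
      using q pathin_subtopologyD by (intro path_classesI) auto
    have bq: "class_concat X b (path_class X q) \<in> path_classes X x0 (q 1)"
      by (rule path_classes_concat[OF b(1) q'])
    have a: "a = class_concat X ?g' (class_concat X b (path_class X q))"
      unfolding q(1) by (rule class_concat_assoc[OF g' b(1) q'])
    have "class_concat X g a = class_concat X b (path_class X q)"
      unfolding a
      using class_concat_assoc[OF g g' bq] class_concat_inv_right[OF g] class_concat_const_left[OF bq] by simp
    moreover have "a \<in> topspace (universal_cover X x0)"
      unfolding a using path_classes_concat[OF g' bq] by (rule ucover_I)
    ultimately show "a \<in> ?L" using q by (auto simp: ucover_nbhd_def)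
  qed
  then show "openin (universal_cover X x0) {a \<in> topspace (universal_cover X x0). class_concat X g a \<in> ucover_nbhd X b U y}"
    using openin_ucover_nbhd[OF path_classes_concat[OF g' b(1)] b(2,3)] by simp
qed

text \<open>The lift of \<open>F\<close> to the universal cover over a domain that is star-shaped
  about 0: a point goes to the class of the image of its radius. On the unit interval this lifts
  paths, on a triangle it lifts 2-simplices.\<close>

definition radial_lift :: "'a topology \<Rightarrow> ('b::real_vector \<Rightarrow> 'a) \<Rightarrow> 'b \<Rightarrow> (real \<Rightarrow> 'a) set" where
  "radial_lift X F z = path_class X (F \<circ> (\<lambda>u. u *\<^sub>R z))"

lemma radial_lift_path_classes:
  fixes K :: "'b::real_normed_vector set"
  assumes F: "continuous_map (top_of_set K) X F" and K: "convex K" "0 \<in> K" and z: "z \<in> K"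
  shows "radial_lift X F z \<in> path_classes X (F 0) (F z)"
proof -
  have "u *\<^sub>R z \<in> K" if "u \<in> {0..1}" for u
    using convexD_alt[OF K(1) K(2) z, of u] that by simp
  then show ?thesis
    unfolding radial_lift_def
    by (intro path_classesI pathin_compose_convex[OF F]) (auto intro!: continuous_on_scaleR continuous_on_id continuous_on_const)
qed

text \<open>The triangle with vertices 0, \<open>z\<close> and \<open>w\<close> lies in
  \<open>K\<close>, so moving the argument along a segment continues the path by the image of that
  segment.\<close>

lemma radial_lift_step:
  fixes K :: "'b::real_normed_vector set"
  assumes F: "continuous_map (top_of_set K) X F" and K: "convex K" "0 \<in> K" and z: "z \<in> K" "w \<in> K"
  shows "radial_lift X F w = class_concat X (radial_lift X F z) (path_class X (F \<circ> linepath z w))"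
proof -
  have *: "u *\<^sub>R v \<in> K" if "u \<in> {0..1}" "v \<in> K" for u v
    using convexD_alt[OF K(1) K(2) that(2), of u] that by simp
  have c: "continuous_on {0..1} (\<lambda>u. u *\<^sub>R v)" for v :: 'b
    by (intro continuous_on_scaleR continuous_on_id continuous_on_const)
  have l: "linepath z w ` {0..1} \<subseteq> K"
    using K(1) z by (simp add: linepath_image_01 closed_segment_subset)
  show ?thesis
    unfolding radial_lift_def
    by (rule class_concat_convex[OF F K(1) c _ continuous_on_linepath l c _, symmetric])
      (use * z in \<open>auto simp: linepath_def\<close>)
qed

lemma continuous_map_radial_lift:
  fixes K :: "'b::real_normed_vector set"
  assumes F: "continuous_map (top_of_set K) X F" and K: "convex K" "0 \<in> K"
  shows "continuous_map (top_of_set K) (universal_cover X (F 0)) (radial_lift X F)"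
proof (rule continuous_map_into_universal_cover)
  show "radial_lift X F t \<in> topspace (universal_cover X (F 0))" if "t \<in> topspace (top_of_set K)" for t
    using radial_lift_path_classes[OF F K] that by (auto intro: ucover_I)
  fix a U y assume a: "a \<in> path_classes X (F 0) y" "openin X U" "y \<in> U"
  let ?S = "{t \<in> topspace (top_of_set K). radial_lift X F t \<in> ucover_nbhd X a U y}"
  show "openin (top_of_set K) ?S"
  proof (subst openin_subopen, rule ballI)
    fix z assume z: "z \<in> ?S"
    then obtain q where q: "radial_lift X F z = class_concat X a (path_class X q)"
        "pathin (subtopology X U) q" "q 0 = y"
      by (auto simp: ucover_nbhd_def)
    have zK: "z \<in> K" using z by simp
    have q': "path_class X q \<in> path_classes X y (q 1)"
      using q pathin_subtopologyD by (intro path_classesI) auto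
    have q1: "q 1 = F z"
      using path_classes_ends_unique(2)[OF radial_lift_path_classes[OF F K zK]]
        path_classes_concat[OF a(1) q'] q(1) by metis
    have "F z \<in> U" using pathin_subtopologyD(2)[OF q(2), of 1] q1 by simp
    moreover have "openin (top_of_set K) {w \<in> K. F w \<in> U}"
      using openin_continuous_map_preimage[OF F a(2)] by simp
    ultimately obtain e where e: "e > 0" "ball z e \<inter> K \<subseteq> {w \<in> K. F w \<in> U}"
      using zK by (auto simp: openin_contains_ball)
    \<comment> \<open>Segments from \<open>z\<close> within this ball stay in the preimage of
      \<open>U\<close>. Their images are continuations inside \<open>U\<close>, which is what
      membership in the neighbourhood asks for.\<close>
    let ?T = "ball z e \<inter> K"
    have cT: "convex ?T" by (intro convex_Int convex_ball K)
    have "?T \<subseteq> ?S"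
    proof
      fix w assume w: "w \<in> ?T"
      let ?l = "F \<circ> linepath z w"
      have seg: "linepath z w ` {0..1} \<subseteq> ?T"
        unfolding linepath_image_01 by (rule closed_segment_subset[OF _ w cT]) (use zK e(1) in simp)
      have l: "pathin (subtopology X U) ?l"
      proof (rule pathin_subtopologyI)
        show "pathin X ?l" by (rule pathin_compose_convex[OF F]) (use seg in auto)
        show "?l t \<in> U" if "t \<in> {0..1}" for t
        proof -
          have "linepath z w t \<in> ?T" using seg that by blast
          then show ?thesis using e(2) by auto
        qed
      qed
      have l': "path_class X ?l \<in> path_classes X (F z) (F w)"
        using pathin_subtopologyD(1)[OF l] by (intro path_classesI) (auto simp: linepath_def)
      have e1: "q 1 = ?l 0" using q1 by (simp add: linepath_def)
      have "radial_lift X F w = class_concat X a (class_concat X (path_class X q) (path_class X ?l))"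
        using radial_lift_step[OF F K zK, of w] w class_concat_assoc[OF a(1) q'[unfolded q1] l'] q(1) by simp
      also have "class_concat X (path_class X q) (path_class X ?l) = path_class X (path_concat q ?l)"
        by (rule class_concat_path_class[OF pathin_subtopologyD(1)[OF q(2)] pathin_subtopologyD(1)[OF l] e1])
      finally have "radial_lift X F w = class_concat X a (path_class X (path_concat q ?l))" .
      moreover have "pathin (subtopology X U) (path_concat q ?l)"
        by (rule pathin_concat[OF q(2) l e1])
      ultimately have "radial_lift X F w \<in> ucover_nbhd X a U y"
        unfolding ucover_nbhd_def using q(3) by (intro CollectI exI[of _ "path_concat q ?l"]) simp
      then show "w \<in> ?S" using w by simp
    qed
    moreover have "openin (top_of_set K) ?T" by (simp add: openin_open_Int Int_commute)
    ultimately show "\<exists>T. openin (top_of_set K) T \<and> z \<in> T \<and> T \<subseteq> ?S"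
      using zK e(1) by (intro exI[of _ ?T]) simp
  qed
qed

lemma pathin_linepath:
  assumes "continuous_map (top_of_set K) X F" "convex K" "x \<in> K" "y \<in> K"
  shows "pathin X (F \<circ> linepath x y)"
  by (rule pathin_compose_convex[OF assms(1) continuous_on_linepath])
    (use assms in \<open>simp only: linepath_image_01 closed_segment_subset\<close>)

text \<open>Formulated for pairs of paths with common ends, the form in which lifts use it;
  comparing a loop with a constant path gives the usual condition on loops.\<close>

definition semilocally_1_connected :: "'a topology \<Rightarrow> bool" where
  "semilocally_1_connected X \<longleftrightarrow> (\<forall>y\<in>topspace X. \<exists>U. openin X U \<and> y \<in> U \<and>
     (\<forall>p q. pathin (subtopology X U) p \<longrightarrow> pathin (subtopology X U) q \<longrightarrow> p 0 = q 0 \<longrightarrow> p 1 = q 1 \<longrightarrow>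
        path_class X p = path_class X q))"

text \<open>\<open>linepath s t\<close> runs through the parameters from \<open>s\<close> to
  \<open>t\<close>, backwards if \<open>t < s\<close>, so the two times may come in either
  order.\<close>

lemma subpath_class:
  assumes "pathin X p" "s \<in> {0..1}" "t \<in> {0..1}"
  shows "path_class X (p \<circ> linepath s t) \<in> path_classes X (p s) (p t)"
  by (rule path_classesI[OF pathin_linepath[of "{0..1}"]]) (use assms in \<open>auto simp: pathin_def linepath_def\<close>)

lemma subpath_class_concat:
  assumes "pathin X p" "s \<in> {0..1}" "t \<in> {0..1}" "r \<in> {0..1}"
  shows "class_concat X (path_class X (p \<circ> linepath s t)) (path_class X (p \<circ> linepath t r))
     = path_class X (p \<circ> linepath s r)"
  by (rule class_concat_convex[OF assms(1)[unfolded pathin_def] convex_real_interval(5)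
        continuous_on_linepath _ continuous_on_linepath _ continuous_on_linepath])
    (use assms in \<open>simp_all add: linepath_image_01 closed_segment_subset linepath_0' linepath_1'\<close>)

lemma subpath_class_self: "path_class X (p \<circ> linepath s s) = path_class X (\<lambda>_. p s)"
  by (simp add: o_def linepath_refl)

text \<open>The unique lifting property in explicit form: a path in the cover is obtained from its
  value at one time by appending pieces of its projection. As a relation between the times
  \<open>s\<close> and \<open>t\<close> this is an equivalence relation, and it holds locally, so it
  holds throughout the connected unit interval.\<close>

lemma path_lift_unique:
  assumes X: "semilocally_1_connected X" and \<sigma>: "pathin (universal_cover X x0) \<sigma>"
    and st: "s \<in> {0..1}" "t \<in> {0..1}"
  shows "\<sigma> t = class_concat X (\<sigma> s) (path_class X ((class_end \<circ> \<sigma>) \<circ> linepath s t))"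
proof -
  define \<pi> where "\<pi> = class_end \<circ> \<sigma>"
  have \<pi>: "pathin X \<pi>"
    unfolding \<pi>_def by (rule pathin_compose[OF continuous_map_class_end \<sigma>])
  define R where "R s t \<longleftrightarrow> \<sigma> t = class_concat X (\<sigma> s) (path_class X (\<pi> \<circ> linepath s t))" for s t
  have \<sigma>t: "\<sigma> t \<in> topspace (universal_cover X x0)" if "t \<in> {0..1}" for t
    using \<sigma> that by (auto simp: pathin_def continuous_map_def Pi_def)
  then have mem: "\<sigma> t \<in> path_classes X x0 (\<pi> t)" if "t \<in> {0..1}" for t
    using ucover_class_end[OF \<sigma>t[OF that]] by (simp add: \<pi>_def)
  have trans: "R s r" if "R s t" "R t r" "s \<in> {0..1}" "t \<in> {0..1}" "r \<in> {0..1}" for s t r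
  proof -
    have "\<sigma> r = class_concat X (class_concat X (\<sigma> s) (path_class X (\<pi> \<circ> linepath s t))) (path_class X (\<pi> \<circ> linepath t r))"
      using that unfolding R_def by simp
    also have "\<dots> = class_concat X (\<sigma> s) (path_class X (\<pi> \<circ> linepath s r))"
      using class_concat_assoc[OF mem[OF that(3)] subpath_class[OF \<pi> that(3,4)] subpath_class[OF \<pi> that(4,5)]]
        subpath_class_concat[OF \<pi> that(3-5)] by simp
    finally show ?thesis unfolding R_def .
  qed
  have sym: "R t s" if "R s t" "s \<in> {0..1}" "t \<in> {0..1}" for s t
  proof -
    have "class_concat X (\<sigma> t) (path_class X (\<pi> \<circ> linepath t s)) =
        class_concat X (class_concat X (\<sigma> s) (path_class X (\<pi> \<circ> linepath s t))) (path_class X (\<pi> \<circ> linepath t s))"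
      using that unfolding R_def by simp
    also have "\<dots> = class_concat X (\<sigma> s) (path_class X (\<pi> \<circ> linepath s s))"
      using class_concat_assoc[OF mem[OF that(2)] subpath_class[OF \<pi> that(2,3)] subpath_class[OF \<pi> that(3,2)]]
        subpath_class_concat[OF \<pi> that(2,3,2)] by simp
    also have "\<dots> = \<sigma> s"
      unfolding subpath_class_self by (rule class_concat_const_right[OF mem[OF that(2)]])
    finally show ?thesis unfolding R_def by simp
  qed
  have loc: "\<exists>T. openin (top_of_set {0..1}) T \<and> a \<in> T \<and> (\<forall>x\<in>T. R a x)" if a: "a \<in> {0..1}" for a
  proof -
    obtain U where U: "openin X U" "\<pi> a \<in> U"
      "\<And>p q. \<lbrakk>pathin (subtopology X U) p; pathin (subtopology X U) q; p 0 = q 0; p 1 = q 1\<rbrakk> \<Longrightarrow>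
        path_class X p = path_class X q"
      using X path_classes_topspace(2)[OF mem[OF a]] unfolding semilocally_1_connected_def by blast
    let ?N = "ucover_nbhd X (\<sigma> a) U (\<pi> a)"
    have "openin (top_of_set {0..1}) {t \<in> {0..1}. \<sigma> t \<in> ?N}"
      using openin_continuous_map_preimage[OF \<sigma>[unfolded pathin_def] openin_ucover_nbhd[OF mem[OF a] U(1,2)]] by simp
    moreover have "\<sigma> a \<in> ?N" by (rule ucover_nbhd_self[OF mem[OF a] U(2)])
    ultimately obtain e where e: "e > 0" "ball a e \<inter> {0..1} \<subseteq> {t \<in> {0..1}. \<sigma> t \<in> ?N}"
      using a by (auto simp: openin_contains_ball)
    let ?T = "ball a e \<inter> {0..1}"
    have cT: "convex ?T" by (intro convex_Int convex_ball convex_real_interval)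
    have "R a x" if x: "x \<in> ?T" for x
    proof -
      obtain q where q: "\<sigma> x = class_concat X (\<sigma> a) (path_class X q)" "pathin (subtopology X U) q" "q 0 = \<pi> a"
        using x e(2) by (auto simp: ucover_nbhd_def)
      have x01: "x \<in> {0..1}" using x by simp
      have q': "path_class X q \<in> path_classes X (\<pi> a) (q 1)"
        using q pathin_subtopologyD by (intro path_classesI) auto
      have q1: "q 1 = \<pi> x"
        using path_classes_ends_unique(2)[OF mem[OF x01]] path_classes_concat[OF mem[OF a] q'] q(1) by metis
      have seg: "linepath a x ` {0..1} \<subseteq> ?T"
        using cT x a e(1) by (simp add: linepath_image_01 closed_segment_subset)
      \<comment> \<open>Near \<open>a\<close> the lift stays in one basic neighbourhood, so its
        projection and the path \<open>q\<close> provided by that neighbourhood both run inside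
        \<open>U\<close>. They have the same ends, and semilocal simple connectedness identifies
        their classes.\<close>
      have "pathin (subtopology X U) (\<pi> \<circ> linepath a x)"
      proof (rule pathin_subtopologyI)
        show "pathin X (\<pi> \<circ> linepath a x)"
          by (rule pathin_linepath[OF \<pi>[unfolded pathin_def]]) (use a x in auto)
        fix t :: real assume "t \<in> {0..1}"
        then have "linepath a x t \<in> ?T" using seg by blast
        then have "linepath a x t \<in> {0..1}" "\<sigma> (linepath a x t) \<in> ?N" using e(2) by blast+
        then obtain z where "z \<in> U" "\<sigma> (linepath a x t) \<in> path_classes X x0 z"
          using ucover_nbhd_path_classes[OF mem[OF a]] by blast
        then show "(\<pi> \<circ> linepath a x) t \<in> U"
          using class_end[of "\<sigma> (linepath a x t)"] by (simp add: \<pi>_def)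
      qed
      then have "path_class X q = path_class X (\<pi> \<circ> linepath a x)"
        by (rule U(3)[OF q(2)]) (auto simp: q q1 linepath_def)
      then show ?thesis unfolding R_def using q(1) by simp
    qed
    moreover have "openin (top_of_set {0..1}) ?T" by (metis Int_commute open_ball openin_open_Int)
    ultimately show ?thesis
      using a e(1) by (intro exI[of _ ?T]) auto
  qed
  have "R s t"
    by (rule connected_equivalence_relation[of "{0..1}" s t R])
      (simp, rule st(1), rule st(2), rule sym, assumption+, rule trans, assumption+, rule loc, assumption)
  then show ?thesis unfolding R_def \<pi>_def .
qed

corollary path_lift_eq:
  assumes X: "semilocally_1_connected X"
    and \<sigma>: "pathin (universal_cover X x0) \<sigma>" and \<tau>: "pathin (universal_cover X x0) \<tau>"
    and 0: "\<sigma> 0 = \<tau> 0" and e: "\<And>t. t \<in> {0..1} \<Longrightarrow> class_end (\<sigma> t) = class_end (\<tau> t)"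
    and t: "t \<in> {0..1}"
  shows "\<sigma> t = \<tau> t"
proof -
  have p: "pathin X (class_end \<circ> \<sigma> \<circ> linepath 0 t)"
    by (rule pathin_linepath[OF pathin_compose[OF continuous_map_class_end \<sigma>, unfolded pathin_def]])
      (use t in auto)
  have "linepath 0 t u \<in> {0..1}" if "u \<in> {0..1}" for u
    using that t by (auto simp: linepath_def mult_le_one)
  then have "path_class X (class_end \<circ> \<sigma> \<circ> linepath 0 t) = path_class X (class_end \<circ> \<tau> \<circ> linepath 0 t)"
    by (intro path_class_cong[OF p]) (use e in auto)
  then show ?thesis
    using path_lift_unique[OF X \<sigma> _ t, of 0] path_lift_unique[OF X \<tau> _ t, of 0] 0 by simp
qed

section \<open>Low-dimensional singular chains\<close>

text \<open>The linear extension of \<open>w\<close>. Integers are encoded as the free group on one generator, so that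
  \<open>frag_extend\<close> applies.\<close>

definition weight :: "('a \<Rightarrow> int) \<Rightarrow> ('a \<Rightarrow>\<^sub>0 int) \<Rightarrow> int" where
  "weight w c = poly_mapping.lookup (frag_extend (\<lambda>k. frag_cmul (w k) (frag_of ())) c) ()"

lemma weight_0 [simp]: "weight w 0 = 0"
  and weight_of [simp]: "weight w (frag_of k) = w k"
  and weight_add: "weight w (c + d) = weight w c + weight w d"
  and weight_diff: "weight w (c - d) = weight w c - weight w d"
  and weight_cmul: "weight w (frag_cmul n c) = n * weight w c"
  by (simp_all add: weight_def frag_extend_add frag_extend_diff frag_extend_cmul
      lookup_add lookup_minus)

lemma weight_extend: "weight w (frag_extend f c) = weight (\<lambda>k. weight w (f k)) c"
proof -
  have "Poly_Mapping.keys c \<subseteq> UNIV" by simp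
  then show ?thesis
    by (induction c rule: frag_induction) (auto simp: frag_extend_diff weight_diff)
qed

lemma weight_cong: "(\<And>k. k \<in> Poly_Mapping.keys c \<Longrightarrow> w k = w' k) \<Longrightarrow> weight w c = weight w' c"
  unfolding weight_def by (simp cong: frag_extend_eq)

lemma weight_nonzero:
  assumes "weight w c \<noteq> 0"
  obtains k where "k \<in> Poly_Mapping.keys c" "w k \<noteq> 0"
proof -
  have "weight w c = 0" if "\<And>k. k \<in> Poly_Mapping.keys c \<Longrightarrow> w k = 0"
    using that weight_cong[of c w "\<lambda>_. 0"] by (simp add: weight_def frag_extend_def)
  then show thesis using assms that by blast
qed

text \<open>Low-dimensional simplices as functions of the coordinates 1 and 2. The restriction makes
  them extensional on the standard simplex, as singular simplices are required to be.\<close>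

definition point_simplex :: "'a \<Rightarrow> (nat \<Rightarrow> real) \<Rightarrow> 'a" where
  "point_simplex a = restrict (\<lambda>_. a) (standard_simplex 0)"

definition edge_simplex :: "(real \<Rightarrow> 'a) \<Rightarrow> (nat \<Rightarrow> real) \<Rightarrow> 'a" where
  "edge_simplex \<tau> = restrict (\<lambda>x. \<tau> (x 1)) (standard_simplex 1)"

definition triangle_simplex :: "(real \<times> real \<Rightarrow> 'a) \<Rightarrow> (nat \<Rightarrow> real) \<Rightarrow> 'a" where
  "triangle_simplex L = restrict (\<lambda>x. L (x 1, x 2)) (standard_simplex 2)"

text \<open>The standard 2-simplex with coordinate 0 eliminated. Its vertex 0 becomes the origin,
  the centre from which radial lifts are taken.\<close>

definition triangle :: "(real \<times> real) set" where
  "triangle = {z. 0 \<le> fst z \<and> 0 \<le> snd z \<and> fst z + snd z \<le> 1}"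

lemma convex_triangle: "convex triangle"
proof (rule convexI)
  fix x y :: "real \<times> real" and u v :: real
  assume *: "x \<in> triangle" "y \<in> triangle" "0 \<le> u" "0 \<le> v" "u + v = 1"
  have "u * (fst x + snd x) \<le> u * 1" "v * (fst y + snd y) \<le> v * 1"
    by (rule mult_left_mono; use * in \<open>simp add: triangle_def\<close>)+
  then show "u *\<^sub>R x + v *\<^sub>R y \<in> triangle"
    using * by (simp add: triangle_def algebra_simps)
qed

lemma singular_simplex_point: "a \<in> topspace Y \<Longrightarrow> singular_simplex 0 Y (point_simplex a)"
  by (simp add: singular_simplex_def point_simplex_def)

lemma singular_simplex_0_cases:
  assumes "singular_simplex 0 Y f"
  obtains a where "a \<in> topspace Y" "f = point_simplex a"
proof
  let ?v = "\<lambda>j. if j = 0 then 1 else (0::real)"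
  show "f ?v \<in> topspace Y"
    using assms by (auto simp: singular_simplex_def continuous_map_def standard_simplex_0)
  have "f x = point_simplex (f ?v) x" for x
    using assms by (cases "x = ?v") (simp_all add: singular_simplex_def point_simplex_def standard_simplex_0 extensional_def)
  then show "f = point_simplex (f ?v)" by blast
qed

lemma continuous_map_simplex_coord:
  "continuous_map (subtopology (powertop_real UNIV) (standard_simplex p)) euclideanreal (\<lambda>x. x i)"
  by (rule continuous_map_from_subtopology[OF continuous_map_product_projection]) simp

lemma standard_simplex_1: "x \<in> standard_simplex 1 \<Longrightarrow> x 0 = 1 - x 1 \<and> x 1 \<in> {0..1}"
  by (auto simp: standard_simplex_def)

lemma standard_simplex_2: "x \<in> standard_simplex 2 \<Longrightarrow> x 0 = 1 - x 1 - x 2 \<and> (x 1, x 2) \<in> triangle"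
proof -
  assume "x \<in> standard_simplex 2"
  then have "0 \<le> x 0" "0 \<le> x 1" "0 \<le> x 2" "x 0 + x 1 + x 2 = 1"
    by (auto simp: standard_simplex_def numeral_2_eq_2)
  then show ?thesis by (simp add: triangle_def)
qed

lemma singular_simplex_edge:
  assumes "pathin Y \<tau>"
  shows "singular_simplex 1 Y (edge_simplex \<tau>)"
proof -
  have "continuous_map (subtopology (powertop_real UNIV) (standard_simplex 1)) (top_of_set {0..1}) (\<lambda>x. x 1)"
    using continuous_map_simplex_coord standard_simplex_1 by (auto simp: continuous_map_in_subtopology)
  from continuous_map_compose[OF this assms[unfolded pathin_def]]
  show ?thesis
    by (simp add: singular_simplex_def edge_simplex_def o_def)
qed

lemma singular_simplex_1_cases:
  assumes "singular_simplex 1 Y f"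
  obtains \<sigma> where "pathin Y \<sigma>" "f = edge_simplex \<sigma>"
proof
  let ?e = "\<lambda>t::real. \<lambda>i::nat. if i = 0 then 1 - t else if i = 1 then t else 0"
  have in1: "?e t \<in> standard_simplex 1" if "t \<in> {0..1}" for t
    using that by (auto simp: standard_simplex_def)
  have "continuous_map (top_of_set {0..1}) (powertop_real UNIV) ?e"
    unfolding continuous_map_componentwise_UNIV
  proof
    fix k :: nat
    show "continuous_map (top_of_set {0..1}) euclideanreal (\<lambda>t. ?e t k)"
      by (cases "k = 0"; cases "k = 1") (auto intro!: continuous_intros)
  qed
  then have "continuous_map (top_of_set {0..1}) (subtopology (powertop_real UNIV) (standard_simplex 1)) ?e"
    using in1 by (auto simp: continuous_map_in_subtopology)
  then show "pathin Y (f \<circ> ?e)"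
    unfolding pathin_def using assms by (intro continuous_map_compose) (auto simp: singular_simplex_def)
  have e: "?e (x 1) = x" if "x \<in> standard_simplex 1" for x
    using standard_simplex_1[OF that] that by (auto simp: fun_eq_iff standard_simplex_def)
  have "f x = edge_simplex (f \<circ> ?e) x" for x
  proof (cases "x \<in> standard_simplex 1")
    case True
    then show ?thesis
      by (simp only: edge_simplex_def restrict_apply' o_apply e)
  next
    case False
    then show ?thesis
      using assms by (simp add: singular_simplex_def edge_simplex_def extensional_def)
  qed
  then show "f = edge_simplex (f \<circ> ?e)" by blast
qed

lemma singular_simplex_triangle:
  assumes "continuous_map (top_of_set triangle) Y L"
  shows "singular_simplex 2 Y (triangle_simplex L)"
proof -
  have "continuous_map (subtopology (powertop_real UNIV) (standard_simplex 2)) euclidean (\<lambda>x. (x 1, x 2))"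
    unfolding prod_topology_euclidean[symmetric]
    by (intro continuous_map_pairedI continuous_map_simplex_coord)
  then have "continuous_map (subtopology (powertop_real UNIV) (standard_simplex 2)) (top_of_set triangle) (\<lambda>x. (x 1, x 2))"
    using standard_simplex_2 by (auto simp: continuous_map_in_subtopology)
  from continuous_map_compose[OF this assms]
  show ?thesis
    by (simp add: singular_simplex_def triangle_simplex_def o_def)
qed

lemma edge_simplex_cong:
  "(\<And>t. t \<in> {0..1} \<Longrightarrow> \<sigma> t = \<tau> t) \<Longrightarrow> edge_simplex \<sigma> = edge_simplex \<tau>"
  unfolding edge_simplex_def by (rule restrict_ext) (use standard_simplex_1 in blast)

lemma chain_boundary_edge:
  "chain_boundary 1 (frag_of (edge_simplex \<tau>)) = frag_of (point_simplex (\<tau> 1)) - frag_of (point_simplex (\<tau> 0))"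
proof -
  have v: "(\<lambda>j. if j = 0 then 1 else (0::real)) \<in> standard_simplex 0"
    by simp
  have f: "simplical_face k (\<lambda>j. if j = 0 then 1 else (0::real)) \<in> standard_simplex 1" if "k \<le> 1" for k
    using simplical_face_in_standard_simplex[of 1 k] that v by simp
  have 0: "singular_face 1 0 (edge_simplex \<tau>) = point_simplex (\<tau> 1)"
    unfolding singular_face_def point_simplex_def edge_simplex_def
    using f[of 0] by (auto intro!: restrict_ext simp: standard_simplex_0 simplical_face_def)
  have 1: "singular_face 1 1 (edge_simplex \<tau>) = point_simplex (\<tau> 0)"
    unfolding singular_face_def point_simplex_def edge_simplex_def
    using f[of 1] by (auto intro!: restrict_ext simp: standard_simplex_0 simplical_face_def)
  show ?thesis
    using 0 1 by (simp add: chain_boundary_of)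
qed

text \<open>The three terms are the faces from vertex 1 to 2, from 0 to 2 and from 0 to 1; the edge
  parameter increases towards the vertex of larger index.\<close>

lemma chain_boundary_triangle:
  "chain_boundary 2 (frag_of (triangle_simplex L)) =
     frag_of (edge_simplex (\<lambda>t. L (1 - t, t))) - frag_of (edge_simplex (\<lambda>t. L (0, t)))
       + frag_of (edge_simplex (\<lambda>t. L (t, 0)))"
proof -
  have f: "simplical_face k x \<in> standard_simplex 2" if "k \<le> 2" "x \<in> standard_simplex 1" for k and x :: "nat \<Rightarrow> real"
    using simplical_face_in_standard_simplex[of 2 k x] that by simp
  have 0: "singular_face 2 0 (triangle_simplex L) = edge_simplex (\<lambda>t. L (1 - t, t))"
    unfolding singular_face_def edge_simplex_def triangle_simplex_def
    by (simp, rule restrict_ext) (use f[of 0] standard_simplex_1 in \<open>auto simp: simplical_face_def\<close>)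
  have 1: "singular_face 2 1 (triangle_simplex L) = edge_simplex (\<lambda>t. L (0, t))"
    unfolding singular_face_def edge_simplex_def triangle_simplex_def
    by (simp, rule restrict_ext) (use f[of 1] standard_simplex_1 in \<open>auto simp: simplical_face_def\<close>)
  have 2: "singular_face 2 2 (triangle_simplex L) = edge_simplex (\<lambda>t. L (t, 0))"
    unfolding singular_face_def edge_simplex_def triangle_simplex_def
    by (simp, rule restrict_ext) (use f[of 2] standard_simplex_1 in \<open>auto simp: simplical_face_def\<close>)
  show ?thesis
    using 0 1 2 by (simp add: chain_boundary_of numeral_2_eq_2)
qed

section \<open>Homology of the universal cover\<close>

text \<open>The square is collapsed onto the triangle along its two constant sides, so a homotopy
  factors through the triangle.\<close>

lemma triangle_filling:
  assumes hom: "path_homotopic X (path_concat p q) r" and pq: "p 1 = q 0"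
  obtains F where "continuous_map (top_of_set triangle) X F"
    "\<And>t. t \<in> {0..1} \<Longrightarrow> F (t, 0) = p t" "\<And>t. t \<in> {0..1} \<Longrightarrow> F (1 - t, t) = q t"
    "\<And>t. t \<in> {0..1} \<Longrightarrow> F (0, t) = r t"
proof -
  let ?S = "{0..1::real} \<times> {0..1::real}"
  obtain h where h: "continuous_map (top_of_set ?S) X h" "\<And>x. h (0,x) = path_concat p q x"
      "\<And>x. h (1,x) = r x" "\<And>t. t \<in> {0..1} \<Longrightarrow> h (t,0) = p 0 \<and> h (t,1) = q 1"
    using hom unfolding path_homotopic_def homotopic_with_def prod_topology_subtopology_eu path_concat_ends by blast
  \<comment> \<open>\<open>\<psi> (0, t)\<close> runs from (0,0) to (1,0) and on to (0,1), with
    first coordinate \<open>m t\<close>; \<open>\<psi> (1, t)\<close> runs along the third side. In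
    between, the point moves along the line on which half the first coordinate plus the second
    equals \<open>t\<close>.\<close>
  define m where "m t = min (2 * t) (2 - 2 * t)" for t :: real
  define \<psi> where "\<psi> z = ((1 - fst z) * m (snd z), snd z - (1 - fst z) * m (snd z) / 2)" for z
  have m: "0 \<le> m t" "m t / 2 \<le> t" "m t / 2 \<le> 1 - t" if "t \<in> {0..1}" for t
    using that by (auto simp: m_def min_def)
  have \<psi>_in: "\<psi> z \<in> triangle" if z: "z \<in> ?S" for z
  proof -
    have t: "snd z \<in> {0..1}" and s: "0 \<le> 1 - fst z" "1 - fst z \<le> 1" using z by auto
    have "0 \<le> (1 - fst z) * m (snd z)" using m[OF t] s by simp
    moreover have "(1 - fst z) * m (snd z) \<le> m (snd z)" using m[OF t] s mult_left_le_one_le by blast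
    moreover define y where "y = (1 - fst z) * m (snd z)"
    ultimately have "0 \<le> y" "y \<le> m (snd z)" by auto
    then show ?thesis using m[OF t] unfolding triangle_def \<psi>_def y_def[symmetric] by simp
  qed
  have "triangle \<subseteq> \<psi> ` ?S"
  proof
    fix y assume y: "y \<in> triangle"
    obtain a b where ab: "y = (a, b)" by (cases y)
    have b: "0 \<le> a" "0 \<le> b" "a + b \<le> 1" using y ab by (auto simp: triangle_def)
    let ?t = "a / 2 + b"
    have t: "?t \<in> {0..1}" using b by auto
    have am: "a \<le> m ?t" using b by (auto simp: m_def)
    define s where "s = (if m ?t = 0 then 0 else 1 - a / m ?t)"
    have "(1 - s) * m ?t = a" using am b(1) by (auto simp: s_def)
    moreover have "s \<in> {0..1}"
      using am b(1) m(1)[OF t] by (auto simp: s_def divide_simps)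
    ultimately show "y \<in> \<psi> ` ?S"
      using t ab by (intro image_eqI[of _ _ "(s, ?t)"]) (auto simp: \<psi>_def)
  qed
  then have img: "\<psi> ` ?S = triangle" using \<psi>_in by blast
  have "continuous_on ?S \<psi>"
    unfolding \<psi>_def m_def by (intro continuous_intros) auto
  then have "continuous_map (top_of_set ?S) (top_of_set triangle) \<psi>"
    using \<psi>_in by auto
  \<comment> \<open>A continuous surjection from a compact space onto a Hausdorff space is a
    quotient map, so \<open>h\<close> descends to the triangle once it is constant on fibres. The
    only nontrivial fibres have \<open>m t = 0\<close>: they are the two sides on which
    \<open>h\<close> is constant.\<close>
  then have quot: "quotient_map (top_of_set ?S) (top_of_set triangle) \<psi>"
    by (rule T1_Spaces.continuous_imp_quotient_map)
      (use img in \<open>auto simp: compact_space_subtopology Hausdorff_space_subtopology compact_Times\<close>)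
  have fib: "h x = h y" if xy: "x \<in> topspace (top_of_set ?S)" "y \<in> topspace (top_of_set ?S)" "\<psi> x = \<psi> y" for x y
  proof -
    obtain s t s' t' where st: "x = (s,t)" "y = (s',t')" by (cases x, cases y)
    have e1: "(1 - s) * m t = (1 - s') * m t'" and e2: "t - (1 - s) * m t / 2 = t' - (1 - s') * m t' / 2"
      using xy(3) by (auto simp: \<psi>_def st)
    then have t: "t' = t" by simp
    show ?thesis
    proof (cases "m t = 0")
      case True
      then have "t = 0 \<or> t = 1" by (auto simp: m_def min_def split: if_splits)
      then show ?thesis using h(4)[of s] h(4)[of s'] xy(1,2) by (auto simp: st t)
    next
      case False
      then show ?thesis using e1 by (simp add: st t)
    qed
  qed
  have "\<exists>F. continuous_map (top_of_set triangle) X F \<and> (\<forall>x\<in>topspace (top_of_set ?S). F (\<psi> x) = h x)"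
  proof (rule quotient_map_lift_exists[OF quot h(1)])
    show "h x = h y" if "x \<in> topspace (top_of_set ?S)" "y \<in> topspace (top_of_set ?S)" "\<psi> x = \<psi> y" for x y
      using that by (rule fib)
  qed blast
  then obtain F where F: "continuous_map (top_of_set triangle) X F"
    "\<And>x. x \<in> topspace (top_of_set ?S) \<Longrightarrow> F (\<psi> x) = h x"
    by blast
  show thesis
  proof
    fix t :: real assume t: "t \<in> {0..1}"
    have "\<psi> (0, t/2) = (t, 0)" using t by (auto simp: \<psi>_def m_def min_def)
    then show "F (t, 0) = p t" using F(2)[of "(0, t/2)"] t h(2) by (simp add: path_concat_def)
    have "\<psi> (0, (1 + t)/2) = (1 - t, t)" using t by (auto simp: \<psi>_def m_def min_def field_simps)
    then have "F (1 - t, t) = path_concat p q ((1 + t)/2)" using F(2)[of "(0, (1 + t)/2)"] t h(2) by simp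
    also have "\<dots> = q t" using t pq by (cases "t = 0") (auto simp: path_concat_def field_simps)
    finally show "F (1 - t, t) = q t" .
    have "\<psi> (1, t) = (0, t)" by (simp add: \<psi>_def)
    then show "F (0, t) = r t" using F(2)[of "(1, t)"] t h(3) by simp
  qed (rule F(1))
qed

text \<open>The tautological edge of the cover from the base class to \<open>a\<close>: a chosen
  representative of \<open>a\<close>, lifted.\<close>

definition cone_edge :: "'a topology \<Rightarrow> (real \<Rightarrow> 'a) set \<Rightarrow> (nat \<Rightarrow> real) \<Rightarrow> (real \<Rightarrow> 'a) set" where
  "cone_edge X a = edge_simplex (radial_lift X (SOME p. p \<in> a))"

lemma cone_path:
  assumes a: "a \<in> path_classes X x0 z"
  defines "\<tau> \<equiv> radial_lift X (SOME p. p \<in> a)"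
  shows "pathin (universal_cover X x0) \<tau>" "\<tau> 0 = path_class X (\<lambda>_. x0)" "\<tau> 1 = a"
proof -
  define p where "p = (SOME p. p \<in> a)"
  have p: "pathin X p" "p 0 = x0" "p 1 = z" "path_class X p = a"
    using path_classes_member[OF a some_mem_path_class[OF a]] by (auto simp: p_def)
  show "pathin (universal_cover X x0) \<tau>"
    using continuous_map_radial_lift[OF p(1)[unfolded pathin_def]] p(2)
    unfolding pathin_def \<tau>_def p_def[symmetric] by simp
  show "\<tau> 0 = path_class X (\<lambda>_. x0)" "\<tau> 1 = a"
    unfolding \<tau>_def p_def[symmetric] by (simp_all add: radial_lift_def o_def p)
qed

lemma singular_simplex_cone_edge:
  "a \<in> path_classes X x0 z \<Longrightarrow> singular_simplex 1 (universal_cover X x0) (cone_edge X a)"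
  unfolding cone_edge_def by (intro singular_simplex_edge cone_path)

lemma chain_boundary_cone_edge:
  assumes "a \<in> path_classes X x0 z"
  shows "chain_boundary 1 (frag_of (cone_edge X a)) =
    frag_of (point_simplex a) - frag_of (point_simplex (path_class X (\<lambda>_. x0)))"
  unfolding cone_edge_def chain_boundary_edge by (simp add: cone_path[OF assms])

text \<open>Let \<open>p\<close> and \<open>r\<close> be the chosen representatives of the ends of
  \<open>\<sigma>\<close>, and \<open>q\<close> its projection. By unique lifting, \<open>p\<close>
  followed by \<open>q\<close> is homotopic to \<open>r\<close>, and the homotopy fills a triangle
  in \<open>X\<close>. In its radial lift the two sides at the origin are cone edges, and the third
  is \<open>\<sigma>\<close>, again by unique lifting.\<close>

lemma cone_triangle:
  assumes X: "semilocally_1_connected X" and \<sigma>: "pathin (universal_cover X x0) \<sigma>"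
  obtains T where "singular_simplex 2 (universal_cover X x0) T"
    "chain_boundary 2 (frag_of T) =
       frag_of (edge_simplex \<sigma>) - frag_of (cone_edge X (\<sigma> 1)) + frag_of (cone_edge X (\<sigma> 0))"
proof -
  define q where "q = class_end \<circ> \<sigma>"
  have \<sigma>t: "\<sigma> t \<in> path_classes X x0 (q t)" if "t \<in> {0..1}" for t
    using \<sigma> that ucover_class_end[of "\<sigma> t"] by (auto simp: q_def pathin_def continuous_map_def Pi_def)
  define p where "p = (SOME p. p \<in> \<sigma> 0)"
  define r where "r = (SOME p. p \<in> \<sigma> 1)"
  have p: "pathin X p" "p 0 = x0" "p 1 = q 0" "path_class X p = \<sigma> 0"
    using path_classes_member[OF \<sigma>t[of 0] some_mem_path_class[OF \<sigma>t[of 0]]] by (auto simp: p_def)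
  have r: "pathin X r" "r 0 = x0" "r 1 = q 1" "path_class X r = \<sigma> 1"
    using path_classes_member[OF \<sigma>t[of 1] some_mem_path_class[OF \<sigma>t[of 1]]] by (auto simp: r_def)
  have q: "pathin X q"
    unfolding q_def by (rule pathin_compose[OF continuous_map_class_end \<sigma>])
  have "path_class X (path_concat p q) = class_concat X (\<sigma> 0) (path_class X q)"
    using class_concat_path_class[OF p(1) q p(3)] p(4) by simp
  also have "\<dots> = \<sigma> 1"
    using path_lift_unique[OF X \<sigma>, of 0 1] by (simp add: q_def linepath_def o_def)
  finally have pqr: "path_homotopic X (path_concat p q) r"
    using path_class_eq_iff[OF pathin_concat[OF p(1) q p(3)], of r] r(4) by simp
  obtain F where F: "continuous_map (top_of_set triangle) X F"
    "\<And>t. t \<in> {0..1} \<Longrightarrow> F (t, 0) = p t" "\<And>t. t \<in> {0..1} \<Longrightarrow> F (1 - t, t) = q t"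
    "\<And>t. t \<in> {0..1} \<Longrightarrow> F (0, t) = r t"
    using triangle_filling[OF pqr p(3)] by blast
  have 0: "0 \<in> triangle" by (simp add: triangle_def)
  have F0: "F 0 = x0" using F(2)[of 0] p(2) by (simp add: zero_prod_def)
  define L where "L = radial_lift X F"
  have L: "continuous_map (top_of_set triangle) (universal_cover X x0) L"
    unfolding L_def using continuous_map_radial_lift[OF F(1) convex_triangle 0] F0 by simp
  have e0: "L (t, 0) = radial_lift X p t" if t: "t \<in> {0..1}" for t
  proof -
    have "u * t \<in> {0..1}" if "u \<in> {0..1}" for u using that t by (auto simp: mult_le_one)
    then have "path_class X (p \<circ> (\<lambda>u. u *\<^sub>R t)) = path_class X (F \<circ> (\<lambda>u. u *\<^sub>R (t, 0)))"
      by (intro path_class_cong pathin_compose_convex[OF p(1)[unfolded pathin_def]])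
        (use F(2) in \<open>auto intro!: continuous_intros\<close>)
    then show ?thesis by (simp add: L_def radial_lift_def)
  qed
  have e1: "L (0, t) = radial_lift X r t" if t: "t \<in> {0..1}" for t
  proof -
    have "u * t \<in> {0..1}" if "u \<in> {0..1}" for u using that t by (auto simp: mult_le_one)
    then have "path_class X (r \<circ> (\<lambda>u. u *\<^sub>R t)) = path_class X (F \<circ> (\<lambda>u. u *\<^sub>R (0, t)))"
      by (intro path_class_cong pathin_compose_convex[OF r(1)[unfolded pathin_def]])
        (use F(4) in \<open>auto intro!: continuous_intros\<close>)
    then show ?thesis by (simp add: L_def radial_lift_def)
  qed
  have hyp: "(1 - t, t) \<in> triangle" if "t \<in> {0..1}" for t :: real
    using that by (auto simp: triangle_def)
  have e2: "L (1 - t, t) = \<sigma> t" if t: "t \<in> {0..1}" for t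
  proof (rule path_lift_eq[OF X _ \<sigma> _ _ t, of "\<lambda>t. L (1 - t, t)"])
    have "pathin (universal_cover X x0) (L \<circ> (\<lambda>t. (1 - t, t)))"
      by (rule pathin_compose_convex[OF L]) (use hyp in \<open>auto intro!: continuous_intros\<close>)
    then show "pathin (universal_cover X x0) (\<lambda>t. L (1 - t, t))" by (simp add: o_def)
    show "L (1 - 0, 0) = \<sigma> 0"
      using e0[of 1] p(4) by (simp add: radial_lift_def o_def)
    show "class_end (L (1 - u, u)) = class_end (\<sigma> u)" if u: "u \<in> {0..1}" for u
      using class_end[OF radial_lift_path_classes[OF F(1) convex_triangle 0 hyp[OF u]]] F(3)[OF u]
      by (simp add: L_def q_def)
  qed
  show thesis
  proof
    show "singular_simplex 2 (universal_cover X x0) (triangle_simplex L)"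
      by (rule singular_simplex_triangle[OF L])
    show "chain_boundary 2 (frag_of (triangle_simplex L)) =
       frag_of (edge_simplex \<sigma>) - frag_of (cone_edge X (\<sigma> 1)) + frag_of (cone_edge X (\<sigma> 0))"
      unfolding chain_boundary_triangle cone_edge_def p_def[symmetric] r_def[symmetric]
      using edge_simplex_cong[OF e0] edge_simplex_cong[OF e1] edge_simplex_cong[OF e2] by simp
  qed
qed

text \<open>The function with value 1 at 0 and value 0 elsewhere is the only point of the standard
  0-simplex. This is the degree 0 part of a contraction onto the base point.\<close>

definition cone_chain :: "'a topology \<Rightarrow> (real \<Rightarrow> 'a) set chain \<Rightarrow> (real \<Rightarrow> 'a) set chain" where
  "cone_chain X = frag_extend (\<lambda>f. frag_of (cone_edge X (f (\<lambda>j. if j = 0 then 1 else 0))))"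

lemma cone_chain_point: "cone_chain X (frag_of (point_simplex a)) = frag_of (cone_edge X a)"
  by (simp add: cone_chain_def point_simplex_def)

text \<open>Cone edges join every point to the base point, so a 0-chain is homologous to a multiple
  of it; this is how \<open>H\<^sub>0\<close> becomes the integers.\<close>

lemma cone_chain_0_homology:
  assumes "singular_chain 0 (universal_cover X x0) c"
  shows "singular_chain 1 (universal_cover X x0) (cone_chain X c)"
    and "chain_boundary 1 (cone_chain X c) =
      c - frag_cmul (weight (\<lambda>_. 1) c) (frag_of (point_simplex (path_class X (\<lambda>_. x0))))"
proof -
  have "singular_chain 1 (universal_cover X x0) (cone_chain X c) \<and> chain_boundary 1 (cone_chain X c) =
      c - frag_cmul (weight (\<lambda>_. 1) c) (frag_of (point_simplex (path_class X (\<lambda>_. x0))))"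
    using assms unfolding singular_chain_def
  proof (induction c rule: frag_induction)
    case zero
    then show ?case by (simp add: cone_chain_def)
  next
    case (one f)
    then obtain a where a: "a \<in> topspace (universal_cover X x0)" "f = point_simplex a"
      by (auto elim: singular_simplex_0_cases)
    show ?case
      unfolding a(2) cone_chain_point chain_boundary_cone_edge[OF ucover_class_end[OF a(1)]]
      using singular_simplex_cone_edge[OF ucover_class_end[OF a(1)]] by simp
  next
    case (diff a b)
    have "Poly_Mapping.keys (cone_chain X (a - b)) \<subseteq> Collect (singular_simplex 1 (universal_cover X x0))"
      unfolding cone_chain_def frag_extend_diff
      by (rule order.trans[OF keys_diff Un_least]) (use diff in \<open>simp_all add: cone_chain_def\<close>)
    moreover have "chain_boundary 1 (cone_chain X (a - b)) = chain_boundary 1 (cone_chain X a) - chain_boundary 1 (cone_chain X b)"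
      by (simp add: cone_chain_def frag_extend_diff chain_boundary_diff)
    ultimately show ?case
      using diff by (simp add: weight_diff frag_cmul_diff_distrib)
  qed
  then show "singular_chain 1 (universal_cover X x0) (cone_chain X c)"
    "chain_boundary 1 (cone_chain X c) =
      c - frag_cmul (weight (\<lambda>_. 1) c) (frag_of (point_simplex (path_class X (\<lambda>_. x0))))"
    by (auto simp: singular_chain_def)
qed

lemma weight_chain_boundary:
  assumes "singular_chain 1 Y c"
  shows "weight (\<lambda>_. 1) (chain_boundary 1 c) = 0"
  using assms unfolding singular_chain_def
proof (induction c rule: frag_induction)
  case (one f)
  then obtain \<sigma> where "f = edge_simplex \<sigma>"
    using singular_simplex_1_cases[of Y f] by blast
  then show ?case by (simp only: chain_boundary_edge weight_diff weight_of)
next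
  case (diff a b)
  then show ?case by (simp add: chain_boundary_diff weight_diff)
qed simp

text \<open>Modulo boundaries a 1-chain equals the cone over its boundary: for a single edge the
  difference is the boundary of its cone triangle, and both sides are linear. For a cycle the cone
  is 0.\<close>

lemma universal_cover_H1_trivial:
  assumes X: "semilocally_1_connected X" and c: "singular_chain 1 (universal_cover X x0) c"
    and cyc: "chain_boundary 1 c = 0"
  obtains d where "singular_chain 2 (universal_cover X x0) d" "chain_boundary 2 d = c"
proof -
  let ?Y = "universal_cover X x0"
  have "\<exists>d. singular_chain 2 ?Y d \<and> chain_boundary 2 d = c - cone_chain X (chain_boundary 1 c)"
    using c unfolding singular_chain_def
  proof (induction c rule: frag_induction)
    case zero
    then show ?case by (intro exI[of _ 0]) (simp add: cone_chain_def)
  next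
    case (one f)
    then obtain \<sigma> where \<sigma>: "pathin ?Y \<sigma>" "f = edge_simplex \<sigma>"
      using singular_simplex_1_cases[of ?Y f] by blast
    obtain T where T: "singular_simplex 2 ?Y T" "chain_boundary 2 (frag_of T) =
       frag_of (edge_simplex \<sigma>) - frag_of (cone_edge X (\<sigma> 1)) + frag_of (cone_edge X (\<sigma> 0))"
      using cone_triangle[OF X \<sigma>(1)] by blast
    have "cone_chain X (chain_boundary 1 (frag_of f)) = frag_of (cone_edge X (\<sigma> 1)) - frag_of (cone_edge X (\<sigma> 0))"
      unfolding \<sigma>(2) chain_boundary_edge using cone_chain_point[of X]
      by (simp add: cone_chain_def frag_extend_diff)
    then show ?case
      using T \<sigma>(2) by (intro exI[of _ "frag_of T"]) simp
  next
    case (diff a b)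
    then obtain d e where "singular_chain 2 ?Y d" "chain_boundary 2 d = a - cone_chain X (chain_boundary 1 a)"
       "singular_chain 2 ?Y e" "chain_boundary 2 e = b - cone_chain X (chain_boundary 1 b)"
      by (auto simp: singular_chain_def)
    then have "singular_chain 2 ?Y (d - e) \<and> chain_boundary 2 (d - e) = (a - b) - cone_chain X (chain_boundary 1 (a - b))"
      by (simp add: chain_boundary_diff cone_chain_def frag_extend_diff singular_chain_diff)
    then show ?case unfolding singular_chain_def by blast
  qed
  then show thesis
    using that cyc by (auto simp: cone_chain_def)
qed

section \<open>Monoid rings and free modules\<close>

lemma frag_cmul_diff_distrib2: "frag_cmul n (a - b) = frag_cmul n a - frag_cmul n b"
  by (rule poly_mapping_eqI) (simp add: lookup_minus right_diff_distrib)

lemma frag_extend_fun_diff: "frag_extend (\<lambda>x. f x - g x) c = frag_extend f c - frag_extend g c"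
  by (simp add: frag_extend_def frag_cmul_diff_distrib2 sum_subtractf)

lemma frag_extend_fun_add: "frag_extend (\<lambda>x. f x + g x) c = frag_extend f c + frag_extend g c"
  by (simp add: frag_extend_def frag_cmul_distrib2 sum.distrib)

lemma frag_extend_fun_zero [simp]: "frag_extend (\<lambda>x. 0) c = 0"
  by (simp add: frag_extend_def)

lemma frag_extend_of_same [simp]: "frag_extend frag_of c = c"
  by (rule frag_expansion[symmetric])

text \<open>The product of \<open>monoid_ring\<close>, named in order to state its bilinearity on
  the type of formal sums.\<close>

definition conv :: "('g, 'b) monoid_scheme \<Rightarrow> ('g \<Rightarrow>\<^sub>0 int) \<Rightarrow> ('g \<Rightarrow>\<^sub>0 int) \<Rightarrow> ('g \<Rightarrow>\<^sub>0 int)" where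
  "conv M a b = frag_extend (\<lambda>g. frag_extend (\<lambda>h. frag_of (g \<otimes>\<^bsub>M\<^esub> h)) b) a"

lemma monoid_ring_simps [simp]:
  "a \<in> carrier (monoid_ring M) \<longleftrightarrow> Poly_Mapping.keys a \<subseteq> carrier M"
  "a \<otimes>\<^bsub>monoid_ring M\<^esub> b = conv M a b"
  "\<one>\<^bsub>monoid_ring M\<^esub> = frag_of \<one>\<^bsub>M\<^esub>"
  "\<zero>\<^bsub>monoid_ring M\<^esub> = 0"
  "a \<oplus>\<^bsub>monoid_ring M\<^esub> b = a + b"
  by (simp_all add: monoid_ring_def conv_def)

lemma conv_simps [simp]:
  "conv M 0 b = 0" "conv M a 0 = 0"
  "conv M (frag_of g) (frag_of h) = frag_of (g \<otimes>\<^bsub>M\<^esub> h)"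
  by (simp_all add: conv_def)

lemma conv_diff_left: "conv M (a - a') b = conv M a b - conv M a' b"
  and conv_add_left: "conv M (a + a') b = conv M a b + conv M a' b"
  and conv_diff_right: "conv M a (b - b') = conv M a b - conv M a b'"
  and conv_add_right: "conv M a (b + b') = conv M a b + conv M a b'"
  by (simp_all add: conv_def frag_extend_diff frag_extend_add frag_extend_fun_diff frag_extend_fun_add)

lemma conv_sum_right: "conv M a (\<Sum>i\<in>I. f i) = (\<Sum>i\<in>I. conv M a (f i))"
  by (induction I rule: infinite_finite_induct) (simp_all add: conv_add_right)

lemma keys_conv:
  assumes "monoid M" "Poly_Mapping.keys a \<subseteq> carrier M" "Poly_Mapping.keys b \<subseteq> carrier M"
  shows "Poly_Mapping.keys (conv M a b) \<subseteq> carrier M"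
proof
  fix x assume "x \<in> Poly_Mapping.keys (conv M a b)"
  then obtain g where g: "g \<in> Poly_Mapping.keys a"
    "x \<in> Poly_Mapping.keys (frag_extend (\<lambda>h. frag_of (g \<otimes>\<^bsub>M\<^esub> h)) b)"
    unfolding conv_def using keys_frag_extend by (metis (no_types, lifting) UN_iff subsetD)
  then obtain h where "h \<in> Poly_Mapping.keys b" "x \<in> Poly_Mapping.keys (frag_of (g \<otimes>\<^bsub>M\<^esub> h))"
    using keys_frag_extend by (metis (no_types, lifting) UN_iff subsetD)
  then show "x \<in> carrier M"
    using g assms by (auto simp: monoid.m_closed subset_iff)
qed

lemma conv_assoc:
  assumes M: "monoid M" and a: "Poly_Mapping.keys a \<subseteq> carrier M"
    and b: "Poly_Mapping.keys b \<subseteq> carrier M" and c: "Poly_Mapping.keys c \<subseteq> carrier M"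
  shows "conv M (conv M a b) c = conv M a (conv M b c)"
  using a
proof (induction a rule: frag_induction)
  case (one g)
  show ?case using b
  proof (induction b rule: frag_induction)
    case (one h)
    show ?case using c
    proof (induction c rule: frag_induction)
      case (one k)
      then show ?case
        using \<open>g \<in> carrier M\<close> \<open>h \<in> carrier M\<close> by (simp add: monoid.m_assoc[OF M])
    qed (simp_all add: conv_diff_right)
  qed (simp_all add: conv_diff_right conv_diff_left)
qed (simp_all add: conv_diff_left)

lemma conv_one_left:
  assumes M: "monoid M" and a: "Poly_Mapping.keys a \<subseteq> carrier M"
  shows "conv M (frag_of \<one>\<^bsub>M\<^esub>) a = a"
  using a by (induction a rule: frag_induction) (simp_all add: conv_diff_right monoid.l_one[OF M])

lemma conv_one_right:
  assumes M: "monoid M" and a: "Poly_Mapping.keys a \<subseteq> carrier M"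
  shows "conv M a (frag_of \<one>\<^bsub>M\<^esub>) = a"
  using a by (induction a rule: frag_induction) (simp_all add: conv_diff_left monoid.r_one[OF M])

lemma ring_monoid_ring:
  assumes M: "monoid M"
  shows "ring (monoid_ring M)"
proof (rule ringI)
  show "abelian_group (monoid_ring M)"
  proof (rule abelian_groupI)
    show "\<exists>y\<in>carrier (monoid_ring M). y \<oplus>\<^bsub>monoid_ring M\<^esub> x = \<zero>\<^bsub>monoid_ring M\<^esub>"
      if "x \<in> carrier (monoid_ring M)" for x
      using that by (intro bexI[of _ "- x"]) (simp_all add: keys_minus)
  next
    fix x y assume "x \<in> carrier (monoid_ring M)" "y \<in> carrier (monoid_ring M)"
    then show "x \<oplus>\<^bsub>monoid_ring M\<^esub> y \<in> carrier (monoid_ring M)"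
      using Poly_Mapping.keys_add[of x y] by auto
  qed (simp_all add: ac_simps)
  show "monoid (monoid_ring M)"
    by (rule monoidI)
      (simp_all add: keys_conv[OF M] conv_assoc[OF M] conv_one_left[OF M] conv_one_right[OF M] monoid.one_closed[OF M])
qed (simp_all add: conv_add_left conv_add_right)

section \<open>Free left modules\<close>

lemma free_left_module_simps [simp]:
  "f \<in> carrier (free_left_module R I) \<longleftrightarrow>
     (\<forall>i. f i \<in> carrier R) \<and> (\<forall>i. i \<notin> I \<longrightarrow> f i = \<zero>\<^bsub>R\<^esub>) \<and> finite {i. f i \<noteq> \<zero>\<^bsub>R\<^esub>}"
  "f \<oplus>\<^bsub>free_left_module R I\<^esub> g = (\<lambda>i. f i \<oplus>\<^bsub>R\<^esub> g i)"
  "\<zero>\<^bsub>free_left_module R I\<^esub> = (\<lambda>i. \<zero>\<^bsub>R\<^esub>)"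
  "r \<odot>\<^bsub>free_left_module R I\<^esub> f = (\<lambda>i. r \<otimes>\<^bsub>R\<^esub> f i)"
  by (simp_all add: free_left_module_def)

lemma free_left_module_finite:
  "finite I \<Longrightarrow> f \<in> carrier (free_left_module R I) \<longleftrightarrow>
     (\<forall>i. f i \<in> carrier R) \<and> (\<forall>i. i \<notin> I \<longrightarrow> f i = \<zero>\<^bsub>R\<^esub>)"
  by (auto intro: finite_subset[of _ I])

lemma left_module_abelian_group: "left_module R M \<Longrightarrow> abelian_group M"
  and left_module_smult: "left_module R M \<Longrightarrow> r \<in> carrier R \<Longrightarrow> x \<in> carrier M \<Longrightarrow> r \<odot>\<^bsub>M\<^esub> x \<in> carrier M"
  by (simp_all add: left_module_def)

lemma left_module_free:
  assumes "ring R"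
  shows "left_module R (free_left_module R I)"
proof -
  interpret R: ring R by fact
  have "abelian_group (free_left_module R I)"
  proof (rule abelian_groupI)
    fix f g assume f: "f \<in> carrier (free_left_module R I)" and g: "g \<in> carrier (free_left_module R I)"
    have "finite {i. f i \<oplus>\<^bsub>R\<^esub> g i \<noteq> \<zero>\<^bsub>R\<^esub>}"
      by (rule finite_subset[of _ "{i. f i \<noteq> \<zero>\<^bsub>R\<^esub>} \<union> {i. g i \<noteq> \<zero>\<^bsub>R\<^esub>}"]) (use f g in auto)
    then show "f \<oplus>\<^bsub>free_left_module R I\<^esub> g \<in> carrier (free_left_module R I)"
      using f g by simp
  next
    fix f assume f: "f \<in> carrier (free_left_module R I)"
    have "finite {i. \<ominus>\<^bsub>R\<^esub> f i \<noteq> \<zero>\<^bsub>R\<^esub>}"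
      by (rule finite_subset[of _ "{i. f i \<noteq> \<zero>\<^bsub>R\<^esub>}"]) (use f in auto)
    then show "\<exists>g\<in>carrier (free_left_module R I). g \<oplus>\<^bsub>free_left_module R I\<^esub> f = \<zero>\<^bsub>free_left_module R I\<^esub>"
      using f by (intro bexI[of _ "\<lambda>i. \<ominus>\<^bsub>R\<^esub> f i"]) (simp_all add: R.l_neg)
  next
    fix f g assume "f \<in> carrier (free_left_module R I)" "g \<in> carrier (free_left_module R I)"
    then show "f \<oplus>\<^bsub>free_left_module R I\<^esub> g = g \<oplus>\<^bsub>free_left_module R I\<^esub> f"
      by (simp add: R.a_comm)
  qed (simp_all add: R.a_assoc)
  moreover have "r \<odot>\<^bsub>free_left_module R I\<^esub> f \<in> carrier (free_left_module R I)"
    if r: "r \<in> carrier R" and f: "f \<in> carrier (free_left_module R I)" for r f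
  proof -
    have "finite {i. r \<otimes>\<^bsub>R\<^esub> f i \<noteq> \<zero>\<^bsub>R\<^esub>}"
      by (rule finite_subset[of _ "{i. f i \<noteq> \<zero>\<^bsub>R\<^esub>}"]) (use f r in auto)
    then show ?thesis using f r by simp
  qed
  ultimately show ?thesis
    unfolding left_module_def using assms by (simp add: R.l_distr R.r_distr R.m_assoc)
qed

definition unit_vector :: "'r ring \<Rightarrow> 'i \<Rightarrow> 'i \<Rightarrow> 'r" where
  "unit_vector R i = (\<lambda>j. if j = i then \<one>\<^bsub>R\<^esub> else \<zero>\<^bsub>R\<^esub>)"

lemma inj_unit_vector: "\<one>\<^bsub>R\<^esub> \<noteq> \<zero>\<^bsub>R\<^esub> \<Longrightarrow> inj (unit_vector R)"
  unfolding unit_vector_def inj_def fun_eq_iff by metis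

text \<open>The sum runs over a part \<open>J\<close> of the index set, so that the induction on
  \<open>J\<close> keeps the module fixed.\<close>

lemma unit_vector_expansion:
  assumes R: "ring R" and J: "finite J" "J \<subseteq> I" and x: "x \<in> carrier (free_left_module R I)"
  shows "(\<Oplus>\<^bsub>free_left_module R I\<^esub>i\<in>J. x i \<odot>\<^bsub>free_left_module R I\<^esub> unit_vector R i)
    = (\<lambda>j. if j \<in> J then x j else \<zero>\<^bsub>R\<^esub>)"
proof -
  interpret ring R by fact
  interpret F: abelian_group "free_left_module R I"
    by (rule left_module_abelian_group[OF left_module_free[OF R]])
  have c: "x i \<odot>\<^bsub>free_left_module R I\<^esub> unit_vector R i \<in> carrier (free_left_module R I)" if "i \<in> I" for i
  proof -
    have "unit_vector R i \<in> carrier (free_left_module R I)"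
      using that by (auto simp: unit_vector_def intro: finite_subset[of _ "{i}"])
    then show ?thesis
      by (rule left_module_smult[OF left_module_free[OF R], rotated]) (use x in simp)
  qed
  show ?thesis using J
  proof (induction J rule: finite_induct)
    case (insert i J)
    have "(\<Oplus>\<^bsub>free_left_module R I\<^esub>i\<in>insert i J. x i \<odot>\<^bsub>free_left_module R I\<^esub> unit_vector R i) =
       x i \<odot>\<^bsub>free_left_module R I\<^esub> unit_vector R i \<oplus>\<^bsub>free_left_module R I\<^esub>
       (\<Oplus>\<^bsub>free_left_module R I\<^esub>i\<in>J. x i \<odot>\<^bsub>free_left_module R I\<^esub> unit_vector R i)"
      by (rule F.finsum_insert) (use insert c in auto)
    then show ?case
      using insert x by (auto simp: unit_vector_def fun_eq_iff)
  qed simp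
qed

lemma fin_gen_free_module:
  fixes R :: "'r ring" and I :: "'i set"
  assumes R: "ring R" "\<one>\<^bsub>R\<^esub> \<noteq> \<zero>\<^bsub>R\<^esub>" and I: "finite I"
  shows "fin_gen_module R (free_left_module R I)"
  unfolding fin_gen_module_def
proof (intro conjI exI ballI)
  let ?F = "free_left_module R I"
  interpret ring R by fact
  interpret F: abelian_group ?F
    by (rule left_module_abelian_group[OF left_module_free[OF R(1)]])
  show "left_module R ?F" by (rule left_module_free[OF R(1)])
  show "finite (unit_vector R ` I)" using I by simp
  have u: "unit_vector R i \<in> carrier ?F" if "i \<in> I" for i
    using that by (auto simp: unit_vector_def intro: finite_subset[of _ "{i}"])
  then show "unit_vector R ` I \<subseteq> carrier ?F" by blast
  fix x assume x: "x \<in> carrier ?F"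
  \<comment> \<open>Finite generation indexes coefficients by generators rather than by positions.
    The position is recovered from the unit vector, which needs 1 to differ from 0.\<close>
  have inv: "inv_into UNIV (unit_vector R) (unit_vector R i) = i" for i :: 'i
    by (rule inv_f_f[OF inj_unit_vector[OF R(2)]])
  let ?c = "\<lambda>b. x (inv_into UNIV (unit_vector R) b)"
  have "(\<Oplus>\<^bsub>?F\<^esub>b\<in>unit_vector R ` I. ?c b \<odot>\<^bsub>?F\<^esub> b) = (\<Oplus>\<^bsub>?F\<^esub>i\<in>I. ?c (unit_vector R i) \<odot>\<^bsub>?F\<^esub> unit_vector R i)"
  proof (rule F.finsum_reindex)
    show "(\<lambda>b. ?c b \<odot>\<^bsub>?F\<^esub> b) \<in> unit_vector R ` I \<rightarrow> carrier ?F"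
      using x u by (auto simp del: free_left_module_simps(4) simp add: inv intro!: left_module_smult[OF left_module_free[OF R(1)]])
    show "inj_on (unit_vector R) I"
      by (rule inj_on_subset[OF inj_unit_vector[OF R(2)]]) simp
  qed
  also have "\<dots> = (\<Oplus>\<^bsub>?F\<^esub>i\<in>I. x i \<odot>\<^bsub>?F\<^esub> unit_vector R i)"
    by (simp only: inv)
  also have "\<dots> = (\<lambda>j. if j \<in> I then x j else \<zero>\<^bsub>R\<^esub>)"
    by (rule unit_vector_expansion[OF R(1) I order.refl x])
  also have "\<dots> = x" using x by auto
  finally show "\<exists>c\<in>unit_vector R ` I \<rightarrow> carrier R. x = (\<Oplus>\<^bsub>?F\<^esub>b\<in>unit_vector R ` I. c b \<odot>\<^bsub>?F\<^esub> b)"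
    using x by (intro bexI[of _ ?c]) auto
qed

text \<open>The definition of projectivity wants an index set inside the module itself; the unit vectors
  serve as one.\<close>

lemma projective_free_module:
  fixes R :: "'r ring" and I :: "'i set"
  assumes R: "ring R" "\<one>\<^bsub>R\<^esub> \<noteq> \<zero>\<^bsub>R\<^esub>" and I: "finite I"
  shows "projective_module R (free_left_module R I)"
proof -
  interpret R: ring R by fact
  let ?F = "free_left_module R I"
  let ?u = "unit_vector R" and ?U = "unit_vector R ` I"
  let ?G = "free_left_module R ?U"
  define i where "i x = (\<lambda>m. if m \<in> ?U then x (inv_into UNIV ?u m) else \<zero>\<^bsub>R\<^esub>)" for x
  define q where "q y = (\<lambda>j. if j \<in> I then y (?u j) else \<zero>\<^bsub>R\<^esub>)" for y
  have inv: "inv_into UNIV ?u (?u j) = j" for j :: 'i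
    by (rule inv_f_f[OF inj_unit_vector[OF R(2)]])
  have U: "finite ?U" using I by simp
  have "i \<in> linear_hom R ?F ?G"
    unfolding linear_hom_def free_left_module_finite[OF I] Pi_iff free_left_module_finite[OF U]
    by (auto simp: i_def free_left_module_finite[OF I] fun_eq_iff simp del: free_left_module_simps(1))
  moreover have "q \<in> linear_hom R ?G ?F"
    unfolding linear_hom_def Pi_iff
    by (auto simp: q_def free_left_module_finite[OF I] free_left_module_finite[OF U] fun_eq_iff simp del: free_left_module_simps(1))
  moreover have "q (i x) = x" if "x \<in> carrier ?F" for x
    using that by (auto simp: q_def i_def inv fun_eq_iff)
  ultimately show ?thesis
    unfolding projective_module_def using left_module_free[OF R(1), of I] by blast
qed

section \<open>Half-spaces of Cayley graphs\<close>

text \<open>The edges of the Cayley graph that start in the half-space. For an additive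
  \<open>\<phi>\<close> that is nonnegative on \<open>S\<close> they end there as well.\<close>

definition halfspace_edges :: "('g, 'b) monoid_scheme \<Rightarrow> ('g \<Rightarrow> real) \<Rightarrow> 'g set \<Rightarrow> ('g \<times> 'g) set" where
  "halfspace_edges G \<phi> S = {(h, h \<otimes>\<^bsub>G\<^esub> s) | h s. h \<in> carrier G \<and> 0 \<le> \<phi> h \<and> s \<in> S}"

definition joined :: "('g \<times> 'g) set \<Rightarrow> 'g \<Rightarrow> 'g \<Rightarrow> bool" where
  "joined E x y \<longleftrightarrow> (x, y) \<in> (E \<union> E\<inverse>)\<^sup>*"

text \<open>The combinatorial condition of Bieri, Neumann and Strebel. An edge from h to hs
  corresponds to the ring element h(s - 1), so the condition expresses that finitely many
  differences s - 1 generate the augmentation ideal of the monoid ring of the half-space as a left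
  ideal.\<close>

definition halfspace_connected :: "('g, 'b) monoid_scheme \<Rightarrow> ('g \<Rightarrow> real) \<Rightarrow> bool" where
  "halfspace_connected G \<phi> \<longleftrightarrow> (\<exists>S. finite S \<and> S \<subseteq> {s \<in> carrier G. 0 \<le> \<phi> s} \<and>
     (\<forall>g\<in>carrier G. 0 \<le> \<phi> g \<longrightarrow> joined (halfspace_edges G \<phi> S) \<one>\<^bsub>G\<^esub> g))"

lemma joined_refl [simp]: "joined E x x"
  by (simp add: joined_def)

lemma joined_trans [trans]: "joined E x y \<Longrightarrow> joined E y z \<Longrightarrow> joined E x z"
  by (auto simp: joined_def)

lemma joined_sym: "joined E x y \<Longrightarrow> joined E y x"
  unfolding joined_def by (rule symD[OF sym_rtrancl]) (auto simp: sym_def)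

lemma joined_edge: "(x, y) \<in> E \<Longrightarrow> joined E x y"
  by (auto simp: joined_def)

lemma joined_induct [consumes 1, case_names refl step]:
  assumes "joined E x y" "P x"
    and "\<And>a b. joined E x a \<Longrightarrow> P a \<Longrightarrow> (a, b) \<in> E \<or> (b, a) \<in> E \<Longrightarrow> P b"
  shows "P y"
  using assms(1) unfolding joined_def
  by (induction rule: rtrancl_induct) (use assms(2,3) in \<open>auto simp: joined_def\<close>)

text \<open>A nonzero character is unbounded on the powers of an element of positive value. Right
  multiplication by a large power moves a given finite set into the half-space.\<close>

lemma (in group) character_translation:
  assumes \<phi>: "\<And>a b. a \<in> carrier G \<Longrightarrow> b \<in> carrier G \<Longrightarrow> \<phi> (a \<otimes> b) = \<phi> a + (\<phi> b :: real)"
    and nz: "u \<in> carrier G" "\<phi> u \<noteq> 0" and D: "finite D"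
  obtains t where "t \<in> carrier G" "\<And>a. a \<in> D \<Longrightarrow> 0 \<le> \<phi> a + \<phi> t"
proof -
  have one: "\<phi> \<one> = 0" using \<phi>[of \<one> \<one>] by simp
  obtain v where v: "v \<in> carrier G" "\<phi> v > 0"
  proof (cases "\<phi> u > 0")
    case False
    have "\<phi> (inv u) = - \<phi> u" using \<phi>[of u "inv u"] one nz(1) by simp
    then show ?thesis using that[of "inv u"] nz False by simp
  qed (use that nz in blast)
  obtain b where b: "\<And>a. a \<in> D \<Longrightarrow> - \<phi> a \<le> b"
  proof (rule that)
    show "- \<phi> a \<le> Max ((\<lambda>a. - \<phi> a) ` D)" if "a \<in> D" for a
      using D that by (intro Max_ge) auto
  qed
  obtain n :: nat where n: "b < real n * \<phi> v"
    using reals_Archimedean3[OF v(2)] by blast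
  have "\<phi> (v [^] k) = real k * \<phi> v" for k :: nat
    by (induction k) (simp_all add: one \<phi> v algebra_simps)
  then have "0 \<le> \<phi> a + \<phi> (v [^] n)" if "a \<in> D" for a
    using b[OF that] n by simp
  then show thesis using that[of "v [^] n"] v by simp
qed

text \<open>The elements of \<open>D\<close> may lie outside the half-space. Multiplying on the
  right by a suitable \<open>t\<close> moves them into it, and a step from ha to hb becomes two
  edges starting at h, one to hat and one to hbt. The detour through h is legitimate because h
  itself lies in the half-space.\<close>

lemma (in group) halfspace_connected_if_joined:
  assumes \<phi>: "\<And>a b. a \<in> carrier G \<Longrightarrow> b \<in> carrier G \<Longrightarrow> \<phi> (a \<otimes> b) = \<phi> a + (\<phi> b :: real)"
    and nz: "u \<in> carrier G" "\<phi> u \<noteq> 0" and D: "finite D" "D \<subseteq> carrier G" and k: "k \<in> D"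
    and j: "\<And>g. g \<in> carrier G \<Longrightarrow> 0 \<le> \<phi> g \<Longrightarrow>
      joined {(h \<otimes> a, h \<otimes> b) | h a b. h \<in> carrier G \<and> 0 \<le> \<phi> h \<and> a \<in> D \<and> b \<in> D} k (g \<otimes> k)"
  shows "halfspace_connected G \<phi>"
proof -
  obtain t where t: "t \<in> carrier G" "\<And>a. a \<in> D \<Longrightarrow> 0 \<le> \<phi> a + \<phi> t"
    using character_translation[OF \<phi> nz D(1)] by blast
  define S where "S = (\<lambda>a. a \<otimes> t) ` D"
  have S: "finite S" "S \<subseteq> {s \<in> carrier G. 0 \<le> \<phi> s}"
    using D t by (auto simp: S_def \<phi> subset_iff)
  let ?E = "halfspace_edges G \<phi> S"
  have e: "joined ?E h (h \<otimes> a \<otimes> t)" if "h \<in> carrier G" "0 \<le> \<phi> h" "a \<in> D" for h a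
    by (rule joined_edge) (use that D t in \<open>force simp: halfspace_edges_def S_def m_assoc\<close>)
  have step: "joined ?E (x \<otimes> t) (y \<otimes> t)"
    if "joined {(h \<otimes> a, h \<otimes> b) | h a b. h \<in> carrier G \<and> 0 \<le> \<phi> h \<and> a \<in> D \<and> b \<in> D} x y" for x y
    using that
  proof (induction rule: joined_induct)
    case (step a b)
    then obtain h c d where "h \<in> carrier G" "0 \<le> \<phi> h" "c \<in> D" "d \<in> D" "a = h \<otimes> c" "b = h \<otimes> d"
      by blast
    then have "joined ?E (a \<otimes> t) (b \<otimes> t)"
      using joined_trans[OF joined_sym[OF e] e] by simp
    then show ?case using step joined_trans by metis
  qed simp
  have one: "\<phi> \<one> = 0" using \<phi>[of \<one> \<one>] by simp
  have "joined ?E \<one> g" if g: "g \<in> carrier G" "0 \<le> \<phi> g" for g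
  proof -
    have kG: "k \<in> carrier G" using k D by blast
    have "joined ?E \<one> (\<one> \<otimes> k \<otimes> t)" by (rule e) (use k one in auto)
    also have "\<one> \<otimes> k \<otimes> t = k \<otimes> t" using kG by simp
    also have "joined ?E (k \<otimes> t) (g \<otimes> k \<otimes> t)" by (rule step[OF j[OF g]])
    also have "joined ?E (g \<otimes> k \<otimes> t) g" by (rule joined_sym[OF e[OF g k]])
    finally show ?thesis .
  qed
  then show ?thesis unfolding halfspace_connected_def using S by blast
qed

text \<open>The central element provides a direction along which generators can be translated into the
  half-space, and vertices can be connected far away from its boundary.\<close>

lemma (in group) halfspace_connected_central:
  assumes \<phi>: "\<And>a b. a \<in> carrier G \<Longrightarrow> b \<in> carrier G \<Longrightarrow> \<phi> (a \<otimes> b) = \<phi> a + (\<phi> b :: real)"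
    and c: "c \<in> carrier G" "\<And>g. g \<in> carrier G \<Longrightarrow> g \<otimes> c = c \<otimes> g" "\<phi> c \<noteq> 0"
    and Y: "finite Y" "Y \<subseteq> carrier G" "generate G Y = carrier G"
  shows "halfspace_connected G \<phi>"
proof -
  have one: "\<phi> \<one> = 0" using \<phi>[of \<one> \<one>] by simp
  have \<phi>inv: "\<phi> (inv g) = - \<phi> g" if "g \<in> carrier G" for g
    using \<phi>[of g "inv g"] one that by simp
  \<comment> \<open>\<open>z\<close> is the central element or its inverse, whichever has positive
    value.\<close>
  obtain z where z: "z \<in> carrier G" "\<And>g. g \<in> carrier G \<Longrightarrow> g \<otimes> z = z \<otimes> g" "\<phi> z > 0"
  proof (cases "\<phi> c > 0")
    case False
    have "g \<otimes> inv c = inv c \<otimes> g" if "g \<in> carrier G" for g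
    proof -
      have "inv c \<otimes> (g \<otimes> c) \<otimes> inv c = inv c \<otimes> (c \<otimes> g) \<otimes> inv c" using c that by simp
      then show ?thesis using c(1) that by (simp add: m_assoc inv_solve_left)
    qed
    then show ?thesis using that[of "inv c"] c False \<phi>inv by simp
  qed (use that c in blast)
  have zpow: "\<phi> (z [^] k) = real k * \<phi> z" for k :: nat
    by (induction k) (simp_all add: one \<phi> z algebra_simps)
  have zcomm: "g \<otimes> z [^] k = z [^] k \<otimes> g" if "g \<in> carrier G" for g and k :: nat
    using that z by (induction k) (simp_all, metis m_assoc nat_pow_closed)
  define Y' where "Y' = Y \<union> m_inv G ` Y"
  have Y': "finite Y'" "Y' \<subseteq> carrier G" using Y by (auto simp: Y'_def)
  obtain b where b: "\<And>a. a \<in> Y' \<Longrightarrow> - \<phi> a \<le> b" "0 \<le> b"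
  proof (rule that)
    show "- \<phi> a \<le> Max (insert 0 ((\<lambda>a. - \<phi> a) ` Y'))" if "a \<in> Y'" for a
      using Y' that by (intro Max_ge) auto
    show "0 \<le> Max (insert 0 ((\<lambda>a. - \<phi> a) ` Y'))" using Y' by (intro Max_ge) auto
  qed
  \<comment> \<open>\<open>N\<close> steps along \<open>z\<close> outweigh the most negative value
    on a generator or its inverse, so every \<open>y \<otimes> z [^] N\<close> lies in the
    half-space.\<close>
  obtain N :: nat where N: "b < real N * \<phi> z"
    using reals_Archimedean3[OF z(3)] by blast
  define S where "S = insert z ((\<lambda>y. y \<otimes> z [^] N) ` Y')"
  have S: "finite S" "S \<subseteq> {s \<in> carrier G. 0 \<le> \<phi> s}"
  proof -
    show "finite S" using Y' by (simp add: S_def)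
    have "0 \<le> \<phi> (y \<otimes> z [^] N)" if "y \<in> Y'" for y
      using b(1)[OF that] N that Y' z by (simp add: \<phi> zpow subset_iff)
    then show "S \<subseteq> {s \<in> carrier G. 0 \<le> \<phi> s}" using Y' z by (auto simp: S_def subset_iff)
  qed
  let ?E = "halfspace_edges G \<phi> S"
  have up: "joined ?E h (h \<otimes> z [^] k)" if h: "h \<in> carrier G" "0 \<le> \<phi> h" for h and k :: nat
  proof (induction k)
    case (Suc k)
    have "joined ?E (h \<otimes> z [^] k) ((h \<otimes> z [^] k) \<otimes> z)"
    proof (rule joined_edge)
      have "h \<otimes> z [^] k \<in> carrier G" "0 \<le> \<phi> (h \<otimes> z [^] k)" "z \<in> S"
        using h z by (auto simp: S_def \<phi> zpow)
      then show "(h \<otimes> z [^] k, h \<otimes> z [^] k \<otimes> z) \<in> ?E"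
        unfolding halfspace_edges_def by blast
    qed
    then show ?case using Suc h z joined_trans by (fastforce simp: m_assoc)
  qed (use h in simp)
  \<comment> \<open>Every generated element is reached after being pushed far enough along
    \<open>z\<close>; how far may depend on the element.\<close>
  have gen: "\<exists>M. joined ?E \<one> (g \<otimes> z [^] (M::nat))" if "g \<in> generate G Y" for g
  proof -
    have step: "\<exists>M. joined ?E \<one> (g \<otimes> y \<otimes> z [^] (M::nat))"
      if g: "g \<in> carrier G" "\<exists>M. joined ?E \<one> (g \<otimes> z [^] (M::nat))" and y: "y \<in> Y'" for g y
    proof -
      have yG: "y \<in> carrier G" using y Y' by blast
      obtain M :: nat where M: "joined ?E \<one> (g \<otimes> z [^] M)" using g(2) by blast
      obtain K :: nat where K: "- \<phi> g < real K * \<phi> z"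
        using reals_Archimedean3[OF z(3)] by blast
      let ?L = "M + K"
      have L: "0 \<le> \<phi> (g \<otimes> z [^] ?L)"
      proof -
        have "real K * \<phi> z \<le> real ?L * \<phi> z" using z(3) by (intro mult_right_mono) auto
        moreover have "\<phi> (g \<otimes> z [^] ?L) = \<phi> g + real ?L * \<phi> z"
          using g z by (simp only: \<phi> zpow nat_pow_closed)
        ultimately show ?thesis using K by linarith
      qed
      \<comment> \<open>Nothing is known about the value of \<open>g\<close>. Its translate lies in
        the half-space because it is the end of a path there, unless the path is empty and the end
        is the neutral element.\<close>
      have "0 \<le> \<phi> (g \<otimes> z [^] M) \<or> g \<otimes> z [^] M = \<one>"
        using M unfolding joined_def
        by (cases rule: rtranclE) (use S in \<open>auto simp: halfspace_edges_def \<phi> subset_iff\<close>)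
      then have M0: "0 \<le> \<phi> (g \<otimes> z [^] M)" using one by auto
      have "joined ?E (g \<otimes> z [^] M) ((g \<otimes> z [^] M) \<otimes> z [^] K)"
        by (rule up) (use g z M0 in auto)
      also have "(g \<otimes> z [^] M) \<otimes> z [^] K = g \<otimes> z [^] ?L"
        using g z by (simp add: m_assoc nat_pow_mult)
      also have "joined ?E (g \<otimes> z [^] ?L) ((g \<otimes> z [^] ?L) \<otimes> (y \<otimes> z [^] N))"
      proof (rule joined_edge)
        have "g \<otimes> z [^] ?L \<in> carrier G" "y \<otimes> z [^] N \<in> S"
          using g z y by (auto simp: S_def)
        then show "(g \<otimes> z [^] ?L, g \<otimes> z [^] ?L \<otimes> (y \<otimes> z [^] N)) \<in> ?E"
          using L unfolding halfspace_edges_def by blast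
      qed
      also have "(g \<otimes> z [^] ?L) \<otimes> (y \<otimes> z [^] N) = g \<otimes> y \<otimes> z [^] (?L + N)"
      proof -
        have "(g \<otimes> z [^] ?L) \<otimes> (y \<otimes> z [^] N) = g \<otimes> (z [^] ?L \<otimes> y) \<otimes> z [^] N"
          using g z yG by (simp add: m_assoc)
        also have "\<dots> = g \<otimes> (y \<otimes> z [^] ?L) \<otimes> z [^] N" using zcomm[OF yG] by simp
        also have "\<dots> = g \<otimes> y \<otimes> z [^] (?L + N)" using g z yG by (simp add: m_assoc nat_pow_mult)
        finally show ?thesis .
      qed
      finally show ?thesis using joined_trans[OF M] by blast
    qed
    \<comment> \<open>The induction needs an arbitrary prefix \<open>g\<close>, since the product
      rule of \<open>generate\<close> splits a word in two and each part is appended on the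
      right.\<close>
    have "\<exists>M. joined ?E \<one> (g \<otimes> h \<otimes> z [^] (M::nat))"
      if "h \<in> generate G Y" "g \<in> carrier G" "\<exists>M. joined ?E \<one> (g \<otimes> z [^] (M::nat))" for g h
      using that
    proof (induction arbitrary: g)
      case (incl h) then show ?case using step by (auto simp: Y'_def)
    next
      case (inv h) then show ?case using step by (auto simp: Y'_def)
    next
      case (eng h1 h2)
      have "h1 \<in> carrier G" "h2 \<in> carrier G" using eng generate_in_carrier[OF Y(2)] by blast+
      then show ?case using eng.IH(2)[of "g \<otimes> h1"] eng.IH(1)[of g] eng.prems by (simp add: m_assoc)
    qed simp
    moreover have "\<exists>M. joined ?E \<one> (\<one> \<otimes> z [^] (M::nat))"
      by (rule exI[of _ 0]) simp
    ultimately have "\<exists>M. joined ?E \<one> (\<one> \<otimes> g \<otimes> z [^] (M::nat))"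
      using that one_closed by blast
    then show ?thesis
      using generate_in_carrier[OF Y(2) that] by simp
  qed
  have "joined ?E \<one> g" if g: "g \<in> carrier G" "0 \<le> \<phi> g" for g
  proof -
    obtain M :: nat where "joined ?E \<one> (g \<otimes> z [^] M)" using gen g Y(3) by blast
    then show ?thesis by (rule joined_trans[OF _ joined_sym[OF up[OF g]]])
  qed
  then show ?thesis unfolding halfspace_connected_def using S by blast
qed

text \<open>The fibres of \<open>\<rho>\<close> are orbits under powers of \<open>c\<close>, on
  which \<open>\<phi>\<close> vanishes. Paths are pushed down by applying \<open>\<rho>\<close>. For
  the converse, \<open>c\<close> and its inverse are added to lifts of the generators: both have
  value 0, so every fibre over the half-space is connected, and a path lifts up to movements within
  fibres.\<close>

lemma halfspace_connected_quotient:
  assumes G: "group G" and H: "group H" and \<rho>: "\<rho> \<in> hom G H" "\<rho> ` carrier G = carrier H"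
    and \<phi>: "\<And>g. g \<in> carrier G \<Longrightarrow> \<phi> g = \<psi> (\<rho> g)"
    and c: "c \<in> carrier G" "\<And>a b. a \<in> carrier G \<Longrightarrow> b \<in> carrier G \<Longrightarrow> \<rho> a = \<rho> b \<Longrightarrow> \<exists>k::int. b = a \<otimes>\<^bsub>G\<^esub> c [^]\<^bsub>G\<^esub> k"
      "\<rho> c = \<one>\<^bsub>H\<^esub>"
    and \<psi>: "\<And>a b. a \<in> carrier H \<Longrightarrow> b \<in> carrier H \<Longrightarrow> \<psi> (a \<otimes>\<^bsub>H\<^esub> b) = \<psi> a + (\<psi> b :: real)"
  shows "halfspace_connected G \<phi> \<longleftrightarrow> halfspace_connected H \<psi>"
proof
  interpret G: group G by fact
  interpret H: group H by fact
  have \<rho>m: "\<rho> (a \<otimes>\<^bsub>G\<^esub> b) = \<rho> a \<otimes>\<^bsub>H\<^esub> \<rho> b" if "a \<in> carrier G" "b \<in> carrier G" for a b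
    using \<rho>(1) that by (rule hom_mult)
  have \<rho>c: "\<rho> a \<in> carrier H" if "a \<in> carrier G" for a
    using \<rho>(2) that by blast
  have \<rho>1: "\<rho> \<one>\<^bsub>G\<^esub> = \<one>\<^bsub>H\<^esub>" by (rule hom_one[OF \<rho>(1) G H])
  have \<psi>1: "\<psi> \<one>\<^bsub>H\<^esub> = 0" using \<psi>[of "\<one>\<^bsub>H\<^esub>" "\<one>\<^bsub>H\<^esub>"] by simp
  {
    assume "halfspace_connected G \<phi>"
    then obtain S where S: "finite S" "S \<subseteq> {s \<in> carrier G. 0 \<le> \<phi> s}"
      "\<And>g. g \<in> carrier G \<Longrightarrow> 0 \<le> \<phi> g \<Longrightarrow> joined (halfspace_edges G \<phi> S) \<one>\<^bsub>G\<^esub> g"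
      unfolding halfspace_connected_def by blast
    have push: "joined (halfspace_edges H \<psi> (\<rho> ` S)) (\<rho> \<one>\<^bsub>G\<^esub>) (\<rho> g)" if "joined (halfspace_edges G \<phi> S) \<one>\<^bsub>G\<^esub> g" for g
      using that
    proof (induction rule: joined_induct)
      case (step a b)
      have e: "(\<rho> x, \<rho> y) \<in> halfspace_edges H \<psi> (\<rho> ` S)" if xy: "(x, y) \<in> halfspace_edges G \<phi> S" for x y
      proof -
        obtain s where "x \<in> carrier G" "0 \<le> \<phi> x" "s \<in> S" "y = x \<otimes>\<^bsub>G\<^esub> s"
          using xy unfolding halfspace_edges_def by blast
        then have "\<rho> x \<in> carrier H" "0 \<le> \<psi> (\<rho> x)" "\<rho> s \<in> \<rho> ` S" "\<rho> y = \<rho> x \<otimes>\<^bsub>H\<^esub> \<rho> s"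
          using S(2) \<rho>c \<rho>m \<phi> by auto
        then show ?thesis unfolding halfspace_edges_def by blast
      qed
      then have "joined (halfspace_edges H \<psi> (\<rho> ` S)) (\<rho> a) (\<rho> b)"
        using step.hyps(2) joined_edge joined_sym by metis
      then show ?case using step.IH joined_trans by metis
    qed simp
    show "halfspace_connected H \<psi>"
      unfolding halfspace_connected_def
    proof (intro exI[of _ "\<rho> ` S"] conjI ballI impI)
      show "finite (\<rho> ` S)" using S by simp
      show "\<rho> ` S \<subseteq> {s \<in> carrier H. 0 \<le> \<psi> s}" using S(2) \<rho>c \<phi> by auto
      fix h assume h: "h \<in> carrier H" "0 \<le> \<psi> h"
      then obtain g where g: "g \<in> carrier G" "h = \<rho> g" using \<rho>(2) by blast
      then show "joined (halfspace_edges H \<psi> (\<rho> ` S)) \<one>\<^bsub>H\<^esub> h"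
        using push[OF S(3)[OF g(1)]] h \<phi> \<rho>1 by simp
    qed
  }
  assume "halfspace_connected H \<psi>"
  then obtain S where S: "finite S" "S \<subseteq> {s \<in> carrier H. 0 \<le> \<psi> s}"
    "\<And>g. g \<in> carrier H \<Longrightarrow> 0 \<le> \<psi> g \<Longrightarrow> joined (halfspace_edges H \<psi> S) \<one>\<^bsub>H\<^esub> g"
    unfolding halfspace_connected_def by blast
  define l where "l s = (SOME g. g \<in> carrier G \<and> \<rho> g = s)" for s
  have l: "l s \<in> carrier G" "\<rho> (l s) = s" if "s \<in> carrier H" for s
  proof -
    have "s \<in> \<rho> ` carrier G" using that \<rho>(2) by simp
    then have "\<exists>g. g \<in> carrier G \<and> \<rho> g = s" by blast
    then have "l s \<in> carrier G \<and> \<rho> (l s) = s" unfolding l_def by (rule someI_ex)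
    then show "l s \<in> carrier G" "\<rho> (l s) = s" by auto
  qed
  define T where "T = {c, inv\<^bsub>G\<^esub> c} \<union> l ` S"
  have \<rho>ci: "\<rho> (inv\<^bsub>G\<^esub> c) = \<one>\<^bsub>H\<^esub>"
  proof -
    have "\<rho> (inv\<^bsub>G\<^esub> c) = \<rho> (c \<otimes>\<^bsub>G\<^esub> inv\<^bsub>G\<^esub> c)"
      using c \<rho>m[of c "inv\<^bsub>G\<^esub> c"] \<rho>c by simp
    then show ?thesis using c(1) \<rho>1 by simp
  qed
  have T: "finite T" "T \<subseteq> {s \<in> carrier G. 0 \<le> \<phi> s}"
  proof -
    show "finite T" using S by (simp add: T_def)
    have "l s \<in> carrier G \<and> 0 \<le> \<phi> (l s)" if "s \<in> S" for s
      using l[of s] S(2) that \<phi> by auto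
    then show "T \<subseteq> {s \<in> carrier G. 0 \<le> \<phi> s}"
      using c \<phi>[of c] \<phi>[of "inv\<^bsub>G\<^esub> c"] \<rho>ci \<psi>1 by (auto simp: T_def)
  qed
  let ?E = "halfspace_edges G \<phi> T"
  have cpow: "c [^]\<^bsub>G\<^esub> k \<in> carrier G" "\<rho> (c [^]\<^bsub>G\<^esub> k) = \<one>\<^bsub>H\<^esub>" for k :: int
  proof -
    show 1: "c [^]\<^bsub>G\<^esub> k \<in> carrier G" using c by simp
    interpret \<rho>: group_hom G H \<rho> by unfold_locales (rule \<rho>(1))
    show "\<rho> (c [^]\<^bsub>G\<^esub> k) = \<one>\<^bsub>H\<^esub>" using \<rho>.hom_int_pow[OF c(1), of k] c(3) by simp
  qed
  have along1: "joined ?E a (a \<otimes>\<^bsub>G\<^esub> c [^]\<^bsub>G\<^esub> k)" if a: "a \<in> carrier G" "0 \<le> \<phi> a" for a and k :: int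
  proof -
    have "0 \<le> \<phi> (a \<otimes>\<^bsub>G\<^esub> c [^]\<^bsub>G\<^esub> m)" for m :: int
      using a cpow \<phi>[of "a \<otimes>\<^bsub>G\<^esub> c [^]\<^bsub>G\<^esub> m"] \<phi>[of a] by (simp add: \<rho>m \<rho>c)
    then have e: "joined ?E (a \<otimes>\<^bsub>G\<^esub> c [^]\<^bsub>G\<^esub> m) ((a \<otimes>\<^bsub>G\<^esub> c [^]\<^bsub>G\<^esub> m) \<otimes>\<^bsub>G\<^esub> t)" if "t \<in> T" for m :: int and t
      using a cpow(1) that by (intro joined_edge) (auto simp: halfspace_edges_def)
    show ?thesis
    proof (induction k rule: int_induct[where k = 0])
      case (step1 k)
      have "(a \<otimes>\<^bsub>G\<^esub> c [^]\<^bsub>G\<^esub> k) \<otimes>\<^bsub>G\<^esub> c = a \<otimes>\<^bsub>G\<^esub> c [^]\<^bsub>G\<^esub> (k + 1)"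
        using a c by (simp add: G.m_assoc G.int_pow_mult)
      then show ?case using joined_trans[OF step1(2) e[of c k]] by (simp add: T_def)
    next
      case (step2 k)
      have "(a \<otimes>\<^bsub>G\<^esub> c [^]\<^bsub>G\<^esub> k) \<otimes>\<^bsub>G\<^esub> inv\<^bsub>G\<^esub> c = a \<otimes>\<^bsub>G\<^esub> c [^]\<^bsub>G\<^esub> (k - 1)"
        using a c by (simp add: G.m_assoc G.int_pow_diff)
      then show ?case using joined_trans[OF step2(2) e[of "inv\<^bsub>G\<^esub> c" k]] by (simp add: T_def)
    qed (use a in simp)
  qed
  have fibre: "joined ?E a b" if "a \<in> carrier G" "b \<in> carrier G" "\<rho> a = \<rho> b" "0 \<le> \<phi> a" for a b
    using c(2)[OF that(1-3)] along1[OF that(1,4)] by auto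
  have lift: "\<exists>g\<in>carrier G. \<rho> g = h \<and> 0 \<le> \<phi> g \<and> joined ?E \<one>\<^bsub>G\<^esub> g" if "joined (halfspace_edges H \<psi> S) \<one>\<^bsub>H\<^esub> h" for h
    using that
  proof (induction rule: joined_induct)
    case refl
    then show ?case using \<rho>1 \<phi>[of "\<one>\<^bsub>G\<^esub>"] \<psi>1 by (intro bexI[of _ "\<one>\<^bsub>G\<^esub>"]) auto
  next
    case (step x y)
    then obtain g where g: "g \<in> carrier G" "\<rho> g = x" "0 \<le> \<phi> g" "joined ?E \<one>\<^bsub>G\<^esub> g" by blast
    from step.hyps(2) show ?case
    proof
      assume "(x, y) \<in> halfspace_edges H \<psi> S"
      then obtain s where s: "x \<in> carrier H" "0 \<le> \<psi> x" "s \<in> S" "y = x \<otimes>\<^bsub>H\<^esub> s"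
        by (auto simp: halfspace_edges_def)
      have ls: "l s \<in> carrier G" "\<rho> (l s) = s" "0 \<le> \<phi> (l s)" "l s \<in> T"
        using l[of s] S(2) s(3) \<phi>[of "l s"] by (auto simp: T_def)
      have "(g, g \<otimes>\<^bsub>G\<^esub> l s) \<in> ?E" using g ls by (auto simp: halfspace_edges_def)
      then have "joined ?E \<one>\<^bsub>G\<^esub> (g \<otimes>\<^bsub>G\<^esub> l s)" using joined_edge joined_trans g(4) by metis
      moreover have "0 \<le> \<phi> (g \<otimes>\<^bsub>G\<^esub> l s)"
        using g ls s(1,3) S(2) \<rho>m[of g "l s"] \<phi>[of "g \<otimes>\<^bsub>G\<^esub> l s"] \<phi>[of g] \<phi>[of "l s"] \<psi>[of "\<rho> g" "\<rho> (l s)"] by auto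
      ultimately show ?thesis
        using g ls s \<rho>m[of g "l s"] by (intro bexI[of _ "g \<otimes>\<^bsub>G\<^esub> l s"]) auto
    next
      assume "(y, x) \<in> halfspace_edges H \<psi> S"
      then obtain s where s: "y \<in> carrier H" "0 \<le> \<psi> y" "s \<in> S" "x = y \<otimes>\<^bsub>H\<^esub> s"
        by (auto simp: halfspace_edges_def)
      have ls: "l s \<in> carrier G" "\<rho> (l s) = s" "0 \<le> \<phi> (l s)" "l s \<in> T"
        using l[of s] S(2) s(3) \<phi>[of "l s"] by (auto simp: T_def)
      \<comment> \<open>For an edge traversed backwards, a lift of its initial point
        \<open>y\<close> is taken; the lifted edge ends in the fibre over \<open>x\<close>, where it
        is joined to \<open>g\<close>.\<close>
      have ly: "l y \<in> carrier G" "\<rho> (l y) = y" "0 \<le> \<phi> (l y)" using l[OF s(1)] \<phi> s(2) by auto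
      have "(l y, l y \<otimes>\<^bsub>G\<^esub> l s) \<in> ?E" using ly ls by (auto simp: halfspace_edges_def)
      moreover have "joined ?E g (l y \<otimes>\<^bsub>G\<^esub> l s)"
        by (rule fibre) (use g ly ls s \<rho>m in auto)
      ultimately have "joined ?E \<one>\<^bsub>G\<^esub> (l y)" using joined_edge joined_sym joined_trans g(4) by metis
      then show ?thesis using ly by blast
    qed
  qed
  show "halfspace_connected G \<phi>"
    unfolding halfspace_connected_def
  proof (intro exI[of _ T] conjI ballI impI T)
    fix g assume g: "g \<in> carrier G" "0 \<le> \<phi> g"
    then have "joined (halfspace_edges H \<psi> S) \<one>\<^bsub>H\<^esub> (\<rho> g)" using S(3) \<rho>c \<phi> by auto
    then obtain g' where "g' \<in> carrier G" "\<rho> g' = \<rho> g" "0 \<le> \<phi> g'" "joined ?E \<one>\<^bsub>G\<^esub> g'"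
      using lift by blast
    then show "joined ?E \<one>\<^bsub>G\<^esub> g" using fibre[of g' g] g joined_trans by metis
  qed
qed

section \<open>Finite 1-type of the universal cover\<close>

lemma weight_mult: "weight (\<lambda>k. w k * n) c = weight w c * n"
proof -
  have "Poly_Mapping.keys c \<subseteq> UNIV" by simp
  then show ?thesis
    by (induction c rule: frag_induction) (simp_all add: weight_diff left_diff_distrib)
qed

lemma weight_constant_on_keys:
  assumes "\<And>k. k \<in> Poly_Mapping.keys c \<Longrightarrow> w k = n"
  shows "weight w c = weight (\<lambda>_. 1) c * n"
  using weight_cong[of c w "\<lambda>k. 1 * n"] assms weight_mult[of "\<lambda>_. 1" n c] by simp

lemma weight_zero_on_keys:
  assumes "\<And>k. k \<in> Poly_Mapping.keys c \<Longrightarrow> w k = 0"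
  shows "weight w c = 0"
  using weight_constant_on_keys[of c w 0] assms by simp

lemma weight_chain_map: "weight w (chain_map p f c) = weight (\<lambda>\<sigma>. w (simplex_map p f \<sigma>)) c"
  unfolding chain_map_def weight_extend by simp

lemma simplex_map_point: "simplex_map 0 f (point_simplex a) = point_simplex (f a)"
  unfolding simplex_map_def point_simplex_def by (rule restrict_ext) simp

lemma keys_sum_subset: "(\<And>i. i \<in> I \<Longrightarrow> Poly_Mapping.keys (f i) \<subseteq> A) \<Longrightarrow> Poly_Mapping.keys (\<Sum>i\<in>I. f i) \<subseteq> A"
  using keys_sum[of f I] by blast

lemma keys_add_subset: "Poly_Mapping.keys f \<subseteq> A \<Longrightarrow> Poly_Mapping.keys g \<subseteq> A \<Longrightarrow> Poly_Mapping.keys (f + g) \<subseteq> A"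
  using Poly_Mapping.keys_add[of f g] by blast

lemma keys_diff_subset: "Poly_Mapping.keys f \<subseteq> A \<Longrightarrow> Poly_Mapping.keys g \<subseteq> A \<Longrightarrow> Poly_Mapping.keys (f - g) \<subseteq> A"
  using keys_diff[of f g] by blast

lemma (in abelian_monoid) finsum_induct:
  assumes "finite B" "\<And>b. b \<in> B \<Longrightarrow> f b \<in> carrier G \<and> P (f b)" "P \<zero>"
    and add: "\<And>x y. x \<in> carrier G \<Longrightarrow> y \<in> carrier G \<Longrightarrow> P x \<Longrightarrow> P y \<Longrightarrow> P (x \<oplus> y)"
  shows "P (\<Oplus>b\<in>B. f b)"
  using assms(1,2)
proof (induction B rule: finite_induct)
  case empty
  then show ?case using assms(3) by simp
next
  case (insert b B)
  have "(\<Oplus>b\<in>insert b B. f b) = f b \<oplus> (\<Oplus>b\<in>B. f b)"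
    by (rule finsum_insert) (use insert in auto)
  moreover have "(\<Oplus>b\<in>B. f b) \<in> carrier G"
    by (rule finsum_closed) (use insert in auto)
  ultimately show ?case using insert add by simp
qed

locale pointed_character =
  fixes X :: "'a topology" and x0 :: 'a and \<phi> :: "(real \<Rightarrow> 'a) set \<Rightarrow> real"
  assumes x0: "x0 \<in> topspace X" and \<phi>_hom: "\<phi> \<in> hom (pi1 X x0) real_add_group"
begin

abbreviation "Y \<equiv> universal_cover X x0"
abbreviation "G \<equiv> pi1 X x0"
abbreviation "M \<equiv> nonneg_submonoid X x0 \<phi>"
abbreviation "R \<equiv> monoid_ring (nonneg_submonoid X x0 \<phi>)"
abbreviation "C \<equiv> ucover_chains X x0"
abbreviation "base_class \<equiv> path_class X (\<lambda>_. x0)"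
abbreviation "base_chain \<equiv> frag_of (point_simplex base_class)"
abbreviation "aug \<equiv> weight (\<lambda>_. 1)"

definition act :: "nat \<Rightarrow> ((real \<Rightarrow> 'a) set \<Rightarrow>\<^sub>0 int) \<Rightarrow> (real \<Rightarrow> 'a) set chain \<Rightarrow> (real \<Rightarrow> 'a) set chain" where
  "act p r c = frag_extend (\<lambda>g. chain_map p (class_concat X g) c) r"

lemma \<phi>_mult: "a \<in> path_classes X x0 x0 \<Longrightarrow> b \<in> path_classes X x0 x0 \<Longrightarrow>
    \<phi> (class_concat X a b) = \<phi> a + \<phi> b"
  using hom_mult[OF \<phi>_hom, of a b] by (simp add: real_add_group_def)

lemma base_class: "base_class \<in> path_classes X x0 x0"
  by (rule path_classes_const[OF x0])

lemma \<phi>_one: "\<phi> base_class = 0"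
  using \<phi>_mult[OF base_class base_class] class_concat_const_left[OF base_class] by simp

lemma M_simps [simp]:
  "g \<in> carrier M \<longleftrightarrow> g \<in> path_classes X x0 x0 \<and> 0 \<le> \<phi> g"
  "g \<otimes>\<^bsub>M\<^esub> h = class_concat X g h"
  "\<one>\<^bsub>M\<^esub> = base_class"
  by (simp_all add: nonneg_submonoid_def)

lemma monoid_M: "monoid M"
  by (rule monoidI)
    (simp_all add: path_classes_concat[of _ X x0 x0] base_class \<phi>_one \<phi>_mult class_concat_assoc[of _ X x0 x0 _ x0 _ x0]
      class_concat_const_left[of _ X x0 x0] class_concat_const_right[of _ X x0 x0])

lemma ring_R: "ring R"
  by (rule ring_monoid_ring[OF monoid_M])

section \<open>Chains of the cover as a module over the monoid ring\<close>

lemma C_simps [simp]: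
  "c \<in> carrier (obj C p) \<longleftrightarrow> singular_chain p Y c"
  "c \<oplus>\<^bsub>obj C p\<^esub> d = c + d"
  "\<zero>\<^bsub>obj C p\<^esub> = 0"
  "r \<odot>\<^bsub>obj C p\<^esub> c = act p r c"
  "diff C p = chain_boundary (Suc p)"
  by (simp_all add: ucover_chains_def act_def)

lemma act_simps [simp]:
  "act p 0 c = 0" "act p r 0 = 0" "act p (frag_of g) c = chain_map p (class_concat X g) c"
  by (simp_all add: act_def)

lemma act_diff_left: "act p (r - s) c = act p r c - act p s c"
  and act_add_left: "act p (r + s) c = act p r c + act p s c"
  and act_diff_right: "act p r (c - d) = act p r c - act p r d"
  by (simp_all add: act_def frag_extend_diff frag_extend_add chain_map_diff frag_extend_fun_diff)

lemma act_add_right: "act p r (c + d) = act p r c + act p r d"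
  by (simp add: act_def chain_map_add frag_extend_fun_add)

lemma act_sum_left: "act p (\<Sum>i\<in>I. r i) c = (\<Sum>i\<in>I. act p (r i) c)"
  by (induction I rule: infinite_finite_induct) (simp_all add: act_add_left)

lemma act_sum_right: "act p r (\<Sum>i\<in>I. c i) = (\<Sum>i\<in>I. act p r (c i))"
  by (induction I rule: infinite_finite_induct) (simp_all add: act_add_right)

lemma singular_chain_act:
  assumes r: "Poly_Mapping.keys r \<subseteq> carrier M" and c: "singular_chain p Y c"
  shows "singular_chain p Y (act p r c)"
  unfolding act_def
  by (intro singular_chain_extend singular_chain_chain_map[OF c] continuous_map_deck) (use r in auto)

lemma simplex_map_deck_concat:
  assumes g: "g \<in> path_classes X x0 x0" and h: "h \<in> path_classes X x0 x0" and \<sigma>: "singular_simplex p Y \<sigma>"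
  shows "simplex_map p (class_concat X (class_concat X g h)) \<sigma> =
    simplex_map p (class_concat X g) (simplex_map p (class_concat X h) \<sigma>)"
proof -
  have "class_concat X (class_concat X g h) y = (class_concat X g \<circ> class_concat X h) y" if "y \<in> topspace Y" for y
    using class_concat_assoc[OF g h ucover_class_end[OF that]] by simp
  then show ?thesis
    using simplex_map_eq[OF \<sigma>] simplex_map_compose by (metis comp_apply)
qed

lemma act_conv:
  assumes r: "Poly_Mapping.keys r \<subseteq> carrier M" and s: "Poly_Mapping.keys s \<subseteq> carrier M"
    and c: "singular_chain p Y c"
  shows "act p (conv M r s) c = act p r (act p s c)"
  using r
proof (induction r rule: frag_induction)
  case (one g)
  show ?case using s
  proof (induction s rule: frag_induction)
    case (one h)
    show ?case using c unfolding singular_chain_def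
    proof (induction c rule: frag_induction)
      case (one \<sigma>)
      then show ?case
        using \<open>g \<in> carrier M\<close> \<open>h \<in> carrier M\<close> by (simp add: simplex_map_deck_concat)
    qed (simp_all add: act_diff_right)
  qed (simp_all add: conv_diff_right act_diff_left act_diff_right)
qed (simp_all add: conv_diff_left act_diff_left)

lemma chain_boundary_act:
  assumes c: "singular_chain (Suc p) Y c"
  shows "chain_boundary (Suc p) (act (Suc p) r c) = act p r (chain_boundary (Suc p) c)"
proof -
  have "Poly_Mapping.keys r \<subseteq> UNIV" by simp
  then show ?thesis
    by (induction r rule: frag_induction)
      (simp_all add: act_diff_left chain_boundary_diff chain_boundary_chain_map[OF c])
qed

text \<open>A deck transformation sends simplices to simplices, so the action affects the
  augmentation only through the coefficients.\<close>

lemma aug_act: "aug (act p r c) = aug r * aug c"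
  unfolding act_def weight_extend weight_chain_map using weight_mult[of "\<lambda>_. 1" "aug c" r] by simp

lemma singular_chain_base: "singular_chain 0 Y base_chain"
  using singular_simplex_point[OF ucover_I[OF base_class]] by (simp add: singular_chain_of)

text \<open>A 0-chain of augmentation 0 is the boundary of its cone. From here on
  \<open>H\<^sub>0\<close> of the cover is handled through the integer \<open>aug\<close>.\<close>

lemma boundaries_C_0: "boundaries C 0 = {c. singular_chain 0 Y c \<and> aug c = 0}"
proof (rule equalityI; rule subsetI)
  fix c assume "c \<in> boundaries C 0"
  then obtain d where "singular_chain 1 Y d" "c = chain_boundary 1 d"
    by (auto simp: boundaries_def)
  then show "c \<in> {c. singular_chain 0 Y c \<and> aug c = 0}"
    using weight_chain_boundary singular_chain_boundary[of 1 Y d] by fastforce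
next
  fix c assume "c \<in> {c. singular_chain 0 Y c \<and> aug c = 0}"
  then have "singular_chain 1 Y (cone_chain X c)" "chain_boundary 1 (cone_chain X c) = c"
    using cone_chain_0_homology[of X x0 c] by auto
  then show "c \<in> boundaries C 0"
    unfolding boundaries_def by (intro image_eqI[of _ _ "cone_chain X c"]) simp_all
qed

lemma hclass_C: "hclass C p c = {b + c | b. b \<in> boundaries C p}"
  by (auto simp: hclass_def a_r_coset_def')

lemma hclass_C_0:
  assumes c: "singular_chain 0 Y c"
  shows "hclass C 0 c = {d. singular_chain 0 Y d \<and> aug d = aug c}"
proof (rule equalityI; rule subsetI)
  fix d assume "d \<in> hclass C 0 c"
  then show "d \<in> {d. singular_chain 0 Y d \<and> aug d = aug c}"
    using c by (auto simp: hclass_C boundaries_C_0 weight_add singular_chain_add)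
next
  fix d assume "d \<in> {d. singular_chain 0 Y d \<and> aug d = aug c}"
  then have "d - c \<in> boundaries C 0"
    using c by (auto simp: boundaries_C_0 weight_diff singular_chain_diff)
  then show "d \<in> hclass C 0 c" unfolding hclass_C by force
qed

lemma hclass_C_1:
  assumes X: "semilocally_1_connected X" and c: "singular_chain 1 Y c" "chain_boundary 1 c = 0"
  shows "hclass C 1 c = boundaries C 1"
proof -
  obtain d where d: "singular_chain 2 Y d" "chain_boundary 2 d = c"
    using universal_cover_H1_trivial[OF X c] by blast
  have d: "singular_chain (Suc 1) Y d" "chain_boundary (Suc 1) d = c" using d by (simp_all add: numeral_2_eq_2)
  show ?thesis
  proof (rule equalityI; rule subsetI)
    fix b assume "b \<in> hclass C 1 c"
    then obtain e where "singular_chain (Suc 1) Y e" "b = chain_boundary (Suc 1) e + c"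
      by (auto simp: hclass_C boundaries_def)
    then show "b \<in> boundaries C 1"
      unfolding boundaries_def using d
      by (intro image_eqI[of _ _ "e + d"]) (simp_all add: chain_boundary_add singular_chain_add)
  next
    fix b assume "b \<in> boundaries C 1"
    then obtain e where "singular_chain (Suc 1) Y e" "b = chain_boundary (Suc 1) e"
      by (auto simp: boundaries_def)
    then have "b - c \<in> boundaries C 1"
      unfolding boundaries_def using d
      by (intro image_eqI[of _ _ "e - d"]) (simp_all add: chain_boundary_diff singular_chain_diff)
    then show "b \<in> hclass C 1 c" unfolding hclass_C by force
  qed
qed

subsection \<open>Connected half-spaces give finite 1-type\<close>

definition pres_boundary :: "nat \<Rightarrow> (nat \<Rightarrow> (real \<Rightarrow> 'a) set) \<Rightarrow> (nat \<Rightarrow> ((real \<Rightarrow> 'a) set \<Rightarrow>\<^sub>0 int)) \<Rightarrow> ((real \<Rightarrow> 'a) set \<Rightarrow>\<^sub>0 int)" where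
  "pres_boundary k s x = (\<Sum>i<k. conv M (x i) (frag_of (s i) - frag_of base_class))"

text \<open>The start of a free resolution of the trivial module: the i-th basis vector in degree 1
  is sent to \<open>s i\<close> minus 1, and all modules above degree 1 are zero. The generator in
  degree 0 has index 0, so that elements have the type prescribed by
  \<open>finite_1_type\<close>.\<close>

definition pres_cx :: "nat \<Rightarrow> (nat \<Rightarrow> (real \<Rightarrow> 'a) set) \<Rightarrow>
    (((real \<Rightarrow> 'a) set \<Rightarrow>\<^sub>0 int), nat \<Rightarrow> ((real \<Rightarrow> 'a) set \<Rightarrow>\<^sub>0 int)) chain_cx" where
  "pres_cx k s = \<lparr>obj = (\<lambda>p. free_left_module R (if p = 0 then {0} else if p = 1 then {..<k} else {})),
     diff = (\<lambda>p x i. if p = 0 \<and> i = 0 then pres_boundary k s x else 0)\<rparr>"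

text \<open>The generator in degree 0 goes to the base point, the i-th generator in degree 1 to the
  cone edge that ends at its translate by \<open>s i\<close>.\<close>

definition pres_map :: "nat \<Rightarrow> (nat \<Rightarrow> (real \<Rightarrow> 'a) set) \<Rightarrow> nat \<Rightarrow>
    (nat \<Rightarrow> ((real \<Rightarrow> 'a) set \<Rightarrow>\<^sub>0 int)) \<Rightarrow> (real \<Rightarrow> 'a) set chain" where
  "pres_map k s p x = (if p = 0 then act 0 (x 0) base_chain
     else if p = 1 then (\<Sum>i<k. act 1 (x i) (frag_of (cone_edge X (s i)))) else 0)"

text \<open>Telescoping: a path from 1 to g writes g - 1 as a signed sum of terms h(s - 1), one for
  each edge. Other ring elements follow by linearity, after subtracting their augmentation.\<close>

lemma pres_boundary_surj:
  assumes s: "\<And>i. i < k \<Longrightarrow> s i \<in> carrier M"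
    and j: "\<And>g. g \<in> carrier M \<Longrightarrow> joined (halfspace_edges G \<phi> (s ` {..<k})) base_class g"
    and r: "Poly_Mapping.keys r \<subseteq> carrier M"
  shows "\<exists>x. (\<forall>i. Poly_Mapping.keys (x i) \<subseteq> carrier M) \<and> (\<forall>i. i \<ge> k \<longrightarrow> x i = 0) \<and>
    pres_boundary k s x = r - frag_cmul (aug r) (frag_of base_class)"
proof -
  define Q where "Q r \<longleftrightarrow> (\<exists>x. (\<forall>i. Poly_Mapping.keys (x i) \<subseteq> carrier M) \<and> (\<forall>i. i \<ge> k \<longrightarrow> x i = 0) \<and>
    pres_boundary k s x = r)" for r
  have Q0: "Q 0"
    unfolding Q_def by (rule exI[of _ "\<lambda>_. 0"]) (simp add: pres_boundary_def)
  have Qd: "Q (a - b)" if ab: "Q a" "Q b" for a b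
  proof -
    obtain x where x: "\<And>i. Poly_Mapping.keys (x i) \<subseteq> carrier M" "\<And>i. i \<ge> k \<Longrightarrow> x i = 0" "pres_boundary k s x = a"
      using ab(1) unfolding Q_def by blast
    obtain y where y: "\<And>i. Poly_Mapping.keys (y i) \<subseteq> carrier M" "\<And>i. i \<ge> k \<Longrightarrow> y i = 0" "pres_boundary k s y = b"
      using ab(2) unfolding Q_def by blast
    have "pres_boundary k s (\<lambda>i. x i - y i) = a - b"
      using x(3) y(3) by (simp add: pres_boundary_def conv_diff_left sum_subtractf)
    then show ?thesis
      unfolding Q_def using x y keys_diff_subset[OF x(1) y(1)] by (intro exI[of _ "\<lambda>i. x i - y i"]) simp
  qed
  have Qa: "Q (a + b)" if "Q a" "Q b" for a b
    using Qd[OF that(1) Qd[OF Q0 that(2)]] by simp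
  have edge: "Q (frag_of b - frag_of a)" if ab: "(a, b) \<in> halfspace_edges G \<phi> (s ` {..<k})" for a b
  proof -
    obtain i where i: "i < k" "a \<in> carrier M" "b = class_concat X a (s i)"
      using ab by (auto simp: halfspace_edges_def)
    have a: "class_concat X a base_class = a" using i(2) class_concat_const_right[of a X x0 x0] by simp
    have "pres_boundary k s (\<lambda>j. if j = i then frag_of a else 0)
        = (\<Sum>j<k. if j = i then conv M (frag_of a) (frag_of (s i) - frag_of base_class) else 0)"
      unfolding pres_boundary_def by (rule sum.cong) auto
    also have "\<dots> = frag_of b - frag_of a"
      using i a by (simp add: conv_diff_right)
    finally show ?thesis
      unfolding Q_def using i(1,2) by (intro exI[of _ "\<lambda>j. if j = i then frag_of a else 0"]) auto
  qed
  have path: "Q (frag_of g - frag_of base_class)" if "joined (halfspace_edges G \<phi> (s ` {..<k})) base_class g" for g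
    using that
  proof (induction rule: joined_induct)
    case refl
    then show ?case using Q0 by simp
  next
    case (step a b)
    from step.hyps(2) have "Q (frag_of b - frag_of a)"
    proof
      assume "(b, a) \<in> halfspace_edges G \<phi> (s ` {..<k})"
      from Qd[OF Q0 edge[OF this]] show ?thesis by simp
    qed (rule edge)
    from Qa[OF this step.IH] show ?case by simp
  qed
  have "Q (r - frag_cmul (aug r) (frag_of base_class))"
    using r
  proof (induction r rule: frag_induction)
    case (one g)
    then show ?case using path[OF j] by simp
  next
    case (diff a b)
    have eq: "(a - b) - frag_cmul (aug (a - b)) (frag_of base_class) =
      (a - frag_cmul (aug a) (frag_of base_class)) - (b - frag_cmul (aug b) (frag_of base_class))"
      by (simp add: weight_diff frag_cmul_diff_distrib)
    show ?case unfolding eq by (rule Qd[OF diff])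
  qed (simp add: Q0)
  then show ?thesis unfolding Q_def .
qed

text \<open>The boundary of \<open>pres_cx\<close> has the augmentation ideal as its image, so its
  \<open>H\<^sub>0\<close> and that of the cover are both the integers, and \<open>pres_map\<close>
  preserves the augmentation. In degree 1 the homology of the cover is trivial.\<close>

lemma finite_1_type_if_connected:
  assumes X: "semilocally_1_connected X" and conn: "halfspace_connected G \<phi>"
  shows "finite_1_type R C"
proof -
  obtain S where S: "finite S" "S \<subseteq> {s \<in> carrier G. 0 \<le> \<phi> s}"
    "\<And>g. g \<in> carrier G \<Longrightarrow> 0 \<le> \<phi> g \<Longrightarrow> joined (halfspace_edges G \<phi> S) \<one>\<^bsub>G\<^esub> g"
    using conn unfolding halfspace_connected_def by blast
  obtain k :: nat and s where ks: "S = s ` {i. i < k}"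
    using finite_imp_nat_seg_image_inj_on[OF S(1)] by blast
  have s: "s i \<in> carrier M" if "i < k" for i
    using S(2) that unfolding ks by auto
  have j: "joined (halfspace_edges G \<phi> (s ` {..<k})) base_class g" if "g \<in> carrier M" for g
    using S(3)[of g] that unfolding ks lessThan_def by simp
  let ?C = "pres_cx k s"
  let ?f = "pres_map k s"
  let ?I = "\<lambda>p::nat. if p = 0 then {0} else if p = 1 then {..<k} else {}"
  have fin: "finite (?I p)" for p by simp
  have carr: "x \<in> carrier (obj ?C p) \<longleftrightarrow>
      (\<forall>i. Poly_Mapping.keys (x i) \<subseteq> carrier M) \<and> (\<forall>i. i \<notin> ?I p \<longrightarrow> x i = 0)" for x p
    by (simp only: pres_cx_def chain_cx.simps free_left_module_finite[OF fin] monoid_ring_simps)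
  have add: "x \<oplus>\<^bsub>obj ?C p\<^esub> y = (\<lambda>i. x i + y i)" for x y p
    by (simp only: pres_cx_def chain_cx.simps free_left_module_simps monoid_ring_simps)
  have zero: "\<zero>\<^bsub>obj ?C p\<^esub> = (\<lambda>i. 0)" for p
    by (simp only: pres_cx_def chain_cx.simps free_left_module_simps monoid_ring_simps)
  have smult: "r \<odot>\<^bsub>obj ?C p\<^esub> x = (\<lambda>i. conv M r (x i))" for r x p
    by (simp only: pres_cx_def chain_cx.simps free_left_module_simps monoid_ring_simps)
  have diff: "diff ?C p x = (\<lambda>i. if p = 0 \<and> i = 0 then pres_boundary k s x else 0)" for p x
    by (simp add: pres_cx_def)
  have unit: "Poly_Mapping.keys (frag_of (s i) - frag_of base_class) \<subseteq> carrier M" if "i < k" for i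
    using s[OF that] base_class \<phi>_one by (intro keys_diff_subset) auto
  have keys_pb: "Poly_Mapping.keys (pres_boundary k s x) \<subseteq> carrier M"
    if "\<And>i. Poly_Mapping.keys (x i) \<subseteq> carrier M" for x
    unfolding pres_boundary_def by (intro keys_sum_subset keys_conv[OF monoid_M that unit]) simp
  have dlin: "diff ?C p \<in> linear_hom R (obj ?C (Suc p)) (obj ?C p)" for p
    unfolding linear_hom_def
  proof (intro CollectI conjI ballI funcsetI)
    fix x assume "x \<in> carrier (obj ?C (Suc p))"
    then show "diff ?C p x \<in> carrier (obj ?C p)" using keys_pb unfolding carr diff by auto
  next
    fix x y assume "x \<in> carrier (obj ?C (Suc p))" "y \<in> carrier (obj ?C (Suc p))"
    show "diff ?C p (x \<oplus>\<^bsub>obj ?C (Suc p)\<^esub> y) = diff ?C p x \<oplus>\<^bsub>obj ?C p\<^esub> diff ?C p y"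
      unfolding add diff by (simp add: pres_boundary_def conv_add_left sum.distrib fun_eq_iff)
  next
    fix r x assume r: "r \<in> carrier R" and x: "x \<in> carrier (obj ?C (Suc p))"
    have "pres_boundary k s (\<lambda>i. conv M r (x i)) = conv M r (pres_boundary k s x)"
      unfolding pres_boundary_def conv_sum_right
      by (rule sum.cong[OF refl], rule conv_assoc[OF monoid_M]) (use r x unit in \<open>auto simp: carr\<close>)
    then show "diff ?C p (r \<odot>\<^bsub>obj ?C (Suc p)\<^esub> x) = r \<odot>\<^bsub>obj ?C p\<^esub> diff ?C p x"
      unfolding smult diff by (simp add: fun_eq_iff)
  qed
  have pb0: "pres_boundary k s (\<lambda>i. 0) = 0" by (simp add: pres_boundary_def)
  have cx: "is_chain_cx R ?C"
    unfolding is_chain_cx_def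
  proof (intro conjI allI ballI)
    show "left_module R (obj ?C p)" for p
      unfolding pres_cx_def chain_cx.simps by (rule left_module_free[OF ring_R])
    show "diff ?C p (diff ?C (Suc p) x) = \<zero>\<^bsub>obj ?C p\<^esub>" for p x
      unfolding zero diff by (simp add: pb0 fun_eq_iff)
  qed (rule dlin)
  have one: "\<one>\<^bsub>R\<^esub> \<noteq> \<zero>\<^bsub>R\<^esub>" by simp
  have fg: "fin_gen_module R (obj ?C p) \<and> projective_module R (obj ?C p)" for p
    using fin_gen_free_module[OF ring_R one fin] projective_free_module[OF ring_R one fin] by (simp add: pres_cx_def)
  have edge: "singular_chain 1 Y (frag_of (cone_edge X (s i)))" if "i < k" for i
    using singular_simplex_cone_edge[of "s i" X x0 x0] s[OF that] by (simp add: singular_chain_of)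
  have fcarr: "?f p x \<in> carrier (obj C p)" if x: "x \<in> carrier (obj ?C p)" for p x
  proof -
    have "singular_chain 1 Y (\<Sum>i<k. act 1 (x i) (frag_of (cone_edge X (s i))))"
      by (intro singular_chain_sum singular_chain_act edge) (use x in \<open>auto simp: carr\<close>)
    moreover have "singular_chain 0 Y (act 0 (x 0) base_chain)"
      by (intro singular_chain_act singular_chain_base) (use x in \<open>auto simp: carr\<close>)
    ultimately show ?thesis by (simp add: pres_map_def)
  qed
  have flin: "?f p \<in> linear_hom R (obj ?C p) (obj C p)" for p
    unfolding linear_hom_def
  proof (intro CollectI conjI ballI funcsetI fcarr)
    fix x y assume "x \<in> carrier (obj ?C p)" "y \<in> carrier (obj ?C p)"
    show "?f p (x \<oplus>\<^bsub>obj ?C p\<^esub> y) = ?f p x \<oplus>\<^bsub>obj C p\<^esub> ?f p y"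
      unfolding add by (simp add: pres_map_def act_add_left sum.distrib)
  next
    fix r x assume r: "r \<in> carrier R" and x: "x \<in> carrier (obj ?C p)"
    have "act 0 (conv M r (x 0)) base_chain = act 0 r (act 0 (x 0) base_chain)"
      by (rule act_conv[OF _ _ singular_chain_base]) (use r x in \<open>auto simp: carr\<close>)
    moreover have "(\<Sum>i<k. act 1 (conv M r (x i)) (frag_of (cone_edge X (s i)))) =
        act 1 r (\<Sum>i<k. act 1 (x i) (frag_of (cone_edge X (s i))))"
      unfolding act_sum_right
      by (rule sum.cong[OF refl], rule act_conv[OF _ _ edge]) (use r x in \<open>auto simp: carr\<close>)
    ultimately show "?f p (r \<odot>\<^bsub>obj ?C p\<^esub> x) = r \<odot>\<^bsub>obj C p\<^esub> ?f p x"
      unfolding smult by (simp add: pres_map_def)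
  qed
  \<comment> \<open>The reason for choosing cone edges: the boundary of the edge to
    \<open>s i\<close> is the translated base point minus the base point.\<close>
  have act_unit: "act 0 (frag_of (s i) - frag_of base_class) base_chain = chain_boundary 1 (frag_of (cone_edge X (s i)))"
    if "i < k" for i
    using s[OF that] class_concat_const_right[of "s i" X x0 x0] class_concat_const_left[OF base_class]
    by (simp add: act_diff_left simplex_map_point chain_boundary_cone_edge[of "s i" X x0 x0, simplified])
  have comm: "?f p (diff ?C p x) = diff C p (?f (Suc p) x)" if x: "x \<in> carrier (obj ?C (Suc p))" for p x
  proof (cases "p = 0")
    case True
    have "act 0 (pres_boundary k s x) base_chain =
        (\<Sum>i<k. act 0 (x i) (act 0 (frag_of (s i) - frag_of base_class) base_chain))"
      unfolding pres_boundary_def act_sum_left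
      by (rule sum.cong[OF refl], rule act_conv[OF _ unit singular_chain_base]) (use x in \<open>auto simp: carr\<close>)
    also have "\<dots> = (\<Sum>i<k. act 0 (x i) (chain_boundary 1 (frag_of (cone_edge X (s i)))))"
      by (rule sum.cong) (simp_all only: act_unit lessThan_iff)
    also have "\<dots> = (\<Sum>i<k. chain_boundary 1 (act 1 (x i) (frag_of (cone_edge X (s i)))))"
      by (rule sum.cong[OF refl]) (use chain_boundary_act[of 0] edge in simp)
    also have "\<dots> = chain_boundary 1 (\<Sum>i<k. act 1 (x i) (frag_of (cone_edge X (s i))))"
      by (induction k) (simp_all add: chain_boundary_add)
    finally show ?thesis
      unfolding diff using True by (simp add: pres_map_def)
  next
    case False
    then show ?thesis unfolding diff by (simp add: pres_map_def)
  qed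
  have cmap: "is_chain_map R ?C C ?f"
    unfolding is_chain_map_def using flin comm by blast
  \<comment> \<open>That every element of augmentation 0 is a boundary is where connectedness of the
    half-space is used.\<close>
  have bd0: "boundaries ?C 0 = {x \<in> carrier (obj ?C 0). aug (x 0) = 0}"
  proof (rule equalityI; rule subsetI)
    fix y assume "y \<in> boundaries ?C 0"
    then obtain x where x: "x \<in> carrier (obj ?C (Suc 0))" "y = diff ?C 0 x"
      by (auto simp: boundaries_def)
    have "act 0 (y 0) base_chain = chain_boundary 1 (?f 1 x)"
      using comm[OF x(1)] x(2) by (simp add: pres_map_def)
    then have "aug (act 0 (y 0) base_chain) = 0"
      using weight_chain_boundary[of Y "?f 1 x"] fcarr[OF x(1)] by simp
    moreover have "y \<in> carrier (obj ?C 0)"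
      using dlin[of 0] x unfolding linear_hom_def by blast
    ultimately show "y \<in> {x \<in> carrier (obj ?C 0). aug (x 0) = 0}"
      by (simp add: aug_act)
  next
    fix y assume "y \<in> {x \<in> carrier (obj ?C 0). aug (x 0) = 0}"
    then have y: "y \<in> carrier (obj ?C 0)" "aug (y 0) = 0" by auto
    then obtain x where x: "\<forall>i. Poly_Mapping.keys (x i) \<subseteq> carrier M" "\<forall>i. i \<ge> k \<longrightarrow> x i = 0"
        "pres_boundary k s x = y 0"
      using pres_boundary_surj[OF s j, of "y 0"] by (auto simp: carr)
    have "x \<in> carrier (obj ?C (Suc 0))" unfolding carr using x by simp
    moreover have "y = diff ?C 0 x" unfolding diff using y x(3) by (auto simp: carr fun_eq_iff)
    ultimately show "y \<in> boundaries ?C 0" unfolding boundaries_def by blast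
  qed
  have hcl: "hclass ?C p x = {\<lambda>i. b i + x i | b. b \<in> boundaries ?C p}" for p x
    unfolding hclass_def a_r_coset_def' add by blast
  have addc: "(\<lambda>i. x i + y i) \<in> carrier (obj ?C 0)" and diffc: "(\<lambda>i. x i - y i) \<in> carrier (obj ?C 0)"
    if "x \<in> carrier (obj ?C 0)" "y \<in> carrier (obj ?C 0)" for x y
    using that keys_add_subset[of "x _" "carrier M" "y _"] keys_diff_subset[of "x _" "carrier M" "y _"]
    unfolding carr by simp_all
  have hcl0: "hclass ?C 0 x = {y \<in> carrier (obj ?C 0). aug (y 0) = aug (x 0)}" if x: "x \<in> carrier (obj ?C 0)" for x
  proof (rule equalityI; rule subsetI)
    fix y assume "y \<in> hclass ?C 0 x"
    then show "y \<in> {y \<in> carrier (obj ?C 0). aug (y 0) = aug (x 0)}"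
      using x addc unfolding hcl bd0 by (auto simp: weight_add)
  next
    fix y assume "y \<in> {y \<in> carrier (obj ?C 0). aug (y 0) = aug (x 0)}"
    then have "(\<lambda>i. y i - x i) \<in> boundaries ?C 0"
      using x diffc unfolding bd0 by (simp add: weight_diff)
    then show "y \<in> hclass ?C 0 x" unfolding hcl by (intro CollectI exI[of _ "\<lambda>i. y i - x i"]) simp
  qed
  have f0: "singular_chain 0 Y (?f 0 x)" "aug (?f 0 x) = aug (x 0)" if "x \<in> carrier (obj ?C 0)" for x
    using fcarr[OF that] by (simp_all add: pres_map_def aug_act)
  have hm0: "homology_map C ?f 0 (hclass ?C 0 x) = {d. singular_chain 0 Y d \<and> aug d = aug (x 0)}"
    if x: "x \<in> carrier (obj ?C 0)" for x
  proof -
    have "hclass C 0 (?f 0 y) = {d. singular_chain 0 Y d \<and> aug d = aug (x 0)}" if "y \<in> hclass ?C 0 x" for y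
      using that f0[of y] hclass_C_0[of "?f 0 y"] unfolding hcl0[OF x] by auto
    moreover have "x \<in> hclass ?C 0 x" unfolding hcl0[OF x] using x by simp
    ultimately show ?thesis unfolding homology_map_def by blast
  qed
  have rep: "(\<lambda>i. if i = 0 then frag_cmul n (frag_of base_class) else 0) \<in> carrier (obj ?C 0)" for n
    unfolding carr using base_class \<phi>_one by (auto dest: subsetD[OF keys_cmul])
  have bij: "bij_betw (homology_map C ?f 0) (homology ?C 0) (homology C 0)"
  proof (rule bij_betw_imageI)
    show "inj_on (homology_map C ?f 0) (homology ?C 0)"
    proof (rule inj_onI)
      fix a b assume "a \<in> homology ?C 0" "b \<in> homology ?C 0" and eq: "homology_map C ?f 0 a = homology_map C ?f 0 b"
      then obtain x y where xy: "x \<in> carrier (obj ?C 0)" "a = hclass ?C 0 x" "y \<in> carrier (obj ?C 0)" "b = hclass ?C 0 y"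
        unfolding homology_def cycles.simps by blast
      have "?f 0 x \<in> {d. singular_chain 0 Y d \<and> aug d = aug (y 0)}"
        using eq f0[OF xy(1)] unfolding xy(2,4) hm0[OF xy(1)] hm0[OF xy(3)] by blast
      then have "aug (x 0) = aug (y 0)" using f0[OF xy(1)] by simp
      then show "a = b" unfolding xy(2,4) hcl0[OF xy(1)] hcl0[OF xy(3)] by simp
    qed
    show "homology_map C ?f 0 ` homology ?C 0 = homology C 0"
    proof (rule equalityI; rule subsetI)
      fix a assume "a \<in> homology_map C ?f 0 ` homology ?C 0"
      then obtain x where x: "x \<in> carrier (obj ?C 0)" "a = homology_map C ?f 0 (hclass ?C 0 x)"
        unfolding homology_def cycles.simps by blast
      have "a = hclass C 0 (?f 0 x)"
        unfolding x(2) hm0[OF x(1)] hclass_C_0[OF f0(1)[OF x(1)]] f0(2)[OF x(1)] ..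
      then show "a \<in> homology C 0" unfolding homology_def using f0(1)[OF x(1)] by simp
    next
      fix a assume "a \<in> homology C 0"
      then obtain c where c: "singular_chain 0 Y c" "a = hclass C 0 c"
        unfolding homology_def by auto
      let ?x = "\<lambda>i::nat. if i = 0 then frag_cmul (aug c) (frag_of base_class) else 0"
      have "a = homology_map C ?f 0 (hclass ?C 0 ?x)"
        unfolding c(2) hm0[OF rep] hclass_C_0[OF c(1)] by (simp add: weight_cmul)
      then show "a \<in> homology_map C ?f 0 ` homology ?C 0"
        unfolding homology_def cycles.simps using rep by blast
    qed
  qed
  \<comment> \<open>The module in degree 2 is zero, so homology classes in degree 1 are
    singletons.\<close>
  have hcl1: "hclass ?C 1 x = {x}" for x
  proof -
    have z: "(\<lambda>i. 0) \<in> carrier (obj ?C (Suc 1))" unfolding carr by simp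
    have "boundaries ?C 1 = {\<lambda>i. 0}"
      unfolding boundaries_def using z by (auto simp: diff)
    then show ?thesis unfolding hcl by simp
  qed
  have hm1: "homology_map C ?f 1 (hclass ?C 1 x) = boundaries C 1" if x: "x \<in> cycles ?C (Suc 0)" for x
  proof -
    have xc: "x \<in> carrier (obj ?C (Suc 0))" and d0: "diff ?C 0 x = (\<lambda>i. 0)" using x zero by auto
    have "chain_boundary 1 (?f 1 x) = 0"
      using comm[OF xc] unfolding d0 by (simp add: pres_map_def)
    then have "hclass C 1 (?f 1 x) = boundaries C 1"
      using hclass_C_1[OF X] fcarr[OF xc] by simp
    then show ?thesis unfolding homology_map_def hcl1 by simp
  qed
  \<comment> \<open>The target consists of a single class, and the cycle 0 shows that it is
    attained.\<close>
  have epi: "homology_map C ?f 1 ` homology ?C 1 = homology C 1"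
  proof -
    have z: "(\<lambda>i. 0) \<in> cycles ?C (Suc 0)"
      using zero by (simp add: carr diff pb0 fun_eq_iff)
    have "homology C 1 = {boundaries C 1}"
    proof -
      have "hclass C 1 c = boundaries C 1" if "c \<in> cycles C (Suc 0)" for c
        using hclass_C_1[OF X, of c] that by simp
      moreover have "0 \<in> cycles C (Suc 0)" by simp
      ultimately show ?thesis unfolding homology_def One_nat_def by blast
    qed
    moreover have "homology_map C ?f 1 ` homology ?C 1 = {boundaries C 1}"
    proof -
      have "homology_map C ?f 1 ` homology ?C 1 = (\<lambda>x. homology_map C ?f 1 (hclass ?C 1 x)) ` cycles ?C (Suc 0)"
        unfolding homology_def One_nat_def by (rule image_image)
      then show ?thesis using hm1 z by auto
    qed
    ultimately show ?thesis by simp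
  qed
  show ?thesis
    unfolding finite_1_type_def using cx fg cmap bij epi by blast
qed

subsection \<open>Finite 1-type gives connected half-spaces\<close>

text \<open>Take \<open>u\<close> in degree 0 of the witnessing complex, mapped to a chain
  \<open>c\<close> of augmentation 1. If \<open>r\<close> has augmentation 0, then \<open>r\<close>
  times \<open>u\<close> is trivial in \<open>H\<^sub>0\<close> by injectivity, hence a combination
  of the boundaries of finitely many generators in degree 1. In the cover, \<open>r\<close> times
  \<open>c\<close> becomes a combination of finitely many fixed chains. The conclusion states this
  dually, through functionals \<open>weight w\<close> that kill all translates of those chains; they
  need not be linear over the monoid ring.\<close>

lemma finite_1_type_generators:
  assumes "finite_1_type R C"
  obtains c and \<C> :: "(real \<Rightarrow> 'a) set chain set" where
    "singular_chain 0 Y c" "aug c = 1" "finite \<C>" "\<And>b. b \<in> \<C> \<Longrightarrow> singular_chain 0 Y b \<and> aug b = 0"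
    "\<And>w r. Poly_Mapping.keys r \<subseteq> carrier M \<Longrightarrow> aug r = 0 \<Longrightarrow>
      (\<And>b g. b \<in> \<C> \<Longrightarrow> g \<in> carrier M \<Longrightarrow> weight w (act 0 (frag_of g) b) = 0) \<Longrightarrow>
      weight w (act 0 r c) = 0"
proof -
  obtain C' :: "(((real \<Rightarrow> 'a) set \<Rightarrow>\<^sub>0 int), nat \<Rightarrow> ((real \<Rightarrow> 'a) set \<Rightarrow>\<^sub>0 int)) chain_cx" and f where
    *: "is_chain_cx R C' \<and> (\<forall>p. fin_gen_module R (obj C' p) \<and> projective_module R (obj C' p)) \<and>
      is_chain_map R C' C f \<and> bij_betw (homology_map C f 0) (homology C' 0) (homology C 0) \<and>
      homology_map C f 1 ` homology C' 1 = homology C 1"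
    using assms unfolding finite_1_type_def by (elim exE) (rule that)
  have cx: "is_chain_cx R C'" and fg: "\<And>p. fin_gen_module R (obj C' p)" and cmap: "is_chain_map R C' C f"
    and bij: "bij_betw (homology_map C f 0) (homology C' 0) (homology C 0)"
    using * by auto
  have lm: "left_module R (obj C' p)" for p using cx unfolding is_chain_cx_def by blast
  define N where "N = obj C' 1"
  have lmN: "left_module R N" unfolding N_def by (rule lm)
  interpret C0: abelian_group "obj C' 0" by (rule left_module_abelian_group[OF lm])
  interpret C1: abelian_group N by (rule left_module_abelian_group[OF lmN])
  define d where "d = diff C' 0"
  have dlin: "d \<in> linear_hom R N (obj C' 0)"
    using cx unfolding is_chain_cx_def d_def N_def One_nat_def by blast
  have flin: "f 0 \<in> linear_hom R (obj C' 0) (obj C 0)" "f 1 \<in> linear_hom R N (obj C 1)"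
    using cmap unfolding is_chain_map_def N_def by blast+
  have comm: "f 0 (d y) = chain_boundary 1 (f 1 y)" if "y \<in> carrier N" for y
    using cmap that unfolding is_chain_map_def d_def N_def by auto
  have f0c: "singular_chain 0 Y (f 0 x)" if "x \<in> carrier (obj C' 0)" for x
    using flin(1) that unfolding linear_hom_def by auto
  have f1c: "singular_chain 1 Y (f 1 x)" if "x \<in> carrier N" for x
    using flin(2) that unfolding linear_hom_def by auto
  have f0add: "f 0 (x \<oplus>\<^bsub>obj C' 0\<^esub> y) = f 0 x + f 0 y" if "x \<in> carrier (obj C' 0)" "y \<in> carrier (obj C' 0)" for x y
    using flin(1) that unfolding linear_hom_def by auto
  have f0smult: "f 0 (r \<odot>\<^bsub>obj C' 0\<^esub> x) = act 0 r (f 0 x)" if "Poly_Mapping.keys r \<subseteq> carrier M" "x \<in> carrier (obj C' 0)" for r x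
    using flin(1) that unfolding linear_hom_def by auto
  have dc: "d y \<in> carrier (obj C' 0)" if "y \<in> carrier N" for y
    using dlin that unfolding linear_hom_def by auto
  have dadd: "d (x \<oplus>\<^bsub>N\<^esub> y) = d x \<oplus>\<^bsub>obj C' 0\<^esub> d y" if "x \<in> carrier N" "y \<in> carrier N" for x y
    using dlin that unfolding linear_hom_def by auto
  have dsmult: "d (r \<odot>\<^bsub>N\<^esub> x) = r \<odot>\<^bsub>obj C' 0\<^esub> d x" if "Poly_Mapping.keys r \<subseteq> carrier M" "x \<in> carrier N" for r x
    using dlin that unfolding linear_hom_def by auto
  have f00: "f 0 \<zero>\<^bsub>obj C' 0\<^esub> = 0"
    using f0add[of "\<zero>\<^bsub>obj C' 0\<^esub>" "\<zero>\<^bsub>obj C' 0\<^esub>"] by simp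
  have dzero: "d \<zero>\<^bsub>N\<^esub> = \<zero>\<^bsub>obj C' 0\<^esub>"
    using dadd[of "\<zero>\<^bsub>N\<^esub>" "\<zero>\<^bsub>N\<^esub>"] dc by simp
  have d0: "f 0 (d \<zero>\<^bsub>N\<^esub>) = 0" unfolding dzero by (rule f00)
  have augd: "aug (f 0 (d y)) = 0" if "y \<in> carrier N" for y
    using comm[OF that] weight_chain_boundary[OF f1c[OF that]] by simp
  have bd: "boundaries C' 0 = d ` carrier N"
    unfolding boundaries_def d_def N_def by simp
  have hcl: "hclass C' 0 x = {d y \<oplus>\<^bsub>obj C' 0\<^esub> x | y. y \<in> carrier N}" for x
    unfolding hclass_def a_r_coset_def' bd by blast
  have self: "x \<in> hclass C' 0 x" if "x \<in> carrier (obj C' 0)" for x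
    unfolding hcl using dzero that by (intro CollectI exI[of _ "\<zero>\<^bsub>N\<^esub>"]) simp
  have hm: "homology_map C f 0 (hclass C' 0 x) = {c. singular_chain 0 Y c \<and> aug c = aug (f 0 x)}"
    if x: "x \<in> carrier (obj C' 0)" for x
  proof -
    have "hclass C 0 (f 0 z) = {c. singular_chain 0 Y c \<and> aug c = aug (f 0 x)}" if z: "z \<in> hclass C' 0 x" for z
    proof -
      obtain y where y: "y \<in> carrier N" "z = d y \<oplus>\<^bsub>obj C' 0\<^esub> x"
        using z unfolding hcl by blast
      have "z \<in> carrier (obj C' 0)" unfolding y(2) using dc[OF y(1)] x by simp
      moreover have "aug (f 0 z) = aug (f 0 x)"
        unfolding y(2) f0add[OF dc[OF y(1)] x] weight_add augd[OF y(1)] by simp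
      ultimately show ?thesis using hclass_C_0[OF f0c] by simp
    qed
    then show ?thesis unfolding homology_map_def using self[OF x] by blast
  qed
  have cyc: "homology C' 0 = hclass C' 0 ` carrier (obj C' 0)"
    unfolding homology_def by simp
  \<comment> \<open>Augmentation 0 of the image means the zero class in the cover; injectivity on
    \<open>H\<^sub>0\<close> then yields a preimage under the boundary map.\<close>
  have exact: "\<exists>y\<in>carrier N. x = d y" if x: "x \<in> carrier (obj C' 0)" "aug (f 0 x) = 0" for x
  proof -
    have "homology_map C f 0 (hclass C' 0 x) = homology_map C f 0 (hclass C' 0 \<zero>\<^bsub>obj C' 0\<^esub>)"
      unfolding hm[OF x(1)] hm[OF C0.zero_closed] f00 x(2) by simp
    then have "hclass C' 0 x = hclass C' 0 \<zero>\<^bsub>obj C' 0\<^esub>"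
      by (rule inj_onD[OF bij_betw_imp_inj_on[OF bij]]) (use x cyc in auto)
    then have "x \<in> hclass C' 0 \<zero>\<^bsub>obj C' 0\<^esub>" using self[OF x(1)] by simp
    then show ?thesis unfolding hcl using dc by auto
  qed
  obtain u where u: "u \<in> carrier (obj C' 0)" "aug (f 0 u) = 1"
  proof -
    have "hclass C 0 base_chain \<in> homology C 0"
      unfolding homology_def using singular_chain_base by simp
    then have "hclass C 0 base_chain \<in> homology_map C f 0 ` homology C' 0"
      using bij_betw_imp_surj_on[OF bij] by simp
    then obtain x where x: "x \<in> carrier (obj C' 0)" "hclass C 0 base_chain = homology_map C f 0 (hclass C' 0 x)"
      unfolding cyc by blast
    have "base_chain \<in> hclass C 0 base_chain"
      unfolding hclass_C_0[OF singular_chain_base] using singular_chain_base by simp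
    then have "aug base_chain = aug (f 0 x)"
      unfolding x(2) hm[OF x(1)] by simp
    then show thesis using that[OF x(1)] by simp
  qed
  obtain B where B: "finite B" "B \<subseteq> carrier N"
    "\<And>x. x \<in> carrier N \<Longrightarrow> \<exists>c\<in>B \<rightarrow> carrier R. x = (\<Oplus>\<^bsub>N\<^esub>b\<in>B. c b \<odot>\<^bsub>N\<^esub> b)"
    using fg[of 1] unfolding fin_gen_module_def N_def by blast
  show thesis
  proof (rule that[of "f 0 u" "(\<lambda>b. f 0 (d b)) ` B"])
    show "singular_chain 0 Y (f 0 u)" by (rule f0c[OF u(1)])
    show "aug (f 0 u) = 1" by (rule u(2))
    show "finite ((\<lambda>b. f 0 (d b)) ` B)" using B(1) by simp
    show "singular_chain 0 Y b \<and> aug b = 0" if "b \<in> (\<lambda>b. f 0 (d b)) ` B" for b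
      using that B(2) f0c[OF dc] augd by auto
    fix w r assume r: "Poly_Mapping.keys r \<subseteq> carrier M" "aug r = 0"
      and w: "\<And>b g. b \<in> (\<lambda>b. f 0 (d b)) ` B \<Longrightarrow> g \<in> carrier M \<Longrightarrow> weight w (act 0 (frag_of g) b) = 0"
    have ru: "r \<odot>\<^bsub>obj C' 0\<^esub> u \<in> carrier (obj C' 0)"
      by (rule left_module_smult[OF lm _ u(1)]) (use r in simp)
    have "aug (f 0 (r \<odot>\<^bsub>obj C' 0\<^esub> u)) = 0"
      unfolding f0smult[OF r(1) u(1)] aug_act r(2) by simp
    then obtain y where y: "y \<in> carrier N" "r \<odot>\<^bsub>obj C' 0\<^esub> u = d y"
      using exact[OF ru] by blast
    obtain c where c: "c \<in> B \<rightarrow> carrier R" "y = (\<Oplus>\<^bsub>N\<^esub>b\<in>B. c b \<odot>\<^bsub>N\<^esub> b)"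
      using B(3)[OF y(1)] by blast
    have "weight w (f 0 (d (\<Oplus>\<^bsub>N\<^esub>b\<in>B. c b \<odot>\<^bsub>N\<^esub> b))) = 0"
    proof (rule C1.finsum_induct[OF B(1), of _ "\<lambda>y. weight w (f 0 (d y)) = 0"])
      show "weight w (f 0 (d \<zero>\<^bsub>N\<^esub>)) = 0" unfolding d0 by simp
      show "weight w (f 0 (d (x \<oplus>\<^bsub>N\<^esub> z))) = 0"
        if "x \<in> carrier N" "z \<in> carrier N" "weight w (f 0 (d x)) = 0" "weight w (f 0 (d z)) = 0" for x z
        using that dadd f0add dc by (simp add: weight_add)
      fix b assume b: "b \<in> B"
      have bc: "b \<in> carrier N" "Poly_Mapping.keys (c b) \<subseteq> carrier M" using b B(2) funcset_mem[OF c(1) b] by (auto simp only: monoid_ring_simps)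
      have "weight w (f 0 (d (c b \<odot>\<^bsub>N\<^esub> b))) = weight w (act 0 (c b) (f 0 (d b)))"
        using dsmult[OF bc(2,1)] f0smult[OF bc(2) dc[OF bc(1)]] by simp
      \<comment> \<open>The coefficient is expanded into group elements, which leaves only
        translates that \<open>w\<close> kills.\<close>
      also have "\<dots> = weight (\<lambda>g. weight w (act 0 (frag_of g) (f 0 (d b)))) (c b)"
        by (simp add: act_def weight_extend)
      also have "\<dots> = 0"
        by (rule weight_zero_on_keys) (use w b bc in blast)
      finally show "c b \<odot>\<^bsub>N\<^esub> b \<in> carrier N \<and> weight w (f 0 (d (c b \<odot>\<^bsub>N\<^esub> b))) = 0"
        using left_module_smult[OF lmN _ bc(1)] bc(2) by simp
    qed
    then show "weight w (act 0 r (f 0 u)) = 0"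
      using y(2) c(2) f0smult[OF r(1) u(1)] by simp
  qed
qed

text \<open>An equivariant retraction of the points of the cover onto the fibre over the base point,
  that is, onto the group: a chosen path back from the end point is appended. The choice depends
  only on the end point, which deck transformations preserve; hence equivariance.\<close>

definition retract_class :: "((nat \<Rightarrow> real) \<Rightarrow> (real \<Rightarrow> 'a) set) \<Rightarrow> (real \<Rightarrow> 'a) set" where
  "retract_class \<sigma> = (let a = \<sigma> (\<lambda>j. if j = 0 then 1 else 0) in
     class_concat X a (inv_class X (SOME b. b \<in> path_classes X x0 (class_end a))))"

lemma retract_class_point:
  assumes a: "a \<in> path_classes X x0 y"
  shows "retract_class (point_simplex a) \<in> path_classes X x0 x0"
    and "g \<in> path_classes X x0 x0 \<Longrightarrow>
      retract_class (point_simplex (class_concat X g a)) = class_concat X g (retract_class (point_simplex a))"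
proof -
  define b where "b = (SOME b. b \<in> path_classes X x0 y)"
  have "b \<in> path_classes X x0 y" unfolding b_def using a by (rule someI)
  then have b: "inv_class X b \<in> path_classes X y x0" by (rule path_classes_inv)
  have eq: "retract_class (point_simplex c) = class_concat X c (inv_class X b)" if "c \<in> path_classes X x0 y" for c
    unfolding retract_class_def b_def using class_end[OF that] by (simp add: point_simplex_def)
  show "retract_class (point_simplex a) \<in> path_classes X x0 x0"
    unfolding eq[OF a] by (rule path_classes_concat[OF a b])
  assume g: "g \<in> path_classes X x0 x0"
  show "retract_class (point_simplex (class_concat X g a)) = class_concat X g (retract_class (point_simplex a))"
    unfolding eq[OF a] eq[OF path_classes_concat[OF g a]] by (rule class_concat_assoc[OF g a b])
qed

text \<open>The indicator function of a connected component is a functional killing all the relations.\<close>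

lemma connected_if_finite_1_type:
  assumes fin: "finite_1_type R C" and nz: "u \<in> path_classes X x0 x0" "\<phi> u \<noteq> 0"
  shows "halfspace_connected G \<phi>"
proof (rule finite_1_type_generators[OF fin])
  fix c and \<C> :: "(real \<Rightarrow> 'a) set chain set"
  assume c: "singular_chain 0 Y c" "aug c = 1" and \<C>: "finite \<C>" "\<And>b. b \<in> \<C> \<Longrightarrow> singular_chain 0 Y b \<and> aug b = 0"
    and kill: "\<And>w r. Poly_Mapping.keys r \<subseteq> carrier M \<Longrightarrow> aug r = 0 \<Longrightarrow>
      (\<And>b g. b \<in> \<C> \<Longrightarrow> g \<in> carrier M \<Longrightarrow> weight w (act 0 (frag_of g) b) = 0) \<Longrightarrow>
      weight w (act 0 r c) = 0"
  \<comment> \<open>The simplices that occur in \<open>c\<close> and in the generating chains; their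
    retractions form the finite set \<open>D\<close> of group elements.\<close>
  define K where "K = (\<Union>b\<in>insert c \<C>. Poly_Mapping.keys b)"
  have K: "finite K" unfolding K_def using \<C>(1) by simp
  have pt: "\<exists>a y. a \<in> path_classes X x0 y \<and> \<sigma> = point_simplex a" if "\<sigma> \<in> K" for \<sigma>
  proof -
    have "singular_simplex 0 Y \<sigma>" using that c(1) \<C>(2) unfolding K_def singular_chain_def by blast
    then obtain a where "a \<in> topspace Y" "\<sigma> = point_simplex a" by (rule singular_simplex_0_cases)
    then show ?thesis using ucover_class_end[of a X x0] by blast
  qed
  define D where "D = retract_class ` K"
  have ret: "retract_class \<sigma> \<in> path_classes X x0 x0" if "\<sigma> \<in> K" for \<sigma>
    using pt[OF that] by (elim exE conjE) (simp add: retract_class_point(1))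
  have equi: "retract_class (simplex_map 0 (class_concat X g) \<sigma>) = class_concat X g (retract_class \<sigma>)"
    if \<sigma>: "\<sigma> \<in> K" and g: "g \<in> path_classes X x0 x0" for \<sigma> g
  proof -
    obtain a y where "a \<in> path_classes X x0 y" "\<sigma> = point_simplex a" using pt[OF \<sigma>] by blast
    then show ?thesis using retract_class_point(2)[OF _ g] by (simp add: simplex_map_point)
  qed
  \<comment> \<open>In this graph every translate of \<open>D\<close> by an element of the
    half-space is a clique, although \<open>D\<close> itself may leave the half-space. This is the
    situation of \<open>halfspace_connected_if_joined\<close>.\<close>
  let ?E = "{(class_concat X h a, class_concat X h b) | h a b. h \<in> carrier G \<and> 0 \<le> \<phi> h \<and> a \<in> D \<and> b \<in> D}"
  have E: "joined ?E (class_concat X g a) (class_concat X g b)" if "g \<in> carrier M" "a \<in> D" "b \<in> D" for g a b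
    by (rule joined_edge) (use that in auto)
  have "aug c \<noteq> 0" using c(2) by simp
  then obtain \<sigma>0 where \<sigma>0: "\<sigma>0 \<in> Poly_Mapping.keys c" by (rule weight_nonzero)
  define k where "k = retract_class \<sigma>0"
  have keysD: "retract_class \<sigma> \<in> D" if "\<sigma> \<in> Poly_Mapping.keys b" "b \<in> insert c \<C>" for \<sigma> b
    unfolding D_def K_def using that by blast
  have k: "k \<in> D" unfolding k_def using keysD \<sigma>0 by blast
  define w where "w \<sigma> = (if joined ?E k (retract_class \<sigma>) then 1 else 0 :: int)" for \<sigma>
  have weight_w: "weight w (act 0 (frag_of g) b) = weight (\<lambda>\<sigma>. if joined ?E k (class_concat X g (retract_class \<sigma>)) then 1 else 0) b"
    if "b \<in> insert c \<C>" "g \<in> carrier M" for b g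
    unfolding act_simps weight_chain_map
  proof (rule weight_cong)
    fix \<sigma> assume "\<sigma> \<in> Poly_Mapping.keys b"
    then have "\<sigma> \<in> K" "g \<in> path_classes X x0 x0" using that by (auto simp: K_def)
    then show "w (simplex_map 0 (class_concat X g) \<sigma>) = (if joined ?E k (class_concat X g (retract_class \<sigma>)) then 1 else 0)"
      unfolding w_def by (simp only: equi)
  qed
  have D_G: "D \<subseteq> carrier G" using ret by (auto simp: D_def)
  have "joined ?E k (class_concat X g k)" if g: "g \<in> carrier M" for g
  proof -
    \<comment> \<open>The simplices of a translated relation retract into one clique, so
      \<open>w\<close> is constant on them and yields that constant times the augmentation, which is
      0.\<close>
    have rel: "weight w (act 0 (frag_of h) b) = 0" if b: "b \<in> \<C>" and h: "h \<in> carrier M" for b h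
    proof (cases "\<exists>\<tau>\<in>Poly_Mapping.keys b. joined ?E k (class_concat X h (retract_class \<tau>))")
      case True
      then obtain \<tau> where \<tau>: "\<tau> \<in> Poly_Mapping.keys b" "joined ?E k (class_concat X h (retract_class \<tau>))" by blast
      have bI: "b \<in> insert c \<C>" using b by blast
      have "joined ?E k (class_concat X h (retract_class \<sigma>))" if "\<sigma> \<in> Poly_Mapping.keys b" for \<sigma>
        by (rule joined_trans[OF \<tau>(2) E[OF h keysD[OF \<tau>(1) bI] keysD[OF that bI]]])
      then have "weight w (act 0 (frag_of h) b) = aug b * 1"
        unfolding weight_w[OF bI h] by (intro weight_constant_on_keys) simp
      then show ?thesis using \<C>(2)[OF b] by simp
    next
      case False
      have bI: "b \<in> insert c \<C>" using b by blast
      show ?thesis unfolding weight_w[OF bI h] by (rule weight_zero_on_keys) (use False in simp)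
    qed
    have one: "base_class \<in> carrier M" using base_class \<phi>_one by simp
    \<comment> \<open>For \<open>r\<close> equal to g - 1 the vanishing says that \<open>w\<close>
      has the same value on the translate of \<open>c\<close> by \<open>g\<close> as on
      \<open>c\<close>. On \<open>c\<close> this value is 1, so some simplex of the translate
      retracts into the component of \<open>k\<close>.\<close>
    have "weight w (act 0 (frag_of g - frag_of base_class) c) = 0"
    proof (rule kill)
      show "Poly_Mapping.keys (frag_of g - frag_of base_class) \<subseteq> carrier M"
        using g one by (intro keys_diff_subset) auto
      show "aug (frag_of g - frag_of base_class) = 0" by (simp add: weight_diff)
    qed (rule rel)
    then have "weight w (act 0 (frag_of g) c) = weight w (act 0 (frag_of base_class) c)"
      by (simp only: act_diff_left weight_diff)
    also have "\<dots> = aug c * 1"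
      unfolding weight_w[OF insertI1 one]
    proof (rule weight_constant_on_keys)
      fix \<sigma> assume \<sigma>: "\<sigma> \<in> Poly_Mapping.keys c"
      have "joined ?E (class_concat X base_class k) (class_concat X base_class (retract_class \<sigma>))"
        by (rule E[OF one k keysD[OF \<sigma> insertI1]])
      then show "(if joined ?E k (class_concat X base_class (retract_class \<sigma>)) then 1 else 0) = (1::int)"
        using k D_G class_concat_const_left[of k X x0 x0] by auto
    qed
    also have "\<dots> \<noteq> 0" using c(2) by simp
    finally have "weight (\<lambda>\<sigma>. if joined ?E k (class_concat X g (retract_class \<sigma>)) then 1 else (0::int)) c \<noteq> 0"
      unfolding weight_w[OF insertI1 g] .
    then obtain \<sigma> where \<sigma>: "\<sigma> \<in> Poly_Mapping.keys c"
        "(if joined ?E k (class_concat X g (retract_class \<sigma>)) then 1 else (0::int)) \<noteq> 0"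
      by (rule weight_nonzero)
    then have "joined ?E k (class_concat X g (retract_class \<sigma>))" by (simp split: if_splits)
    then show ?thesis
      by (rule joined_trans[OF _ E[OF g keysD[OF \<sigma>(1) insertI1] k]])
  qed
  then have j: "joined {(h \<otimes>\<^bsub>G\<^esub> a, h \<otimes>\<^bsub>G\<^esub> b) | h a b. h \<in> carrier G \<and> 0 \<le> \<phi> h \<and> a \<in> D \<and> b \<in> D} k (g \<otimes>\<^bsub>G\<^esub> k)"
    if "g \<in> carrier G" "0 \<le> \<phi> g" for g
    using that by simp
  interpret G: group G by (rule group_pi1[OF x0])
  show "halfspace_connected G \<phi>"
  proof (rule G.halfspace_connected_if_joined[OF _ _ nz(2) _ D_G k j])
    show "finite D" unfolding D_def using K by simp
    show "u \<in> carrier G" using nz by simp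
    show "\<phi> (a \<otimes>\<^bsub>G\<^esub> b) = \<phi> a + \<phi> b" if "a \<in> carrier G" "b \<in> carrier G" for a b
      using that \<phi>_mult by simp
  qed
qed

theorem finite_1_type_iff:
  assumes "semilocally_1_connected X" "u \<in> path_classes X x0 x0" "\<phi> u \<noteq> 0"
  shows "finite_1_type R C \<longleftrightarrow> halfspace_connected G \<phi>"
  using finite_1_type_if_connected connected_if_finite_1_type assms by blast

end

section \<open>Unions of convex open sets\<close>

lemma continuous_map_id_into: "K \<subseteq> U \<Longrightarrow> continuous_map (top_of_set K) (top_of_set U) id"
  by auto

lemma path_class_convex_subset:
  fixes K U :: "'b::real_normed_vector set"
  assumes "K \<subseteq> U" "convex K" "continuous_on {0..1} p" "p ` {0..1} \<subseteq> K" "continuous_on {0..1} q" "q ` {0..1} \<subseteq> K"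
    "p 0 = q 0" "p 1 = q 1"
  shows "path_class (top_of_set U) p = path_class (top_of_set U) q"
  using path_class_convex[OF continuous_map_id_into[OF assms(1)] assms(2-8)] by simp

lemma semilocally_1_connected_convex_cover:
  fixes U :: "'b::real_normed_vector set"
  assumes "\<And>i. i \<in> I \<Longrightarrow> open (B i) \<and> convex (B i)" "U = (\<Union>i\<in>I. B i)"
  shows "semilocally_1_connected (top_of_set U)"
  unfolding semilocally_1_connected_def
proof
  fix y assume "y \<in> topspace (top_of_set U)"
  then obtain i where i: "i \<in> I" "y \<in> B i" using assms(2) by auto
  have sub: "B i \<subseteq> U" using i assms(2) by blast
  show "\<exists>V. openin (top_of_set U) V \<and> y \<in> V \<and>
     (\<forall>p q. pathin (subtopology (top_of_set U) V) p \<longrightarrow> pathin (subtopology (top_of_set U) V) q \<longrightarrow> p 0 = q 0 \<longrightarrow> p 1 = q 1 \<longrightarrow>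
        path_class (top_of_set U) p = path_class (top_of_set U) q)"
  proof (intro exI[of _ "B i"] conjI allI impI)
    show "openin (top_of_set U) (B i)"
      using assms(1)[OF i(1)] sub by (simp add: open_subset)
    fix p q :: "real \<Rightarrow> 'b"
    assume p: "pathin (subtopology (top_of_set U) (B i)) p" and q: "pathin (subtopology (top_of_set U) (B i)) q"
      and e: "p 0 = q 0" "p 1 = q 1"
    have cB: "convex (B i)" using assms(1)[OF i(1)] by blast
    show "path_class (top_of_set U) p = path_class (top_of_set U) q"
      by (rule path_class_convex_subset[OF sub cB _ _ _ _ e])
        (use p q in \<open>auto simp: pathin_def subtopology_subtopology\<close>)
  qed (rule i)
qed

text \<open>Paths in the preimage of \<open>U\<close> are mapped into \<open>U\<close> by the
  section \<open>s\<close>, identified there, and mapped back by \<open>q\<close>. This transfers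
  the property to the projectivization, whose points are lines rather than vectors.\<close>

lemma semilocally_1_connected_retract:
  assumes X: "semilocally_1_connected X" and s: "continuous_map Z X s" and q: "continuous_map X Z q"
    and qs: "\<And>z. z \<in> topspace Z \<Longrightarrow> q (s z) = z"
  shows "semilocally_1_connected Z"
  unfolding semilocally_1_connected_def
proof
  fix z assume z: "z \<in> topspace Z"
  then have "s z \<in> topspace X" using continuous_map_funspace[OF s] by blast
  then obtain U where U: "openin X U" "s z \<in> U"
    "\<And>p q. pathin (subtopology X U) p \<Longrightarrow> pathin (subtopology X U) q \<Longrightarrow> p 0 = q 0 \<Longrightarrow> p 1 = q 1 \<Longrightarrow>
        path_class X p = path_class X q"
    using X unfolding semilocally_1_connected_def by blast
  let ?V = "{z \<in> topspace Z. s z \<in> U}"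
  show "\<exists>V. openin Z V \<and> z \<in> V \<and>
     (\<forall>p q. pathin (subtopology Z V) p \<longrightarrow> pathin (subtopology Z V) q \<longrightarrow> p 0 = q 0 \<longrightarrow> p 1 = q 1 \<longrightarrow>
        path_class Z p = path_class Z q)"
  proof (intro exI[of _ ?V] conjI allI impI)
    show "openin Z ?V" by (rule openin_continuous_map_preimage[OF s U(1)])
    show "z \<in> ?V" using z U(2) by simp
    fix p p' assume p: "pathin (subtopology Z ?V) p" and p': "pathin (subtopology Z ?V) p'"
      and e: "p 0 = p' 0" "p 1 = p' 1"
    note pZ = pathin_subtopologyD[OF p] and pZ' = pathin_subtopologyD[OF p']
    have push: "path_class Z r = pi1_map Z q (path_class X (s \<circ> r))"
      if r: "pathin Z r" for r
    proof -
      have "path_class Z (q \<circ> (s \<circ> r)) = path_class Z r"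
      proof (rule path_class_cong[symmetric, OF r])
        fix t :: real assume "t \<in> {0..1}"
        then have "r t \<in> topspace Z" using r by (auto simp: pathin_def continuous_map_def Pi_def)
        then show "r t = (q \<circ> (s \<circ> r)) t" using qs by simp
      qed
      then show ?thesis using pi1_map_path_class[OF q pathin_compose[OF s r]] by simp
    qed
    have "path_class X (s \<circ> p) = path_class X (s \<circ> p')"
    proof (rule U(3))
      show "pathin (subtopology X U) (s \<circ> p)"
        by (rule pathin_subtopologyI[OF pathin_compose[OF s pZ(1)]]) (use pZ(2) in simp)
      show "pathin (subtopology X U) (s \<circ> p')"
        by (rule pathin_subtopologyI[OF pathin_compose[OF s pZ'(1)]]) (use pZ'(2) in simp)
    qed (use e in simp_all)
    then show "path_class Z p = path_class Z p'" using push pZ(1) pZ'(1) by metis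
  qed
qed

text \<open>The classes of a path's initial segments, closed up through the cover by connecting paths,
  change only by generators; so they stay in the subgroup along the whole path.\<close>

lemma pi1_finitely_generated_convex_cover:
  fixes U :: "'b::real_normed_vector set"
  assumes I: "finite I" and B: "\<And>i. i \<in> I \<Longrightarrow> open (B i) \<and> convex (B i)" and U: "U = (\<Union>i\<in>I. B i)"
    and x0: "x0 \<in> U"
  obtains S where "finite S" "S \<subseteq> carrier (pi1 (top_of_set U) x0)"
    "generate (pi1 (top_of_set U) x0) S = carrier (pi1 (top_of_set U) x0)"
proof -
  define X where "X = top_of_set U"
  have x0X: "x0 \<in> topspace X" using x0 by (simp add: X_def)
  interpret G: group "pi1 X x0" by (rule group_pi1[OF x0X])
  have sub: "B i \<subseteq> U" if "i \<in> I" for i using that U by blast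
  define seg where "seg y z = path_class X (linepath y z)" for y z
  have seg: "seg y z \<in> path_classes X y z" if "i \<in> I" "y \<in> B i" "z \<in> B i" for i y z
  proof -
    have "pathin X (id \<circ> linepath y z)"
      unfolding X_def by (rule pathin_linepath[OF continuous_map_id_into[OF sub[OF that(1)]]]) (use B that in auto)
    then show ?thesis unfolding seg_def by (intro path_classesI) (auto simp: linepath_def)
  qed
  have seg_concat: "class_concat X (path_class X p) (seg y z) = seg x z"
    if i: "i \<in> I" "z \<in> B i" and p: "continuous_on {0..1} p" "p ` {0..1} \<subseteq> B i" "p 0 = x" "p 1 = y" for i p x y z
  proof -
    have xy: "x \<in> B i" "y \<in> B i" using p by force+
    have cB: "convex (B i)" using B i by blast
    have "class_concat X (path_class X (id \<circ> p)) (path_class X (id \<circ> linepath y z)) = path_class X (id \<circ> linepath x z)"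
      unfolding X_def
      by (rule class_concat_convex[OF continuous_map_id_into[OF sub[OF i(1)]] cB p(1,2) continuous_on_linepath _ continuous_on_linepath])
        (use xy i cB p in \<open>simp_all only: linepath_image_01 closed_segment_subset linepath_0' linepath_1'\<close>)
    then show ?thesis by (simp add: seg_def)
  qed
  define zz where "zz i = (SOME z. z \<in> B i)" for i
  have zz: "zz i \<in> B i" if "y \<in> B i" for i y unfolding zz_def using that by (rule someI)
  \<comment> \<open>\<open>U\<close> may be disconnected, so only members of the cover that can be
    joined to the base point get a connecting path.\<close>
  define reach where "reach i \<longleftrightarrow> (\<exists>b. b \<in> path_classes X (zz i) x0)" for i
  define b where "b i = (SOME b. b \<in> path_classes X (zz i) x0)" for i
  have b: "b i \<in> path_classes X (zz i) x0" if "reach i" for i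
    using that unfolding reach_def b_def by (rule someI_ex)
  \<comment> \<open>The standard way back from a point \<open>y\<close> of \<open>B i\<close>:
    straight to \<open>zz i\<close>, then along \<open>b i\<close>. By convexity, these ways are
    compatible with every path inside \<open>B i\<close>.\<close>
  define \<kappa> where "\<kappa> i y = class_concat X (seg y (zz i)) (b i)" for i y
  have \<kappa>: "\<kappa> i y \<in> path_classes X y x0" if "i \<in> I" "y \<in> B i" "reach i" for i y
    unfolding \<kappa>_def by (rule path_classes_concat[OF seg[OF that(1,2) zz[OF that(2)]] b[OF that(3)]])
  have \<kappa>_move: "class_concat X (path_class X p) (\<kappa> i y) = \<kappa> i x"
    if i: "i \<in> I" "reach i" and p: "continuous_on {0..1} p" "p ` {0..1} \<subseteq> B i" "p 0 = x" "p 1 = y" for i p x y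
  proof -
    have xy: "x \<in> B i" "y \<in> B i" using p by force+
    have "pathin X (id \<circ> p)"
      unfolding X_def by (rule pathin_compose_convex[OF continuous_map_id_into[OF sub[OF i(1)]] p(1,2)])
    then have p': "path_class X p \<in> path_classes X x y" by (intro path_classesI) (use p in auto)
    show ?thesis
      unfolding \<kappa>_def class_concat_assoc[OF p' seg[OF i(1) xy(2) zz[OF xy(2)]] b[OF i(2)], symmetric]
        seg_concat[OF i(1) zz[OF xy(2)] p] ..
  qed
  have \<kappa>_seg: "class_concat X (seg x y) (\<kappa> i y) = \<kappa> i x"
    if i: "i \<in> I" "reach i" and xy: "x \<in> B i" "y \<in> B i" for i x y
  proof -
    have "linepath x y ` {0..1} \<subseteq> B i"
      unfolding linepath_image_01 by (rule closed_segment_subset) (use xy B i in auto)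
    then show ?thesis
      unfolding seg_def by (rule \<kappa>_move[OF i continuous_on_linepath _ linepath_0' linepath_1'])
  qed
  have reachI: "reach i" if "i \<in> I" "y \<in> B i" "a \<in> path_classes X x0 y" for i y a
    unfolding reach_def
    using path_classes_concat[OF seg[OF that(1) zz[OF that(2)] that(2)] path_classes_inv[OF that(3)]] by blast
  define ww where "ww i j = (SOME w. w \<in> B i \<and> w \<in> B j)" for i j
  have ww: "ww i j \<in> B i" "ww i j \<in> B j" if "y \<in> B i" "y \<in> B j" for i j y
  proof -
    have "ww i j \<in> B i \<and> ww i j \<in> B j" unfolding ww_def by (rule someI[of "\<lambda>w. w \<in> B i \<and> w \<in> B j" y]) (use that in simp)
    then show "ww i j \<in> B i" "ww i j \<in> B j" by auto
  qed
  define g where "g i j = class_concat X (inv_class X (\<kappa> i (ww i j))) (\<kappa> j (ww i j))" for i j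
  \<comment> \<open>The loops \<open>g i j\<close> compare the ways back through two overlapping
    members. The loops \<open>\<kappa> i x0\<close> are added because the way back from the base
    point itself need not be trivial.\<close>
  define S where "S = (\<lambda>(i,j). g i j) ` {(i,j) \<in> I \<times> I. B i \<inter> B j \<noteq> {} \<and> reach i \<and> reach j} \<union>
    (\<lambda>i. \<kappa> i x0) ` {i \<in> I. x0 \<in> B i}"
  have const: "path_class X (\<lambda>_. x0) \<in> path_classes X x0 x0" by (rule path_classes_const[OF x0X])
  have "finite {(i,j) \<in> I \<times> I. B i \<inter> B j \<noteq> {} \<and> reach i \<and> reach j}"
    by (rule finite_subset[OF _ finite_cartesian_product[OF I I]]) blast
  then have S_fin: "finite S" unfolding S_def using I by simp
  have S_sub: "S \<subseteq> carrier (pi1 X x0)"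
  proof
    fix x assume "x \<in> S"
    then consider (pair) i j y where "i \<in> I" "j \<in> I" "y \<in> B i" "y \<in> B j" "reach i" "reach j" "x = g i j"
      | (base) i where "i \<in> I" "x0 \<in> B i" "x = \<kappa> i x0"
      unfolding S_def by blast
    then show "x \<in> carrier (pi1 X x0)"
    proof cases
      case pair
      have "g i j \<in> path_classes X x0 x0"
        unfolding g_def using pair ww[OF pair(3,4)]
        by (intro path_classes_concat[of _ X x0 "ww i j"] path_classes_inv \<kappa>) auto
      then show ?thesis using pair by simp
    next
      case base
      then show ?thesis using \<kappa>[OF base(1,2) reachI[OF base(1,2) const]] by simp
    qed
  qed
  define H where "H = generate (pi1 X x0) S"
  have H: "subgroup H (pi1 X x0)" unfolding H_def by (rule G.generate_is_subgroup[OF S_sub])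
  have S_H: "x \<in> H" if "x \<in> S" for x unfolding H_def by (rule generate.incl[OF that])
  have H_mult: "class_concat X x y \<in> H" if "x \<in> H" "y \<in> H" for x y
    using subgroup.m_closed[OF H that] by simp
  \<comment> \<open>The comparison loop \<open>g i j\<close> is formed at one fixed point of the
    overlap. The segment from \<open>y\<close> to that point lies in both members, so the same loop
    compares the two ways back from \<open>y\<close>.\<close>
  have switch: "class_concat X a (\<kappa> j y) \<in> H"
    if ij: "i \<in> I" "j \<in> I" and y: "y \<in> B i" "y \<in> B j" and a: "a \<in> path_classes X x0 y"
      and aH: "class_concat X a (\<kappa> i y) \<in> H" for i j y a
  proof -
    have r: "reach i" "reach j" using reachI ij y a by blast+
    let ?w = "ww i j"
    have w: "?w \<in> B i" "?w \<in> B j" using ww[OF y] by auto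
    have cB: "convex (B i)" "convex (B j)" using B ij by auto
    have m: "\<kappa> i y = class_concat X (seg y ?w) (\<kappa> i ?w)" "\<kappa> j y = class_concat X (seg y ?w) (\<kappa> j ?w)"
      by (rule \<kappa>_seg[symmetric]; use ij r y w in simp)+
    note ks = seg[OF ij(1) y(1) w(1)] and ki = \<kappa>[OF ij(1) w(1) r(1)] and kj = \<kappa>[OF ij(2) w(2) r(2)]
    note gij = path_classes_concat[OF path_classes_inv[OF ki] kj]
    have "class_concat X (\<kappa> i y) (g i j) = class_concat X (seg y ?w) (class_concat X (\<kappa> i ?w) (g i j))"
      unfolding m(1) g_def by (rule class_concat_assoc[OF ks ki gij])
    also have "class_concat X (\<kappa> i ?w) (g i j) = class_concat X (class_concat X (\<kappa> i ?w) (inv_class X (\<kappa> i ?w))) (\<kappa> j ?w)"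
      unfolding g_def by (rule class_concat_assoc[OF ki path_classes_inv[OF ki] kj, symmetric])
    also have "\<dots> = \<kappa> j ?w" unfolding class_concat_inv_right[OF ki] by (rule class_concat_const_left[OF kj])
    finally have "class_concat X (\<kappa> i y) (g i j) = \<kappa> j y" unfolding m(2) .
    then have "class_concat X a (\<kappa> j y) = class_concat X (class_concat X a (\<kappa> i y)) (g i j)"
      using class_concat_assoc[OF a \<kappa>[OF ij(1) y(1) r(1)], of "g i j" x0] gij by (simp add: g_def)
    moreover have "g i j \<in> S" unfolding S_def using ij y r by auto
    ultimately show ?thesis using H_mult[OF aH S_H] by simp
  qed
  have all: "c \<in> H" if c: "c \<in> carrier (pi1 X x0)" for c
  proof -
    obtain p where p: "pathin X p" "p 0 = x0" "p 1 = x0" "c = path_class X p"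
      using c by (auto elim: path_classesE)
    define \<alpha> where "\<alpha> t = path_class X (p \<circ> linepath 0 t)" for t
    have \<alpha>: "\<alpha> t \<in> path_classes X x0 (p t)" if "t \<in> {0..1}" for t
      using subpath_class[OF p(1) _ that, of 0] p(2) by (simp add: \<alpha>_def)
    define Q where "Q t \<longleftrightarrow> (\<forall>i\<in>I. p t \<in> B i \<longrightarrow> class_concat X (\<alpha> t) (\<kappa> i (p t)) \<in> H)" for t
    have Q_iff: "Q t \<longleftrightarrow> class_concat X (\<alpha> t) (\<kappa> i (p t)) \<in> H" if "t \<in> {0..1}" "i \<in> I" "p t \<in> B i" for t i
      unfolding Q_def using switch[OF that(2) _ that(3) _ \<alpha>[OF that(1)]] that by blast
    have cp: "continuous_on {0..1} p" "p ` {0..1} \<subseteq> U" using p(1) by (auto simp: pathin_def X_def)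
    have loc: "\<exists>T. openin (top_of_set {0..1}) T \<and> t \<in> T \<and> (\<forall>x\<in>T. Q t \<longleftrightarrow> Q x)" if t: "t \<in> {0..1}" for t
    proof -
      have "p t \<in> U" using cp(2) t by blast
      then obtain i where i: "i \<in> I" "p t \<in> B i" using U by blast
      have "openin (top_of_set {0..1}) ({0..1} \<inter> p -` B i)"
        by (rule continuous_openin_preimage_gen[OF cp(1)]) (use B i in blast)
      then obtain e where e: "e > 0" "ball t e \<inter> {0..1} \<subseteq> {0..1} \<inter> p -` B i"
        using i t unfolding openin_contains_ball by blast
      let ?T = "ball t e \<inter> {0..1}"
      have cT: "convex ?T" by (intro convex_Int convex_ball convex_real_interval)
      have "Q t \<longleftrightarrow> Q x" if x: "x \<in> ?T" for x
      proof -
        have x01: "x \<in> {0..1}" using x by blast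
        have pxB: "p x \<in> B i" using x e(2) by blast
        have r: "reach i" by (rule reachI[OF i \<alpha>[OF t]])
        have seg: "linepath t x ` {0..1} \<subseteq> ?T"
          unfolding linepath_image_01 by (rule closed_segment_subset[OF _ x cT]) (use t e(1) in simp)
        have "class_concat X (path_class X (p \<circ> linepath t x)) (\<kappa> i (p x)) = \<kappa> i (p t)"
        proof (rule \<kappa>_move[OF i(1) r])
          show "continuous_on {0..1} (p \<circ> linepath t x)"
            by (rule continuous_on_compose[OF continuous_on_linepath continuous_on_subset[OF cp(1)]]) (use seg in blast)
          have "linepath t x ` {0..1} \<subseteq> p -` B i" using order.trans[OF seg e(2)] by blast
          then show "(p \<circ> linepath t x) ` {0..1} \<subseteq> B i" unfolding image_comp[symmetric] by blast
        qed (simp_all add: linepath_0' linepath_1')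
        moreover have "\<alpha> x = class_concat X (\<alpha> t) (path_class X (p \<circ> linepath t x))"
          unfolding \<alpha>_def by (rule subpath_class_concat[OF p(1) _ t x01, symmetric]) simp
        ultimately have "class_concat X (\<alpha> x) (\<kappa> i (p x)) = class_concat X (\<alpha> t) (\<kappa> i (p t))"
          using class_concat_assoc[OF \<alpha>[OF t] subpath_class[OF p(1) t x01] \<kappa>[OF i(1) pxB r]] by simp
        then show ?thesis using Q_iff[OF t i] Q_iff[OF x01 i(1) pxB] by simp
      qed
      moreover have "openin (top_of_set {0..1}) ?T" by (metis Int_commute open_ball openin_open_Int)
      ultimately show ?thesis using t e(1) by (intro exI[of _ ?T]) auto
    qed
    have "Q 0 \<longleftrightarrow> Q 1"
    proof (rule connected_equivalence_relation[of "{0..1::real}" 0 1 "\<lambda>s t. Q s \<longleftrightarrow> Q t"])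
      show "\<exists>T. openin (top_of_set {0..1}) T \<and> a \<in> T \<and> (\<forall>x\<in>T. Q a \<longleftrightarrow> Q x)" if "a \<in> {0..1}" for a
        by (rule loc[OF that])
    qed auto
    have \<alpha>0: "\<alpha> 0 = path_class X (\<lambda>_. x0)"
      unfolding \<alpha>_def subpath_class_self p(2) ..
    obtain i where i: "i \<in> I" "x0 \<in> B i" using x0 U by blast
    have ki: "\<kappa> i x0 \<in> path_classes X x0 x0" "\<kappa> i x0 \<in> S"
      using \<kappa>[OF i reachI[OF i const]] i by (auto simp: S_def)
    have "Q 0"
      using Q_iff[of 0 i] i p(2) \<alpha>0 class_concat_const_left[OF ki(1)] S_H[OF ki(2)] by simp
    then have "Q 1" using \<open>Q 0 \<longleftrightarrow> Q 1\<close> by simp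
    moreover have "\<alpha> 1 = c" unfolding \<alpha>_def p(4) by (simp add: linepath_def o_def)
    \<comment> \<open>At time 1 the path is closed up by \<open>\<kappa> i x0\<close>, itself a
      generator, which can now be cancelled.\<close>
    ultimately have h: "class_concat X c (\<kappa> i x0) \<in> H" using Q_iff[of 1 i] i p(3) by simp
    have cc: "c \<in> path_classes X x0 x0" using c by simp
    have inv: "inv\<^bsub>pi1 X x0\<^esub> (\<kappa> i x0) \<in> H" by (rule subgroup.m_inv_closed[OF H S_H[OF ki(2)]])
    have "c = (c \<otimes>\<^bsub>pi1 X x0\<^esub> \<kappa> i x0) \<otimes>\<^bsub>pi1 X x0\<^esub> inv\<^bsub>pi1 X x0\<^esub> (\<kappa> i x0)"
    proof -
      have kc: "\<kappa> i x0 \<in> carrier (pi1 X x0)" using ki(1) by simp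
      show ?thesis unfolding G.m_assoc[OF c kc G.inv_closed[OF kc]] G.r_inv[OF kc] G.r_one[OF c] ..
    qed
    then show ?thesis using subgroup.m_closed[OF H _ inv, of "class_concat X c (\<kappa> i x0)"] h by simp
  qed
  show thesis
  proof (rule that[of S])
    show "generate (pi1 (top_of_set U) x0) S = carrier (pi1 (top_of_set U) x0)"
      using all subgroup.subset[OF H] unfolding H_def X_def by blast
  qed (use S_fin S_sub in \<open>simp_all only: X_def\<close>)
qed

section \<open>Characters and rays\<close>

lemma H1_real_mult:
  assumes "\<phi> \<in> H1_real X x0" "a \<in> path_classes X x0 x0" "b \<in> path_classes X x0 x0"
  shows "\<phi> (class_concat X a b) = \<phi> a + \<phi> b"
  using hom_mult[of \<phi> "pi1 X x0" real_add_group a b] assms by (simp add: H1_real_def real_add_group_def)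

lemma H1_real_nonzero:
  assumes "\<phi> \<in> H1_real X x0 - {zero_char X x0}"
  obtains u where "u \<in> path_classes X x0 x0" "\<phi> u \<noteq> 0"
proof -
  have "\<phi> = zero_char X x0" if "\<And>u. u \<in> path_classes X x0 x0 \<Longrightarrow> \<phi> u = 0"
    by (rule extensionalityI[of _ "carrier (pi1 X x0)"])
      (use assms that in \<open>auto simp: H1_real_def zero_char_def\<close>)
  then show thesis using assms that by blast
qed

lemma H1_realI:
  assumes "\<phi> \<in> extensional (path_classes X x0 x0)"
    "\<And>a b. a \<in> path_classes X x0 x0 \<Longrightarrow> b \<in> path_classes X x0 x0 \<Longrightarrow> \<phi> (class_concat X a b) = \<phi> a + \<phi> b"
  shows "\<phi> \<in> H1_real X x0"
  using assms by (auto simp: H1_real_def real_add_group_def hom_def)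

lemma char_ray_eqD:
  assumes "char_ray X x0 \<phi> = char_ray X x0 \<psi>"
  obtains c where "0 < c" "\<And>g. g \<in> path_classes X x0 x0 \<Longrightarrow> \<phi> g = c * \<psi> g"
proof -
  have "(\<lambda>g\<in>carrier (pi1 X x0). 1 * \<phi> g) \<in> char_ray X x0 \<phi>"
    unfolding char_ray_def by (intro CollectI exI[of _ 1]) simp
  then have "\<exists>c. (\<lambda>g\<in>carrier (pi1 X x0). 1 * \<phi> g) = (\<lambda>g\<in>carrier (pi1 X x0). c * \<psi> g) \<and> 0 < c"
    unfolding assms unfolding char_ray_def by (rule CollectD)
  then obtain c where c: "0 < c" "(\<lambda>g\<in>carrier (pi1 X x0). 1 * \<phi> g) = (\<lambda>g\<in>carrier (pi1 X x0). c * \<psi> g)"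
    by (elim exE conjE)
  have "\<phi> g = c * \<psi> g" if "g \<in> path_classes X x0 x0" for g
    using fun_cong[OF c(2), of g] that by simp
  then show thesis using that c(1) by blast
qed

lemma nonneg_submonoid_ray:
  assumes "char_ray X x0 \<phi> = char_ray X x0 \<psi>"
  shows "nonneg_submonoid X x0 \<phi> = nonneg_submonoid X x0 \<psi>"
proof -
  obtain c where c: "0 < c" "\<And>g. g \<in> path_classes X x0 x0 \<Longrightarrow> \<phi> g = c * \<psi> g"
    using char_ray_eqD[OF assms] by blast
  have "{g \<in> carrier (pi1 X x0). 0 \<le> \<phi> g} = {g \<in> carrier (pi1 X x0). 0 \<le> \<psi> g}"
    using c by (auto simp: zero_le_mult_iff)
  then show ?thesis unfolding nonneg_submonoid_def by simp
qed

text \<open>\<open>Sigma1\<close> asks for a witness among the representatives of a ray. They all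
  have the same submonoid, so the given one can be tested.\<close>

lemma Sigma1_iff:
  assumes X: "semilocally_1_connected X" and x0: "x0 \<in> topspace X"
    and \<phi>: "\<phi> \<in> H1_real X x0 - {zero_char X x0}"
  shows "char_ray X x0 \<phi> \<in> Sigma1 X x0 \<longleftrightarrow> halfspace_connected (pi1 X x0) \<phi>"
proof -
  obtain u where u: "u \<in> path_classes X x0 x0" "\<phi> u \<noteq> 0" using H1_real_nonzero[OF \<phi>] by blast
  interpret pointed_character X x0 \<phi>
    by unfold_locales (use x0 \<phi> in \<open>auto simp: H1_real_def\<close>)
  have "char_ray X x0 \<phi> \<in> Sigma1 X x0 \<longleftrightarrow> finite_1_type R C"
  proof
    assume "char_ray X x0 \<phi> \<in> Sigma1 X x0"
    then obtain \<psi> where \<psi>: "char_ray X x0 \<phi> = char_ray X x0 \<psi>"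
        "finite_1_type (monoid_ring (nonneg_submonoid X x0 \<psi>)) (ucover_chains X x0)"
      unfolding Sigma1_def by blast
    then show "finite_1_type R C" using nonneg_submonoid_ray[OF \<psi>(1)] by simp
  qed (use \<phi> in \<open>auto simp: Sigma1_def\<close>)
  also have "\<dots> \<longleftrightarrow> halfspace_connected (pi1 X x0) \<phi>" by (rule finite_1_type_iff[OF X u])
  finally show ?thesis .
qed

lemma Sigma1_subset: "Sigma1 X x0 \<subseteq> char_sphere X x0"
  by (auto simp: Sigma1_def char_sphere_def)

lemma pullback_char_H1_real:
  assumes f: "continuous_map X Z f" and \<psi>: "\<psi> \<in> H1_real Z (f x0)"
  shows "pullback_char X x0 Z f \<psi> \<in> H1_real X x0"
proof (rule H1_realI)
  fix a b assume ab: "a \<in> path_classes X x0 x0" "b \<in> path_classes X x0 x0"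
  show "pullback_char X x0 Z f \<psi> (class_concat X a b) = pullback_char X x0 Z f \<psi> a + pullback_char X x0 Z f \<psi> b"
    using ab path_classes_concat[OF ab] pi1_map_concat[OF f ab]
      H1_real_mult[OF \<psi> pi1_map_path_classes[OF f ab(1)] pi1_map_path_classes[OF f ab(2)]]
    by (simp add: pullback_char_def)
qed (simp add: pullback_char_def)

lemma pullback_ray_char_ray:
  assumes f: "continuous_map X Z f"
  shows "pullback_ray X x0 Z f (char_ray Z (f x0) \<psi>) = char_ray X x0 (pullback_char X x0 Z f \<psi>)"
proof -
  have "pullback_char X x0 Z f (\<lambda>g\<in>carrier (pi1 Z (f x0)). c * \<psi> g) =
     (\<lambda>g\<in>carrier (pi1 X x0). c * pullback_char X x0 Z f \<psi> g)" for c
    unfolding pullback_char_def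
    by (rule restrict_ext) (use pi1_map_path_classes[OF f] in simp)
  then show ?thesis
    unfolding pullback_ray_def char_ray_def by (auto simp: image_iff) metis
qed

section \<open>Complements of central arrangements\<close>

definition complex_functional :: "(complex ^ 'n \<Rightarrow> complex) \<Rightarrow> bool" where
  "complex_functional f \<longleftrightarrow> (\<forall>x y. f (x + y) = f x + f y) \<and> (\<forall>c x. f (c *s x) = c * f x)"

text \<open>By dimension, a vector \<open>w\<close> outside \<open>H\<close> spans a complement; the
  functional is the coordinate along \<open>w\<close>.\<close>

lemma hyperplane_functional:
  fixes H :: "(complex ^ 'n) set"
  assumes H: "vec.subspace H" "Suc (vec.dim H) = CARD('n)"
  obtains f where "complex_functional f" "H = {v. f v = 0}"
proof -
  have spanH: "vec.span H = H" using H(1) by (simp add: vec.span_eq_iff)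
  have "H \<noteq> UNIV" using H(2) vec_dim_card[where 'n = 'n and 'a = complex] by auto
  then obtain w where w: "w \<notin> H" by blast
  have "vec.dim (insert w H) = CARD('n)" using w H(2) by (simp add: vec.dim_insert spanH)
  then have full: "vec.span (insert w H) = UNIV"
    using vec.dim_eq_full[of "insert w H"] by (simp add: vec.dimension_def card_cart_basis)
  have ex: "\<exists>k. v - k *s w \<in> H" for v
    using full vec.span_breakdown_eq[of v w H] spanH by auto
  have uniq: "k = k'" if "v - k *s w \<in> H" "v - k' *s w \<in> H" for v k k'
  proof (rule ccontr)
    assume "k \<noteq> k'"
    have "(v - k' *s w) - (v - k *s w) \<in> H" by (rule vec.subspace_diff[OF H(1) that(2,1)])
    also have "(v - k' *s w) - (v - k *s w) = (k - k') *s w" by (simp add: vector_sub_rdistrib)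
    finally have "inverse (k - k') *s ((k - k') *s w) \<in> H" by (rule vec.subspace_scale[OF H(1)])
    moreover have "inverse (k - k') *s ((k - k') *s w) = w"
      using \<open>k \<noteq> k'\<close> by (simp only: vector_smult_assoc left_inverse right_minus_eq vector_smult_lid not_False_eq_True)
    ultimately show False using w by simp
  qed
  define f where "f v = (SOME k. v - k *s w \<in> H)" for v
  have f: "v - f v *s w \<in> H" for v unfolding f_def using ex by (rule someI_ex)
  have fI: "f v = k" if "v - k *s w \<in> H" for v k using uniq[OF f that] .
  have "f (x + y) = f x + f y" for x y
  proof (rule fI)
    have "(x - f x *s w) + (y - f y *s w) \<in> H" by (rule vec.subspace_add[OF H(1) f f])
    then show "x + y - (f x + f y) *s w \<in> H" by (simp add: vector_sadd_rdistrib algebra_simps)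
  qed
  moreover have "f (c *s x) = c * f x" for c x
  proof (rule fI)
    have "c *s (x - f x *s w) \<in> H" by (rule vec.subspace_scale[OF H(1) f])
    then show "c *s x - (c * f x) *s w \<in> H" by (simp add: vector_ssub_ldistrib vector_smult_assoc)
  qed
  ultimately have "complex_functional f" by (simp add: complex_functional_def)
  moreover have "H = {v. f v = 0}"
  proof (rule equalityI; rule subsetI)
    show "v \<in> {v. f v = 0}" if "v \<in> H" for v using fI[of v 0] that by simp
    show "v \<in> H" if "v \<in> {v. f v = 0}" for v using f[of v] that by simp
  qed
  ultimately show thesis by (rule that)
qed

lemma scaleR_eq_smult: "r *\<^sub>R x = complex_of_real r *s x" for x :: "complex ^ 'n"
  by (simp only: vec_eq_iff vector_scaleR_component vector_smult_component) (simp add: scaleR_conv_of_real)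

text \<open>Complex functionals are real-linear, and linear maps on a finite-dimensional real space
  are bounded.\<close>

lemma continuous_on_complex_functional:
  fixes f :: "complex ^ 'n \<Rightarrow> complex"
  assumes "complex_functional f"
  shows "continuous_on S f"
proof -
  have "linear f"
  proof (rule linearI)
    show "f (r *\<^sub>R x) = r *\<^sub>R f x" for r x
      using assms unfolding scaleR_eq_smult complex_functional_def by (simp add: scaleR_conv_of_real)
  qed (use assms in \<open>simp add: complex_functional_def\<close>)
  then show ?thesis by (simp add: linear_continuous_on linear_conv_bounded_linear)
qed

lemma continuous_on_vector_smult:
  fixes f :: "'a::topological_space \<Rightarrow> complex" and g :: "'a \<Rightarrow> complex ^ 'n"
  assumes "continuous_on S f" "continuous_on S g"
  shows "continuous_on S (\<lambda>x. f x *s g x)"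
  unfolding vector_scalar_mult_def
  by (intro continuous_on_vec_lambda continuous_on_mult assms continuous_on_component)

lemma proj_pt_scale: "c \<noteq> 0 \<Longrightarrow> proj_pt (c *s v) = proj_pt v"
  unfolding proj_pt_def vec.span_singleton
proof (rule equalityI; rule subsetI)
  assume c: "c \<noteq> 0"
  fix x
  show "x \<in> range (\<lambda>k. k *s v)" if "x \<in> range (\<lambda>k. k *s (c *s v))"
    using that by (auto simp: vector_smult_assoc)
  show "x \<in> range (\<lambda>k. k *s (c *s v))" if x: "x \<in> range (\<lambda>k. k *s v)"
  proof -
    obtain k where "x = k *s v" using x by blast
    then have "x = (k / c) *s (c *s v)" using c by (simp add: vector_smult_assoc)
    then show ?thesis by blast
  qed
qed

lemma proj_pt_eqD: "proj_pt v = proj_pt w \<Longrightarrow> \<exists>c. v = c *s w"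
  using vec.span_base[of v "{v}"] unfolding proj_pt_def vec.span_singleton by auto

lemma topspace_proj_space: "topspace proj_space = proj_pt ` (UNIV - {0 :: complex ^ 'n})"
proof
  show "topspace proj_space \<subseteq> proj_pt ` (UNIV - {0 :: complex ^ 'n})"
    using openin_topspace[of "proj_space :: (complex ^ 'n) set topology"] unfolding openin_proj_space by blast
  have "{v :: complex ^ 'n. v \<noteq> 0 \<and> proj_pt v \<in> proj_pt ` (UNIV - {0})} = - {0}" by auto
  then have "openin proj_space (proj_pt ` (UNIV - {0 :: complex ^ 'n}))"
    unfolding openin_proj_space by (simp add: open_Compl)
  then show "proj_pt ` (UNIV - {0 :: complex ^ 'n}) \<subseteq> topspace proj_space" by (rule openin_subset)
qed

text \<open>A nonempty arrangement with chosen defining functionals. The distinguished hyperplane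
  \<open>H0\<close> serves to normalize vectors, which trivializes the bundle over the
  projectivization.\<close>

locale pointed_arrangement =
  fixes A :: "(complex ^ 'n) set set" and lf :: "(complex ^ 'n) set \<Rightarrow> complex ^ 'n \<Rightarrow> complex"
    and H0 :: "(complex ^ 'n) set" and x0 :: "complex ^ 'n"
  assumes finA: "finite A" and functional: "\<And>H. H \<in> A \<Longrightarrow> complex_functional (lf H)"
    and kernel: "\<And>H. H \<in> A \<Longrightarrow> H = {v. lf H v = 0}" and H0: "H0 \<in> A" and x0: "x0 \<notin> \<Union>A"
begin

abbreviation "X \<equiv> arr_compl A"
abbreviation "PX \<equiv> proj_arr_compl A"

definition "U = {v. \<forall>H\<in>A. lf H v \<noteq> 0}"

lemma X_eq: "X = top_of_set U"
proof -
  have "UNIV - \<Union>A = U" unfolding U_def using kernel by blast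
  then show ?thesis by (simp add: arr_compl_def)
qed

lemma topspace_X: "topspace X = U"
  by (simp add: X_eq)

lemma x0_U: "x0 \<in> U"
  using x0 kernel unfolding U_def by blast

lemma lf_add: "H \<in> A \<Longrightarrow> lf H (x + y) = lf H x + lf H y"
  and lf_scale: "H \<in> A \<Longrightarrow> lf H (c *s x) = c * lf H x"
  using functional unfolding complex_functional_def by blast+

lemma lf_scaleR: "H \<in> A \<Longrightarrow> lf H (r *\<^sub>R x) = complex_of_real r * lf H x"
  unfolding scaleR_eq_smult by (rule lf_scale)

lemma U_scale: "v \<in> U \<Longrightarrow> c \<noteq> 0 \<Longrightarrow> c *s v \<in> U"
  by (simp add: U_def lf_scale)

lemma U_nonzero: "v \<in> U \<Longrightarrow> v \<noteq> 0"
  using H0 lf_scale[of H0 0 v] by (auto simp: U_def)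

section \<open>The complement as a finite union of convex cells\<close>

definition "cells = PiE A (\<lambda>_. {1, -1, \<i>, -\<i>})"
definition "cell \<sigma> = {v. \<forall>H\<in>A. 0 < Re (\<sigma> H * lf H v)}"

lemma finite_cells: "finite cells"
  unfolding cells_def by (rule finite_PiE[OF finA]) simp

lemma open_convex_cell: "open (cell \<sigma>) \<and> convex (cell \<sigma>)"
proof
  have "cell \<sigma> = (\<Inter>H\<in>A. {v. 0 < Re (\<sigma> H * lf H v)})" by (auto simp: cell_def)
  then show "open (cell \<sigma>)"
    using finA functional
    by (simp only:) (intro open_INT ballI open_Collect_less continuous_on_Re continuous_on_mult continuous_on_const
        continuous_on_complex_functional)
  show "convex (cell \<sigma>)"
  proof (rule convexI)
    fix x y and a b :: real
    assume xy: "x \<in> cell \<sigma>" "y \<in> cell \<sigma>" and ab: "0 \<le> a" "0 \<le> b" "a + b = 1"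
    have "0 < Re (\<sigma> H * lf H (a *\<^sub>R x + b *\<^sub>R y))" if "H \<in> A" for H
    proof -
      have "Re (\<sigma> H * lf H (a *\<^sub>R x + b *\<^sub>R y)) = a * Re (\<sigma> H * lf H x) + b * Re (\<sigma> H * lf H y)"
        using that by (simp add: lf_add lf_scaleR algebra_simps)
      moreover have "0 < Re (\<sigma> H * lf H x)" "0 < Re (\<sigma> H * lf H y)"
        using xy that by (auto simp: cell_def)
      ultimately show ?thesis using ab
        by (cases "a = 0") (auto intro: add_pos_nonneg)
    qed
    then show "a *\<^sub>R x + b *\<^sub>R y \<in> cell \<sigma>" by (simp add: cell_def)
  qed
qed

lemma U_cells: "U = (\<Union>\<sigma>\<in>cells. cell \<sigma>)"
proof (rule equalityI; rule subsetI)
  fix v assume v: "v \<in> U"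
  \<comment> \<open>A nonzero number is moved into the right half-plane by a sign if its real part
    is nonzero; otherwise it is imaginary, and a quarter turn makes it positive.\<close>
  define s where "s z = (if 0 < Re z then 1 else if Re z < 0 then -1 else if 0 < Im z then -\<i> else \<i>)" for z
  have s: "0 < Re (s z * z)" if "z \<noteq> 0" for z
    using that by (auto simp: s_def complex_eq_iff)
  define \<sigma> where "\<sigma> = (\<lambda>H\<in>A. s (lf H v))"
  have "\<sigma> \<in> cells" by (auto simp: \<sigma>_def cells_def s_def)
  moreover have "v \<in> cell \<sigma>" using v s by (auto simp: \<sigma>_def cell_def U_def)
  ultimately show "v \<in> (\<Union>\<sigma>\<in>cells. cell \<sigma>)" by blast
next
  fix v assume "v \<in> (\<Union>\<sigma>\<in>cells. cell \<sigma>)"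
  then show "v \<in> U" by (force simp: cell_def U_def)
qed

lemma open_U: "open U"
  unfolding U_cells using open_convex_cell by blast

lemma semilocally_1_connected_X: "semilocally_1_connected X"
  unfolding X_eq by (rule semilocally_1_connected_convex_cover[OF open_convex_cell U_cells])

lemma pi1_X_finitely_generated:
  obtains S where "finite S" "S \<subseteq> carrier (pi1 X x0)" "generate (pi1 X x0) S = carrier (pi1 X x0)"
  unfolding X_eq by (rule pi1_finitely_generated_convex_cover[OF finite_cells open_convex_cell U_cells x0_U])

section \<open>The projection to projective space and its section\<close>

lemma U_if_proj_pt_eq:
  assumes "v \<in> U" "w \<noteq> 0" "proj_pt w = proj_pt v"
  obtains c where "c \<noteq> 0" "w = c *s v" "w \<in> U"
proof -
  obtain c where c: "w = c *s v" using proj_pt_eqD[OF assms(3)] by blast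
  moreover have "c \<noteq> 0" using c assms(2) by auto
  ultimately show thesis using that U_scale[OF assms(1)] by blast
qed

lemma topspace_PX: "topspace PX = proj_pt ` U"
proof (rule equalityI; rule subsetI)
  fix L assume "L \<in> topspace PX"
  then obtain v where v: "v \<noteq> 0" "L = proj_pt v" "L \<notin> (\<Union>H\<in>A. proj_of_subspace H)"
    unfolding proj_arr_compl_def topspace_subtopology topspace_proj_space by blast
  have "v \<notin> H" if "H \<in> A" for H
    using v that unfolding proj_of_subspace_def by blast
  then have "v \<in> U" using kernel unfolding U_def by blast
  then show "L \<in> proj_pt ` U" using v by blast
next
  fix L assume "L \<in> proj_pt ` U"
  then obtain v where v: "v \<in> U" "L = proj_pt v" by blast
  have "L \<notin> proj_of_subspace H" if H: "H \<in> A" for H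
  proof
    assume "L \<in> proj_of_subspace H"
    then obtain w where w: "w \<in> H" "w \<noteq> 0" "proj_pt w = proj_pt v"
      unfolding proj_of_subspace_def v(2) by force
    then have "w \<in> U" using U_if_proj_pt_eq[OF v(1)] by blast
    then show False using w(1) kernel[OF H] H unfolding U_def by blast
  qed
  then show "L \<in> topspace PX"
    unfolding proj_arr_compl_def topspace_subtopology topspace_proj_space using v U_nonzero by blast
qed

lemma continuous_map_proj_pt: "continuous_map X PX proj_pt"
proof -
  have "continuous_map X proj_space proj_pt"
    unfolding continuous_map_def
  proof (intro conjI allI impI)
    show "proj_pt \<in> topspace X \<rightarrow> topspace proj_space"
      unfolding topspace_X topspace_proj_space using U_nonzero by blast
    fix V :: "(complex ^ 'n) set set" assume "openin proj_space V"
    then have "open {v. v \<noteq> 0 \<and> proj_pt v \<in> V}" unfolding openin_proj_space by blast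
    moreover have "{v \<in> topspace X. proj_pt v \<in> V} = U \<inter> {v. v \<noteq> 0 \<and> proj_pt v \<in> V}"
      unfolding topspace_X using U_nonzero by blast
    ultimately show "openin X {v \<in> topspace X. proj_pt v \<in> V}"
      unfolding X_eq by (simp add: openin_open_Int)
  qed
  moreover have "proj_pt ` topspace X \<subseteq> topspace PX" unfolding topspace_X topspace_PX by blast
  ultimately show ?thesis
    unfolding proj_arr_compl_def by (auto simp: continuous_map_in_subtopology)
qed

text \<open>A line off \<open>H0\<close> meets the affine hyperplane on which \<open>lf H0\<close>
  has the value \<open>lf H0 x0\<close> in exactly one point. This normalization sends the line
  through \<open>x0\<close> back to \<open>x0\<close>, so base points are respected.\<close>

definition sect :: "(complex ^ 'n) set \<Rightarrow> complex ^ 'n" where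
  "sect L = (let v = (SOME v. v \<noteq> 0 \<and> proj_pt v = L) in (lf H0 x0 / lf H0 v) *s v)"

lemma sect_proj_pt:
  assumes v: "v \<in> U"
  shows "sect (proj_pt v) = (lf H0 x0 / lf H0 v) *s v"
proof -
  define w where "w = (SOME w. w \<noteq> 0 \<and> proj_pt w = proj_pt v)"
  have "w \<noteq> 0 \<and> proj_pt w = proj_pt v"
    unfolding w_def by (rule someI[of "\<lambda>w. w \<noteq> 0 \<and> proj_pt w = proj_pt v" v]) (use U_nonzero[OF v] in simp)
  then obtain c where "c \<noteq> 0" "w = c *s v" using U_if_proj_pt_eq[OF v] by blast
  then show ?thesis
    unfolding sect_def Let_def w_def[symmetric] using H0 by (simp add: lf_scale vector_smult_assoc)
qed

lemma sect_factor: "v \<in> U \<Longrightarrow> lf H0 x0 / lf H0 v \<noteq> 0"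
  using x0_U H0 by (simp add: U_def)

lemma proj_pt_sect:
  assumes "L \<in> topspace PX"
  shows "proj_pt (sect L) = L"
proof -
  obtain v where v: "v \<in> U" "L = proj_pt v" using assms unfolding topspace_PX by blast
  show ?thesis unfolding v(2) sect_proj_pt[OF v(1)] by (rule proj_pt_scale[OF sect_factor[OF v(1)]])
qed

lemma sect_base: "sect (proj_pt x0) = x0"
  using sect_proj_pt[OF x0_U] x0_U H0 by (simp add: U_def)

lemma continuous_map_sect: "continuous_map PX X sect"
  unfolding continuous_map_def
proof (intro conjI allI impI)
  show "sect \<in> topspace PX \<rightarrow> topspace X"
  proof
    fix L assume "L \<in> topspace PX"
    then obtain v where v: "v \<in> U" "L = proj_pt v" unfolding topspace_PX by blast
    show "sect L \<in> topspace X"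
      unfolding topspace_X v(2) sect_proj_pt[OF v(1)] by (rule U_scale[OF v(1) sect_factor[OF v(1)]])
  qed
  fix W assume "openin X W"
  then have W: "open W" "W \<subseteq> U" unfolding X_eq using open_U by (auto simp: openin_open_eq)
  define Z where "Z = U \<inter> (\<lambda>v. (lf H0 x0 / lf H0 v) *s v) -` W"
  have "continuous_on U (\<lambda>v. (lf H0 x0 / lf H0 v) *s v)"
    by (intro continuous_on_vector_smult continuous_on_divide continuous_on_const continuous_on_id
        continuous_on_complex_functional functional[OF H0]) (use H0 in \<open>auto simp: U_def\<close>)
  then have Z: "open Z" unfolding Z_def by (rule continuous_open_preimage[OF _ open_U W(1)])
  \<comment> \<open>Rescaling a vector does not change its normalization, so \<open>Z\<close> is
    saturated, and its image is open in the quotient topology.\<close>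
  have "{v. v \<noteq> 0 \<and> proj_pt v \<in> proj_pt ` Z} = Z"
  proof (rule equalityI; rule subsetI)
    fix v assume "v \<in> {v. v \<noteq> 0 \<and> proj_pt v \<in> proj_pt ` Z}"
    then obtain z where z: "z \<in> Z" "v \<noteq> 0" "proj_pt v = proj_pt z" by blast
    have zU: "z \<in> U" using z(1) by (simp add: Z_def)
    obtain c where "c \<noteq> 0" "v = c *s z" "v \<in> U" using U_if_proj_pt_eq[OF zU z(2,3)] by blast
    moreover from this have "sect (proj_pt v) = (lf H0 x0 / lf H0 v) *s v" by (intro sect_proj_pt)
    ultimately show "v \<in> Z" using z sect_proj_pt[OF zU] by (simp add: Z_def)
  next
    fix v assume "v \<in> Z"
    then show "v \<in> {v. v \<noteq> 0 \<and> proj_pt v \<in> proj_pt ` Z}" using U_nonzero by (auto simp: Z_def)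
  qed
  then have V: "openin proj_space (proj_pt ` Z)"
    unfolding openin_proj_space using Z U_nonzero by (auto simp: Z_def)
  have "{L \<in> topspace PX. sect L \<in> W} = proj_pt ` Z"
  proof (rule equalityI; rule subsetI)
    fix L assume "L \<in> {L \<in> topspace PX. sect L \<in> W}"
    then obtain v where v: "v \<in> U" "L = proj_pt v" "sect L \<in> W" unfolding topspace_PX by blast
    have "v \<in> Z" using v(1,3) sect_proj_pt[OF v(1)] by (simp add: Z_def v(2))
    then show "L \<in> proj_pt ` Z" using v(2) by blast
  next
    fix L assume "L \<in> proj_pt ` Z"
    then obtain v where v: "v \<in> Z" "L = proj_pt v" by blast
    have "v \<in> U" using v(1) by (simp add: Z_def)
    then show "L \<in> {L \<in> topspace PX. sect L \<in> W}"
      using v(1) sect_proj_pt[OF \<open>v \<in> U\<close>] by (simp add: Z_def v(2) topspace_PX)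
  qed
  also have "\<dots> = proj_pt ` Z \<inter> topspace PX" unfolding topspace_PX Z_def by blast
  finally have "{L \<in> topspace PX. sect L \<in> W} = proj_pt ` Z \<inter> (topspace proj_space - (\<Union>H\<in>A. proj_of_subspace H))"
    unfolding proj_arr_compl_def topspace_subtopology using openin_subset[OF V] by blast
  then show "openin PX {L \<in> topspace PX. sect L \<in> W}"
    unfolding proj_arr_compl_def[of A] openin_subtopology using V by blast
qed

lemma semilocally_1_connected_PX: "semilocally_1_connected PX"
  by (rule semilocally_1_connected_retract[OF semilocally_1_connected_X continuous_map_sect
        continuous_map_proj_pt proj_pt_sect])

abbreviation "\<rho> \<equiv> pi1_map PX proj_pt"
abbreviation "\<tau> \<equiv> pi1_map X sect"
abbreviation "G \<equiv> pi1 X x0"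

lemma x0_X: "x0 \<in> topspace X"
  by (simp add: topspace_X x0_U)

lemma y0_PX: "proj_pt x0 \<in> topspace PX"
  by (simp add: topspace_PX x0_U)

lemma \<rho>_closed: "a \<in> path_classes X x0 x0 \<Longrightarrow> \<rho> a \<in> path_classes PX (proj_pt x0) (proj_pt x0)"
  by (rule pi1_map_path_classes[OF continuous_map_proj_pt])

lemma \<tau>_closed: "b \<in> path_classes PX (proj_pt x0) (proj_pt x0) \<Longrightarrow> \<tau> b \<in> path_classes X x0 x0"
  using pi1_map_path_classes[OF continuous_map_sect] by (metis sect_base)

lemma \<rho>_\<tau>:
  assumes "b \<in> path_classes PX (proj_pt x0) (proj_pt x0)"
  shows "\<rho> (\<tau> b) = b"
proof -
  obtain p where p: "pathin PX p" "b = path_class PX p" using assms by (elim path_classesE)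
  have "\<rho> (\<tau> b) = path_class PX (proj_pt \<circ> (sect \<circ> p))"
    unfolding p(2) pi1_map_path_class[OF continuous_map_sect p(1)]
    by (rule pi1_map_path_class[OF continuous_map_proj_pt pathin_compose[OF continuous_map_sect p(1)]])
  also have "\<dots> = path_class PX p"
  proof (rule path_class_cong[OF p(1), symmetric])
    fix t :: real assume "t \<in> {0..1}"
    then have "p t \<in> topspace PX" using p(1) by (auto simp: pathin_def continuous_map_def Pi_def)
    then show "p t = (proj_pt \<circ> (sect \<circ> p)) t" using proj_pt_sect by simp
  qed
  finally show ?thesis using p(2) by simp
qed

subsection \<open>The central loop\<close>

text \<open>The orbit of the base point under nonzero scalars, parametrized by the exponential. The
  parameter space is the whole plane, hence convex, so a class of rotations is determined by the
  ends of its path of parameters.\<close>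

definition "rot z = exp z *s x0" for z :: complex
definition "period = 2 * complex_of_real pi * \<i>"
definition "rot_class w z = path_class X (rot \<circ> linepath w z)"
definition "cloop = rot_class 0 period"

lemma rot_U: "rot z \<in> U"
  unfolding rot_def by (rule U_scale[OF x0_U]) simp

lemma continuous_map_rot: "continuous_map (top_of_set UNIV) X rot"
proof -
  have "continuous_on UNIV rot"
    unfolding rot_def by (intro continuous_on_vector_smult continuous_on_exp continuous_on_id continuous_on_const)
  then show ?thesis unfolding X_eq using rot_U by (auto simp: continuous_map_in_subtopology)
qed

lemma exp_period: "exp (z + of_int k * period) = exp z"
  using exp_integer_2pi[of "of_int k"] by (simp add: period_def exp_add mult_ac)

lemma rot_period: "rot (z + of_int k * period) = rot z"
  unfolding rot_def exp_period ..

lemma rot_0: "rot 0 = x0" "rot (of_int k * period) = x0"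
  using rot_period[of 0 k] by (simp_all add: rot_def)

lemma rot_class: "rot_class w z \<in> path_classes X (rot w) (rot z)"
  unfolding rot_class_def
  by (rule path_classesI[OF pathin_linepath[OF continuous_map_rot]]) (simp_all add: linepath_0' linepath_1')

lemma rot_class_concat: "class_concat X (rot_class w z) (rot_class z u) = rot_class w u"
  unfolding rot_class_def
  by (rule class_concat_convex[OF continuous_map_rot convex_UNIV continuous_on_linepath _
        continuous_on_linepath _ continuous_on_linepath]) (simp_all add: linepath_0' linepath_1')

lemma rot_class_shift: "rot_class (of_int k * period) (of_int k * period + period) = cloop"
proof -
  have "linepath (of_int k * period) (of_int k * period + period) t = linepath 0 period t + of_int k * period" for t
    by (simp add: linepath_def algebra_simps flip: scaleR_add_left)
  then show ?thesis
    unfolding cloop_def rot_class_def by (simp add: o_def rot_period)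
qed

lemma cloop: "cloop \<in> path_classes X x0 x0"
  using rot_class[of 0 period] rot_0(2)[of 1] by (simp add: cloop_def rot_0)

text \<open>Concatenated full turns are the image of one long segment. In this form a power is
  recognized from a path of parameters that leads from 0 to a multiple of the period.\<close>

lemma cloop_pow: "cloop [^]\<^bsub>G\<^esub> (k::int) = rot_class 0 (of_int k * period)"
proof -
  interpret G: group G by (rule group_pi1[OF x0_X])
  have c: "cloop \<in> carrier G" using cloop by simp
  have rc: "rot_class 0 (of_int k * period) \<in> carrier G" for k
    using rot_class[of 0 "of_int k * period"] by (simp add: rot_0)
  have step: "rot_class 0 (of_int (k + 1) * period) = rot_class 0 (of_int k * period) \<otimes>\<^bsub>G\<^esub> cloop" for k
    using rot_class_concat[of 0 "of_int k * period" "of_int k * period + period"] rot_class_shift[of k]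
    by (simp add: distrib_right)
  show ?thesis
  proof (induction k rule: int_induct[where k = 0])
    case base
    show ?case using subpath_class_self by (simp add: rot_class_def o_def linepath_refl rot_0)
  next
    case (step1 k)
    have "cloop [^]\<^bsub>G\<^esub> (k + 1) = cloop [^]\<^bsub>G\<^esub> k \<otimes>\<^bsub>G\<^esub> cloop"
      using G.int_pow_mult[OF c, of k 1] c by simp
    then show ?case using step1 step by simp
  next
    case (step2 k)
    have "cloop [^]\<^bsub>G\<^esub> (k - 1) = cloop [^]\<^bsub>G\<^esub> k \<otimes>\<^bsub>G\<^esub> inv\<^bsub>G\<^esub> cloop"
      using G.int_pow_diff[OF c, of k 1] c by simp
    also have "cloop [^]\<^bsub>G\<^esub> k = rot_class 0 (of_int (k - 1) * period) \<otimes>\<^bsub>G\<^esub> cloop"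
      using step2 step[of "k - 1"] by simp
    also have "\<dots> \<otimes>\<^bsub>G\<^esub> inv\<^bsub>G\<^esub> cloop = rot_class 0 (of_int (k - 1) * period)"
      unfolding G.m_assoc[OF rc c G.inv_closed[OF c]] G.r_inv[OF c] G.r_one[OF rc] ..
    finally show ?case .
  qed
qed

lemma \<rho>_cloop: "\<rho> cloop = path_class PX (\<lambda>_. proj_pt x0)"
proof -
  have "pathin X (rot \<circ> linepath 0 period)" by (rule pathin_linepath[OF continuous_map_rot]) simp_all
  moreover have "proj_pt \<circ> (rot \<circ> linepath 0 period) = (\<lambda>_. proj_pt x0)"
    by (auto simp: rot_def proj_pt_scale)
  ultimately show ?thesis
    unfolding cloop_def rot_class_def using pi1_map_path_class[OF continuous_map_proj_pt] by metis
qed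

lemma continuous_map_square:
  assumes h: "continuous_on {0..1} h" and m: "pathin X m"
  shows "continuous_map (top_of_set ({0..1::real} \<times> {0..1::real})) X (\<lambda>z. exp (h (fst z)) *s m (snd z))"
proof -
  have m': "continuous_on {0..1} m" "m ` {0..1} \<subseteq> U" using m by (auto simp: pathin_def X_eq)
  have "continuous_on ({0..1::real} \<times> {0..1::real}) (\<lambda>z. h (fst z))"
    by (rule continuous_on_compose2[OF h continuous_on_fst[OF continuous_on_id]]) auto
  moreover have "continuous_on ({0..1::real} \<times> {0..1::real}) (\<lambda>z. m (snd z))"
    by (rule continuous_on_compose2[OF m'(1) continuous_on_snd[OF continuous_on_id]]) auto
  ultimately have "continuous_on ({0..1::real} \<times> {0..1::real}) (\<lambda>z. exp (h (fst z)) *s m (snd z))"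
    by (intro continuous_on_vector_smult continuous_on_exp)
  moreover have "exp (h s) *s m t \<in> U" if "t \<in> {0..1}" for s t
    using m'(2) that by (intro U_scale) auto
  ultimately show ?thesis unfolding X_eq by auto
qed

text \<open>The map \<open>(s, t) \<mapsto> exp (h s) *s m t\<close> is defined on a square, whose
  diagonal is homotopic to either pair of sides joining the same corners. So moving the vector first
  or the scalar first gives the class in which both move together.\<close>

lemma class_concat_square:
  assumes h: "continuous_on {0..1} h" and m: "pathin X m"
  shows "class_concat X (path_class X (\<lambda>t. exp (h 0) *s m t)) (path_class X (\<lambda>t. exp (h t) *s m 1))
      = path_class X (\<lambda>t. exp (h t) *s m t)"
    and "class_concat X (path_class X (\<lambda>t. exp (h t) *s m 0)) (path_class X (\<lambda>t. exp (h 1) *s m t))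
      = path_class X (\<lambda>t. exp (h t) *s m t)"
proof -
  let ?F = "\<lambda>z. exp (h (fst z)) *s m (snd z)"
  have F: "continuous_map (top_of_set ({0..1::real} \<times> {0..1::real})) X ?F"
    by (rule continuous_map_square[OF assms])
  have K: "convex ({0..1::real} \<times> {0..1::real})" by (intro convex_Times convex_real_interval)
  have "class_concat X (path_class X (?F \<circ> (\<lambda>t. (0, t)))) (path_class X (?F \<circ> (\<lambda>t. (t, 1))))
      = path_class X (?F \<circ> (\<lambda>t. (t, t)))"
    by (rule class_concat_convex[OF F K]) (auto intro!: continuous_on_Pair continuous_on_const continuous_on_id)
  then show "class_concat X (path_class X (\<lambda>t. exp (h 0) *s m t)) (path_class X (\<lambda>t. exp (h t) *s m 1))
      = path_class X (\<lambda>t. exp (h t) *s m t)" by (simp add: o_def)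
  have "class_concat X (path_class X (?F \<circ> (\<lambda>t. (t, 0)))) (path_class X (?F \<circ> (\<lambda>t. (1, t))))
      = path_class X (?F \<circ> (\<lambda>t. (t, t)))"
    by (rule class_concat_convex[OF F K]) (auto intro!: continuous_on_Pair continuous_on_const continuous_on_id)
  then show "class_concat X (path_class X (\<lambda>t. exp (h t) *s m 0)) (path_class X (\<lambda>t. exp (h 1) *s m t))
      = path_class X (\<lambda>t. exp (h t) *s m t)" by (simp add: o_def)
qed

text \<open>With \<open>h\<close> running once through the period and \<open>m\<close> the given
  loop, the two ways around the square are the two products.\<close>

lemma cloop_central:
  assumes a: "a \<in> path_classes X x0 x0"
  shows "class_concat X a cloop = class_concat X cloop a"
proof -
  obtain p where p: "pathin X p" "p 0 = x0" "p 1 = x0" "a = path_class X p"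
    using a by (elim path_classesE)
  define h where "h = linepath 0 period"
  have h: "continuous_on {0..1} h" "h 0 = 0" "exp (h 1) = 1"
    using exp_period[of 0 1] unfolding h_def by (simp_all only: continuous_on_linepath linepath_0' linepath_1') simp_all
  have "cloop = path_class X (\<lambda>t. exp (h t) *s x0)"
    by (simp add: cloop_def rot_class_def rot_def o_def h_def)
  then show ?thesis
    using class_concat_square[OF h(1) p(1)] by (simp add: h p)
qed

text \<open>Comparing a loop with its normalization gives a nonvanishing function on the unit
  interval, which has a continuous logarithm \<open>h\<close>. The loop is then
  \<open>exp (h t)\<close> times the normalized loop, and the square separates the two factors.
  Since the loop is closed, \<open>h\<close> ends at an integer multiple of the period.\<close>

lemma \<tau>_\<rho>:
  assumes a: "a \<in> path_classes X x0 x0"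
  obtains k :: int where "a = class_concat X (\<tau> (\<rho> a)) (cloop [^]\<^bsub>G\<^esub> k)"
proof -
  obtain p where p: "pathin X p" "p 0 = x0" "p 1 = x0" "a = path_class X p"
    using a by (elim path_classesE)
  have p': "continuous_on {0..1} p" "\<And>t. t \<in> {0..1} \<Longrightarrow> p t \<in> U" using p(1) by (auto simp: pathin_def X_eq)
  define \<mu> where "\<mu> t = lf H0 (p t) / lf H0 x0" for t
  have lfx0: "lf H0 x0 \<noteq> 0" using x0_U H0 by (simp add: U_def)
  have lfp: "lf H0 (p t) \<noteq> 0" if "t \<in> {0..1}" for t using p'(2)[OF that] H0 by (simp add: U_def)
  have "continuous_on {0..1} \<mu>"
    unfolding \<mu>_def
    by (intro continuous_on_divide continuous_on_const
        continuous_on_compose2[OF continuous_on_complex_functional[OF functional[OF H0]] p'(1)]) (use lfx0 in auto)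
  then obtain g where g: "continuous_on {0..1} g" "\<And>t. t \<in> {0..1} \<Longrightarrow> \<mu> t = exp (g t)"
    using continuous_logarithm_on_contractible[of "{0..1::real}" \<mu>] lfp lfx0
    by (auto simp: \<mu>_def convex_imp_contractible)
  \<comment> \<open>Subtracting the initial value makes the logarithm start at 0 itself and not
    merely at some multiple of the period.\<close>
  define h where "h t = g t - g 0" for t
  have h: "continuous_on {0..1} h" "h 0 = 0"
    unfolding h_def by (auto intro: continuous_on_diff g(1))
  have \<mu>0: "\<mu> 0 = 1" "\<mu> 1 = 1" using lfx0 by (simp_all add: \<mu>_def p)
  have \<mu>h: "\<mu> t = exp (h t)" if "t \<in> {0..1}" for t
    using g(2)[OF that] g(2)[of 0] \<mu>0(1) by (simp add: h_def exp_diff)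
  have "exp (h 1) = 1" using \<mu>h[of 1] \<mu>0(2) by simp
  then obtain k :: int where "Re (h 1) = 0" "Im (h 1) = of_int (2 * k) * pi" unfolding exp_eq_1 by blast
  then have k: "h 1 = of_int k * period" by (simp add: complex_eq_iff period_def)
  define m where "m = sect \<circ> (proj_pt \<circ> p)"
  have m: "pathin X m"
    unfolding m_def by (intro pathin_compose[OF continuous_map_sect] pathin_compose[OF continuous_map_proj_pt] p)
  have m1: "m 1 = x0" unfolding m_def using p(3) sect_base by simp
  have "p t = exp (h t) *s m t" if "t \<in> {0..1}" for t
    unfolding m_def comp_apply sect_proj_pt[OF p'(2)[OF that]] \<mu>h[OF that, symmetric] \<mu>_def
    using lfx0 lfp[OF that] by (simp add: vector_smult_assoc)
  then have "a = path_class X (\<lambda>t. exp (h t) *s m t)"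
    unfolding p(4) by (rule path_class_cong[OF p(1)])
  also have "\<dots> = class_concat X (path_class X m) (path_class X (rot \<circ> h))"
    using class_concat_square(1)[OF h(1) m] by (simp add: h(2) m1 rot_def o_def)
  also have "path_class X (rot \<circ> h) = path_class X (rot \<circ> linepath 0 (of_int k * period))"
    by (rule path_class_convex[OF continuous_map_rot convex_UNIV h(1) _ continuous_on_linepath]) (simp_all add: h(2) k linepath_0' linepath_1')
  also have "\<dots> = cloop [^]\<^bsub>G\<^esub> k" unfolding cloop_pow rot_class_def ..
  also have "path_class X m = \<tau> (\<rho> a)"
    unfolding p(4) m_def pi1_map_path_class[OF continuous_map_proj_pt p(1)]
      pi1_map_path_class[OF continuous_map_sect pathin_compose[OF continuous_map_proj_pt p(1)]] ..
  finally show thesis by (rule that)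
qed

text \<open>Both classes are the same section class followed by powers of the central loop.\<close>

lemma \<rho>_fibre:
  assumes a: "a \<in> path_classes X x0 x0" and b: "b \<in> path_classes X x0 x0" and eq: "\<rho> a = \<rho> b"
  shows "\<exists>k::int. b = a \<otimes>\<^bsub>G\<^esub> cloop [^]\<^bsub>G\<^esub> k"
proof -
  interpret G: group G by (rule group_pi1[OF x0_X])
  have c: "cloop \<in> carrier G" using cloop by simp
  obtain k :: int where k: "a = class_concat X (\<tau> (\<rho> a)) (cloop [^]\<^bsub>G\<^esub> k)" using \<tau>_\<rho>[OF a] .
  obtain l :: int where l: "b = class_concat X (\<tau> (\<rho> a)) (cloop [^]\<^bsub>G\<^esub> l)" using \<tau>_\<rho>[OF b] unfolding eq .
  have s: "\<tau> (\<rho> a) \<in> carrier G" using \<tau>_closed[OF \<rho>_closed[OF a]] by simp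
  have "a \<otimes>\<^bsub>G\<^esub> cloop [^]\<^bsub>G\<^esub> (l - k) = (\<tau> (\<rho> a) \<otimes>\<^bsub>G\<^esub> cloop [^]\<^bsub>G\<^esub> k) \<otimes>\<^bsub>G\<^esub> cloop [^]\<^bsub>G\<^esub> (l - k)"
    using k by simp
  also have "\<dots> = \<tau> (\<rho> a) \<otimes>\<^bsub>G\<^esub> (cloop [^]\<^bsub>G\<^esub> k \<otimes>\<^bsub>G\<^esub> cloop [^]\<^bsub>G\<^esub> (l - k))"
    by (rule G.m_assoc[OF s G.int_pow_closed[OF c] G.int_pow_closed[OF c]])
  also have "\<dots> = b" using l G.int_pow_mult[OF c, of k "l - k"] by simp
  finally show ?thesis by metis
qed

lemma \<rho>_surj: "\<rho> ` carrier G = carrier (pi1 PX (proj_pt x0))"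
proof (rule equalityI; rule subsetI)
  fix b assume "b \<in> \<rho> ` carrier G"
  then show "b \<in> carrier (pi1 PX (proj_pt x0))" using \<rho>_closed by auto
next
  fix b assume "b \<in> carrier (pi1 PX (proj_pt x0))"
  then have b: "b \<in> path_classes PX (proj_pt x0) (proj_pt x0)" by simp
  show "b \<in> \<rho> ` carrier G" using \<rho>_\<tau>[OF b] \<tau>_closed[OF b] by (intro image_eqI[of _ _ "\<tau> b"]) simp_all
qed

subsection \<open>Comparison of the invariants\<close>

lemma pullback_eval:
  "a \<in> path_classes X x0 x0 \<Longrightarrow> pullback_char X x0 PX proj_pt \<psi> a = \<psi> (\<rho> a)"
  by (simp add: pullback_char_def)

lemma pullback_nonzero:
  assumes \<psi>: "\<psi> \<in> H1_real PX (proj_pt x0) - {zero_char PX (proj_pt x0)}"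
  shows "pullback_char X x0 PX proj_pt \<psi> \<in> H1_real X x0 - {zero_char X x0}"
proof -
  obtain u where u: "u \<in> path_classes PX (proj_pt x0) (proj_pt x0)" "\<psi> u \<noteq> 0" using H1_real_nonzero[OF \<psi>] .
  have "pullback_char X x0 PX proj_pt \<psi> (\<tau> u) \<noteq> zero_char X x0 (\<tau> u)"
    using u \<tau>_closed[OF u(1)] by (simp add: pullback_eval \<rho>_\<tau> zero_char_def)
  then show ?thesis using pullback_char_H1_real[OF continuous_map_proj_pt] \<psi> by auto
qed

lemma Sigma1_pullback_iff:
  assumes \<psi>: "\<psi> \<in> H1_real PX (proj_pt x0) - {zero_char PX (proj_pt x0)}"
  shows "char_ray X x0 (pullback_char X x0 PX proj_pt \<psi>) \<in> Sigma1 X x0 \<longleftrightarrow>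
    char_ray PX (proj_pt x0) \<psi> \<in> Sigma1 PX (proj_pt x0)"
proof -
  let ?H = "pi1 PX (proj_pt x0)"
  have "halfspace_connected G (pullback_char X x0 PX proj_pt \<psi>) \<longleftrightarrow> halfspace_connected ?H \<psi>"
  proof (rule halfspace_connected_quotient[OF group_pi1[OF x0_X] group_pi1[OF y0_PX]
        pi1_map_hom[OF continuous_map_proj_pt] \<rho>_surj])
    show "cloop \<in> carrier G" using cloop by simp
    show "\<rho> cloop = \<one>\<^bsub>?H\<^esub>" using \<rho>_cloop by simp
    show "pullback_char X x0 PX proj_pt \<psi> g = \<psi> (\<rho> g)" if "g \<in> carrier G" for g
      using that pullback_eval by simp
    show "\<psi> (a \<otimes>\<^bsub>?H\<^esub> b) = \<psi> a + \<psi> b" if "a \<in> carrier ?H" "b \<in> carrier ?H" for a b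
      using H1_real_mult[of \<psi> PX "proj_pt x0" a b] \<psi> that by simp
    show "\<exists>k::int. b = a \<otimes>\<^bsub>G\<^esub> cloop [^]\<^bsub>G\<^esub> k" if "a \<in> carrier G" "b \<in> carrier G" "\<rho> a = \<rho> b" for a b
      using \<rho>_fibre that by simp
  qed
  then show ?thesis
    using Sigma1_iff[OF semilocally_1_connected_X x0_X pullback_nonzero[OF \<psi>]]
      Sigma1_iff[OF semilocally_1_connected_PX y0_PX \<psi>] by simp
qed

lemma Sigma1_off_center:
  assumes \<phi>: "\<phi> \<in> H1_real X x0 - {zero_char X x0}" and c: "\<phi> cloop \<noteq> 0"
  shows "char_ray X x0 \<phi> \<in> Sigma1 X x0"
proof -
  interpret G: group G by (rule group_pi1[OF x0_X])
  obtain S where S: "finite S" "S \<subseteq> carrier G" "generate G S = carrier G" by (rule pi1_X_finitely_generated)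
  have "halfspace_connected G \<phi>"
  proof (rule G.halfspace_connected_central[where c = cloop and Y = S])
    show "cloop \<in> carrier G" using cloop by simp
    show "\<phi> (a \<otimes>\<^bsub>G\<^esub> b) = \<phi> a + \<phi> b" if "a \<in> carrier G" "b \<in> carrier G" for a b
      using H1_real_mult[of \<phi> X x0 a b] \<phi> that by simp
    show "g \<otimes>\<^bsub>G\<^esub> cloop = cloop \<otimes>\<^bsub>G\<^esub> g" if "g \<in> carrier G" for g
      using cloop_central that by simp
  qed (rule c S)+
  then show ?thesis using Sigma1_iff[OF semilocally_1_connected_X x0_X \<phi>] by simp
qed

text \<open>The descended character is \<open>\<phi>\<close> composed with the map induced by the
  section. It pulls back to \<open>\<phi>\<close> because a class and the section of its projection
  differ by a power of \<open>cloop\<close>, on which \<open>\<phi>\<close> vanishes.\<close>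

lemma pullback_if_trivial_on_center:
  assumes \<phi>: "\<phi> \<in> H1_real X x0 - {zero_char X x0}" and c: "\<phi> cloop = 0"
  obtains \<psi> where "\<psi> \<in> H1_real PX (proj_pt x0) - {zero_char PX (proj_pt x0)}" "\<phi> = pullback_char X x0 PX proj_pt \<psi>"
proof -
  let ?y0 = "proj_pt x0"
  interpret G: group G by (rule group_pi1[OF x0_X])
  have cG: "cloop \<in> carrier G" using cloop by simp
  have mult: "\<phi> (class_concat X a b) = \<phi> a + \<phi> b" if "a \<in> path_classes X x0 x0" "b \<in> path_classes X x0 x0" for a b
    using H1_real_mult[OF _ that] \<phi> by simp
  have pow: "cloop [^]\<^bsub>G\<^esub> k \<in> path_classes X x0 x0" for k :: int
    using G.int_pow_closed[OF cG] by simp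
  have cpow: "\<phi> (cloop [^]\<^bsub>G\<^esub> k) = 0" for k :: int
  proof (induction k rule: int_induct[where k = 0])
    case base
    show ?case using mult[OF pow[of 0] pow[of 0]] class_concat_const_left[OF path_classes_const[OF x0_X]] by simp
  next
    case (step1 k)
    have "\<phi> (cloop [^]\<^bsub>G\<^esub> (k + 1)) = \<phi> (class_concat X (cloop [^]\<^bsub>G\<^esub> k) cloop)"
      using G.int_pow_mult[OF cG, of k 1] cG by simp
    then show ?case using mult[OF pow cloop] step1 c by simp
  next
    case (step2 k)
    have "\<phi> (cloop [^]\<^bsub>G\<^esub> k) = \<phi> (class_concat X (cloop [^]\<^bsub>G\<^esub> (k - 1)) cloop)"
      using G.int_pow_mult[OF cG, of "k - 1" 1] cG by simp
    then show ?case using mult[OF pow cloop] step2 c by simp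
  qed
  have \<phi>\<rho>: "\<phi> a = \<phi> (\<tau> (\<rho> a))" if a: "a \<in> path_classes X x0 x0" for a
  proof -
    obtain k :: int where k: "a = class_concat X (\<tau> (\<rho> a)) (cloop [^]\<^bsub>G\<^esub> k)" using \<tau>_\<rho>[OF a] .
    have "\<phi> a = \<phi> (class_concat X (\<tau> (\<rho> a)) (cloop [^]\<^bsub>G\<^esub> k))" using k by simp
    also have "\<dots> = \<phi> (\<tau> (\<rho> a))" using mult[OF \<tau>_closed[OF \<rho>_closed[OF a]] pow] cpow by simp
    finally show ?thesis .
  qed
  define \<psi> where "\<psi> = (\<lambda>b\<in>path_classes PX ?y0 ?y0. \<phi> (\<tau> b))"
  have \<psi>: "\<psi> \<in> H1_real PX ?y0"
  proof (rule H1_realI)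
    fix a b assume a: "a \<in> path_classes PX ?y0 ?y0" and b: "b \<in> path_classes PX ?y0 ?y0"
    show "\<psi> (class_concat PX a b) = \<psi> a + \<psi> b"
      using a b path_classes_concat[OF a b] mult[OF \<tau>_closed[OF a] \<tau>_closed[OF b]] pi1_map_concat[OF continuous_map_sect a b]
      by (simp add: \<psi>_def)
  qed (simp add: \<psi>_def)
  have eq: "\<phi> = pullback_char X x0 PX proj_pt \<psi>"
  proof (rule extensionalityI)
    show "\<phi> \<in> extensional (carrier G)" using \<phi> by (simp add: H1_real_def)
    show "pullback_char X x0 PX proj_pt \<psi> \<in> extensional (carrier G)" unfolding pullback_char_def by simp
    show "\<phi> a = pullback_char X x0 PX proj_pt \<psi> a" if "a \<in> carrier G" for a
      using that \<phi>\<rho> \<rho>_closed by (simp add: pullback_eval \<psi>_def)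
  qed
  have "\<psi> \<noteq> zero_char PX ?y0"
  proof
    assume z: "\<psi> = zero_char PX ?y0"
    obtain u where u: "u \<in> path_classes X x0 x0" "\<phi> u \<noteq> 0" using H1_real_nonzero[OF \<phi>] .
    have "\<psi> (\<rho> u) = 0" using \<rho>_closed[OF u(1)] unfolding z zero_char_def by simp
    then show False using \<phi>\<rho>[OF u(1)] \<rho>_closed[OF u(1)] u(2) by (simp add: \<psi>_def)
  qed
  then show thesis using that \<psi> eq by blast
qed

text \<open>A ray comes from the projectivization exactly if its characters vanish on
  \<open>cloop\<close>, which projects to a trivial loop. Off this locus the ray always belongs to
  the invariant; on it, membership is that of the descended character.\<close>

lemma Sigma1_arr_ray_iff:
  assumes r: "r \<in> S_arr A x0"
  shows "r \<in> Sigma1_arr A x0 \<longleftrightarrow> (r \<in> S_proj_arr A x0 \<longrightarrow> r \<in> Sigma1_proj_arr A x0)"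
proof -
  note pr = pullback_ray_char_ray[OF continuous_map_proj_pt, of x0]
  obtain \<phi> where \<phi>: "\<phi> \<in> H1_real X x0 - {zero_char X x0}" "r = char_ray X x0 \<phi>"
    using r unfolding S_arr_def char_sphere_def by blast
  show ?thesis
  proof (cases "\<phi> cloop = 0")
    case False
    have "r \<notin> S_proj_arr A x0"
    proof
      assume "r \<in> S_proj_arr A x0"
      then obtain \<psi> where \<psi>': "\<psi> \<in> H1_real PX (proj_pt x0) - {zero_char PX (proj_pt x0)}"
          "char_ray X x0 \<phi> = pullback_ray X x0 PX proj_pt (char_ray PX (proj_pt x0) \<psi>)"
        unfolding S_proj_arr_def char_sphere_def \<phi>(2) by blast
      then have \<psi>: "\<psi> \<in> H1_real PX (proj_pt x0)"
          "char_ray X x0 \<phi> = char_ray X x0 (pullback_char X x0 PX proj_pt \<psi>)"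
        unfolding pr by blast+
      obtain d where d: "\<And>g. g \<in> path_classes X x0 x0 \<Longrightarrow> \<phi> g = d * pullback_char X x0 PX proj_pt \<psi> g"
        using char_ray_eqD[OF \<psi>(2)] by blast
      let ?e = "path_class PX (\<lambda>_. proj_pt x0)"
      have e: "?e \<in> path_classes PX (proj_pt x0) (proj_pt x0)" by (rule path_classes_const[OF y0_PX])
      have "\<psi> ?e = 0" using H1_real_mult[OF \<psi>(1) e e] class_concat_const_left[OF e] by simp
      then have "\<phi> cloop = 0" using d[OF cloop] by (simp add: pullback_eval[OF cloop] \<rho>_cloop)
      then show False using False by simp
    qed
    then show ?thesis
      using Sigma1_off_center[OF \<phi>(1) False] unfolding Sigma1_arr_def \<phi>(2) by simp
  next
    case True
    obtain \<psi> where \<psi>: "\<psi> \<in> H1_real PX (proj_pt x0) - {zero_char PX (proj_pt x0)}" "\<phi> = pullback_char X x0 PX proj_pt \<psi>"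
      by (rule pullback_if_trivial_on_center[OF \<phi>(1) True])
    have r_eq: "r = pullback_ray X x0 PX proj_pt (char_ray PX (proj_pt x0) \<psi>)"
      unfolding pr \<phi>(2) \<psi>(2) ..
    have S: "r \<in> S_proj_arr A x0"
      unfolding S_proj_arr_def char_sphere_def r_eq using \<psi>(1) by blast
    have "r \<in> Sigma1_proj_arr A x0" if "r \<in> Sigma1_arr A x0"
    proof -
      have "char_ray PX (proj_pt x0) \<psi> \<in> Sigma1 PX (proj_pt x0)"
        using that Sigma1_pullback_iff[OF \<psi>(1)] unfolding Sigma1_arr_def \<phi>(2) \<psi>(2) by simp
      then show ?thesis unfolding Sigma1_proj_arr_def r_eq by blast
    qed
    \<comment> \<open>The argument runs with a character of \<open>r1\<close> itself, which avoids
      showing that the pullback of rays is injective.\<close>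
    moreover have "r \<in> Sigma1_arr A x0" if r: "r \<in> Sigma1_proj_arr A x0"
    proof -
      obtain r1 where r1: "r1 \<in> Sigma1 PX (proj_pt x0)" "r = pullback_ray X x0 PX proj_pt r1"
        using r unfolding Sigma1_proj_arr_def by blast
      obtain \<psi>' where \<psi>': "r1 = char_ray PX (proj_pt x0) \<psi>'"
          "\<psi>' \<in> H1_real PX (proj_pt x0) - {zero_char PX (proj_pt x0)}"
        using r1(1) Sigma1_subset[of PX "proj_pt x0"] unfolding char_sphere_def by blast
      have "r = char_ray X x0 (pullback_char X x0 PX proj_pt \<psi>')" unfolding r1(2) \<psi>'(1) pr ..
      then show ?thesis
        using Sigma1_pullback_iff[OF \<psi>'(2)] r1(1) unfolding Sigma1_arr_def \<psi>'(1) by simp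
    qed
    ultimately show ?thesis using S by blast
  qed
qed

end

text \<open>Without hyperplanes the complement is a vector space, so its loops are contractible and
  it has no nonzero characters. The case is treated apart because there is no hyperplane to
  normalize with.\<close>

lemma S_arr_empty: "S_arr {} x0 = {}"
proof -
  have X: "arr_compl {} = (top_of_set UNIV :: (complex ^ 'n) topology)" by (simp add: arr_compl_def)
  let ?X = "top_of_set UNIV :: (complex ^ 'n) topology"
  let ?e = "path_class ?X (\<lambda>_. x0)"
  have triv: "a = ?e" if a: "a \<in> path_classes ?X x0 x0" for a
  proof -
    obtain p where p: "pathin ?X p" "p 0 = x0" "p 1 = x0" "a = path_class ?X p"
      using a by (elim path_classesE)
    show ?thesis
      unfolding p(4) by (rule path_class_convex_subset[of UNIV]) (use p in \<open>auto simp: pathin_def\<close>)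
  qed
  have "\<phi> u = 0" if "\<phi> \<in> H1_real ?X x0" "u \<in> path_classes ?X x0 x0" for \<phi> u
  proof -
    have "class_concat ?X u u = u"
      using triv[OF path_classes_concat[OF that(2,2)]] triv[OF that(2)] by simp
    then show ?thesis using H1_real_mult[OF that(1,2,2)] by simp
  qed
  then have "H1_real ?X x0 - {zero_char ?X x0} = {}" using H1_real_nonzero[of _ ?X x0] by blast
  then show ?thesis unfolding S_arr_def char_sphere_def X by simp
qed

theorem proposition9p8:
  fixes A :: "(complex ^ 'n) set set" and x0 :: "complex ^ 'n"
  assumes "central_arrangement A"
    and "x0 \<in> topspace (arr_compl A)" and "x0 \<noteq> 0"
  shows "Sigma1_arr A x0 = S_arr A x0 - (S_proj_arr A x0 - Sigma1_proj_arr A x0)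
       \<and> S_arr A x0 - S_proj_arr A x0 \<subseteq> Sigma1_arr A x0"
proof -
  have sub: "Sigma1_arr A x0 \<subseteq> S_arr A x0"
    unfolding Sigma1_arr_def S_arr_def by (rule Sigma1_subset)
  have "r \<in> Sigma1_arr A x0 \<longleftrightarrow> (r \<in> S_proj_arr A x0 \<longrightarrow> r \<in> Sigma1_proj_arr A x0)"
    if r: "r \<in> S_arr A x0" for r
  proof (cases "A = {}")
    case True
    then show ?thesis using r S_arr_empty by blast
  next
    case False
    then obtain H0 where H0: "H0 \<in> A" by blast
    have "\<exists>f. complex_functional f \<and> H = {v. f v = 0}" if "H \<in> A" for H
      using hyperplane_functional[of H] assms(1) that unfolding central_arrangement_def by metis
    then obtain lf where lf: "\<And>H. H \<in> A \<Longrightarrow> complex_functional (lf H) \<and> H = {v. lf H v = 0}" by metis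
    interpret pointed_arrangement A lf H0 x0
    proof
      show "finite A" using assms(1) by (simp add: central_arrangement_def)
      show "complex_functional (lf H)" if "H \<in> A" for H using lf[OF that] by blast
      show "H = {v. lf H v = 0}" if "H \<in> A" for H using lf[OF that] by blast
      show "H0 \<in> A" by (rule H0)
      show "x0 \<notin> \<Union>A" using assms(2) by (simp add: arr_compl_def)
    qed
    show ?thesis by (rule Sigma1_arr_ray_iff[OF r])
  qed
  then show ?thesis using sub by blast
qed

end
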